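(* Let $A=(a_{ij})\in \mathbf{RM}_n$ and $m=\lfloor n/2\rfloor$. Then for $$C(A)\supset E\cup(-E)\ \text{ with the ellipse } E \text{ different from } -E$$ to hold it is necessary and sufficient that $\xi_j:=(|a_{j,j+1}|-|a_{j+1,j}|)^2/4$ ($j=1,\dots,n-1$) satisfy the system of $2m-2$ homogeneous polynomial equations obtained as follows, for one of the $m(m-1)$ pairs $p,X>0$ such that $p+X$ and $p-X$ are non-zero eigenvalues of $A$. With $P_n$ as defined in the context, let $$\zeta_\pm=C+(p^2+X^2)\rho\pm 2p\sqrt{\rho(C+X^2\rho)},\qquad R_e=P_n(\zeta_+)+P_n(\zeta_-),\qquad R_o=\frac{P_n(\zeta_+)-P_n(\zeta_-)}{\sqrt{\rho(C+X^2\rho)}}.$$ These are polynomials in $\rho$ of degrees at most $m$ and $m-1$, respectively, whose coefficients of $\rho^m$ and $\rho^{m-1}$, respectively, vanish for the chosen $p,X$. The coefficients of $\rho^j$ in $R_e$ and $R_o$ are homogeneous polynomials in $C,\xi_1,\dots,\xi_{n-1}$ of degree $m-j$ and $m-j-1$, respectively. Equating the remaining $2m-1$ coefficients with zero, use the one corresponding to $\rho^{m-1}$ in $R_e$ (or $\rho^{m-2}$ in $R_o$) to express $C$ as a linear function of $\xi_1,\dots,\xi_{n-1}$, and substitute this expression into the remaining $2m-2$ equations.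
   Context: $\mathbf{RM}_n$ is the set of complex $n\times n$ tridiagonal matrices $A=(a_{ij})$ with zero main diagonal and $a_{i,i+1}a_{i+1,i}=1$ for $i=1,\dots,n-1$ (reciprocal matrices). Every $A\in\mathbf{RM}_n$ has spectrum $\{2\cos\frac{k\pi}{n+1}:k=1,\dots,n\}$. For a square matrix $A$, $\operatorname{Re}A=(A+A^* )/2$; the Kippenhahn polynomial of $A$ is $P_A(\lambda,\theta)=\det(\operatorname{Re}(e^{i\theta}A)-\lambda I)$, and the Kippenhahn curve $C(A)$ is the envelope of the family of lines $\{e^{-i\theta}(\lambda_j(\theta)+i\mathbb R):\theta\in(-\pi,\pi],\ j=1,\dots,n\}$, where $\lambda_j(\theta)$ are the roots of $P_A(\cdot,\theta)$. Put $\rho=\cos^2\theta$, $\zeta=\lambda^2$, and write $i\prec j$ if $i,j\in\mathbb N$ and $j-i>1$. For $A\in\mathbf{RM}_n$ one has $P_A(\lambda,\theta)=P_n(\lambda^2)$ if $n$ is even and $P_A(\lambda,\theta)=-\lambda P_n(\lambda^2)$ if $n$ is odd, where $P_n(\zeta)=\zeta^m+\sum_{j=0}^{m-1}p_j\zeta^j$ with $p_{m-j}=(-1)^j\sum_{1\le i_1\prec i_2\prec\cdots\prec i_j<n}\prod_{k=1}^j(\xi_{i_k}+\rho)$, $j=1,\dots,m$. Without loss of generality $E$ is the ellipse of the pair centered at $p>0$; $X$ is half the distance between its foci $p\pm X$, and $C$ is the square of the length of its minor half-axis.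
   Formalization: For a genuine ellipse E the system must also give C>0 (ξ=0 solves it with C=0, yet C(A) is finite); the system alone is equivalent to a genuine or degenerate (C=0, point foci) pair. C is expressed from whichever of R_e, R_o has a coefficient involving C; at least one does. *)

theory Defs
  imports
    Complex_Main
    "HOL-Computational_Algebra.Polynomial"
    "Jordan_Normal_Form.Char_Poly"
    "Jordan_Normal_Form.Schur_Decomposition"
begin

(* Matrix indices start at 0, so a_{i,j} of the usual 1-based notation is A $$ (i - 1, j - 1). *)

definition reciprocal_mats :: "nat \<Rightarrow> complex mat set" where
  "reciprocal_mats n = {A \<in> carrier_mat n n.
     (\<forall>i<n. \<forall>j<n. i \<noteq> Suc j \<and> j \<noteq> Suc i \<longrightarrow> A $$ (i, j) = 0) \<and>
     (\<forall>i. Suc i < n \<longrightarrow> A $$ (i, Suc i) * A $$ (Suc i, i) = 1)}"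

(* meaningful for 1 \<le> j < n *)
definition xi :: "complex mat \<Rightarrow> nat \<Rightarrow> real" where
  "xi A j = (cmod (A $$ (j - 1, j)) - cmod (A $$ (j, j - 1)))\<^sup>2 / 4"

definition re_part :: "complex mat \<Rightarrow> complex mat" where
  "re_part A = (1 / 2) \<cdot>\<^sub>m (A + mat_adjoint A)"

definition kippenhahn_poly :: "complex mat \<Rightarrow> complex \<Rightarrow> real \<Rightarrow> complex" where
  "kippenhahn_poly A l \<theta> =
     det (re_part (cis \<theta> \<cdot>\<^sub>m A) - l \<cdot>\<^sub>m 1\<^sub>m (dim_row A))"

(* The line exp(-i t) (l + i R) is {z. Re (cis t * z) = l}. The envelope consists of the points z
   satisfying F(z, t) = 0 and dF/dt (z, t) = 0 for F(z, t) = Re (cis t * z) - lam t, where lam is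
   a branch of the roots of the Kippenhahn polynomial near t. Working with branches instead of
   the product over all roots keeps crossing points of two branches from contributing
   whole lines. *)
definition kippenhahn_curve :: "complex mat \<Rightarrow> complex set" where
  "kippenhahn_curve A = {z. \<exists>\<theta> lam. - pi < \<theta> \<and> \<theta> \<le> pi \<and>
     (\<forall>\<^sub>F t in nhds \<theta>. kippenhahn_poly A (complex_of_real (lam t)) t = 0) \<and>
     Re (cis \<theta> * z) = lam \<theta> \<and>
     ((\<lambda>t. Re (cis t * z) - lam t) has_real_derivative 0) (at \<theta>)}"

(* every line of the pencil through f belongs to the family whose envelope is the curve *)
definition pencil_in_family :: "complex mat \<Rightarrow> complex \<Rightarrow> bool" where
  "pencil_in_family A f \<longleftrightarrow>
     (\<forall>\<theta>. kippenhahn_poly A (complex_of_real (Re (cis \<theta> * f))) \<theta> = 0)"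

(* non-degenerate ellipses, circles included *)
definition is_ellipse :: "complex set \<Rightarrow> bool" where
  "is_ellipse E \<longleftrightarrow>
     (\<exists>f g s. dist f g < s \<and> E = {z. dist z f + dist z g = s})"

(* i_1 \<prec> ... \<prec> i_j corresponds to the set {i_1, ..., i_j} *)
definition sparse_subsets :: "nat \<Rightarrow> nat \<Rightarrow> nat set set" where
  "sparse_subsets n j =
     {S. S \<subseteq> {1..<n} \<and> card S = j \<and> (\<forall>a\<in>S. \<forall>b\<in>S. a < b \<longrightarrow> b - a > 1)}"

definition p_coeff :: "nat \<Rightarrow> (nat \<Rightarrow> real) \<Rightarrow> real \<Rightarrow> nat \<Rightarrow> real" where
  "p_coeff n x \<rho> i = (let j = n div 2 - i in
     (-1) ^ j * (\<Sum>S\<in>sparse_subsets n j. \<Prod>k\<in>S. x k + \<rho>))"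

definition P :: "nat \<Rightarrow> (nat \<Rightarrow> real) \<Rightarrow> real \<Rightarrow> complex \<Rightarrow> complex" where
  "P n x \<rho> \<zeta> =
     \<zeta> ^ (n div 2) + (\<Sum>j<n div 2. complex_of_real (p_coeff n x \<rho> j) * \<zeta> ^ j)"

(* The complex square root makes the formulas valid for C and \<rho> of any sign;
   R_even_fun and R_odd_fun do not depend on its branch. *)
definition root_term :: "real \<Rightarrow> real \<Rightarrow> real \<Rightarrow> complex" where
  "root_term X C \<rho> = csqrt (complex_of_real (\<rho> * (C + X\<^sup>2 * \<rho>)))"

definition zeta_plus :: "real \<Rightarrow> real \<Rightarrow> real \<Rightarrow> real \<Rightarrow> complex" where
  "zeta_plus p X C \<rho> =
     complex_of_real (C + (p\<^sup>2 + X\<^sup>2) * \<rho>) + 2 * complex_of_real p * root_term X C \<rho>"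

definition zeta_minus :: "real \<Rightarrow> real \<Rightarrow> real \<Rightarrow> real \<Rightarrow> complex" where
  "zeta_minus p X C \<rho> =
     complex_of_real (C + (p\<^sup>2 + X\<^sup>2) * \<rho>) - 2 * complex_of_real p * root_term X C \<rho>"

definition R_even_fun :: "nat \<Rightarrow> real \<Rightarrow> real \<Rightarrow> real \<Rightarrow> (nat \<Rightarrow> real) \<Rightarrow> real \<Rightarrow> complex" where
  "R_even_fun n p X C x \<rho> = P n x \<rho> (zeta_plus p X C \<rho>) + P n x \<rho> (zeta_minus p X C \<rho>)"

definition R_odd_fun :: "nat \<Rightarrow> real \<Rightarrow> real \<Rightarrow> real \<Rightarrow> (nat \<Rightarrow> real) \<Rightarrow> real \<Rightarrow> complex" where
  "R_odd_fun n p X C x \<rho> =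
     (P n x \<rho> (zeta_plus p X C \<rho>) - P n x \<rho> (zeta_minus p X C \<rho>)) / root_term X C \<rho>"

definition represents_R_even ::
  "nat \<Rightarrow> real \<Rightarrow> real \<Rightarrow> real \<Rightarrow> (nat \<Rightarrow> real) \<Rightarrow> real poly \<Rightarrow> bool" where
  "represents_R_even n p X C x q \<longleftrightarrow>
     (\<forall>\<rho>. complex_of_real (poly q \<rho>) = R_even_fun n p X C x \<rho>)"

definition represents_R_odd ::
  "nat \<Rightarrow> real \<Rightarrow> real \<Rightarrow> real \<Rightarrow> (nat \<Rightarrow> real) \<Rightarrow> real poly \<Rightarrow> bool" where
  "represents_R_odd n p X C x q \<longleftrightarrow>
     (\<forall>\<rho>. \<rho> * (C + X\<^sup>2 * \<rho>) \<noteq> 0 \<longrightarrow> complex_of_real (poly q \<rho>) = R_odd_fun n p X C x \<rho>)"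

definition R_even :: "nat \<Rightarrow> real \<Rightarrow> real \<Rightarrow> real \<Rightarrow> (nat \<Rightarrow> real) \<Rightarrow> real poly" where
  "R_even n p X C x = (THE q. represents_R_even n p X C x q)"

(* unique for X \<noteq> 0, because then the excluded set of \<rho> is finite *)
definition R_odd :: "nat \<Rightarrow> real \<Rightarrow> real \<Rightarrow> real \<Rightarrow> (nat \<Rightarrow> real) \<Rightarrow> real poly" where
  "R_odd n p X C x = (THE q. represents_R_odd n p X C x q)"

definition focal_pairs :: "complex mat \<Rightarrow> (real \<times> real) set" where
  "focal_pairs A = {(p, X). 0 < p \<and> 0 < X \<and> p + X \<noteq> 0 \<and> p - X \<noteq> 0 \<and>
     eigenvalue A (complex_of_real (p + X)) \<and> eigenvalue A (complex_of_real (p - X))}"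

(* F is a homogeneous polynomial of degree d in the variables v i, i \<in> I *)
definition homogeneous_form :: "nat set \<Rightarrow> nat \<Rightarrow> ((nat \<Rightarrow> real) \<Rightarrow> real) \<Rightarrow> bool" where
  "homogeneous_form I d F \<longleftrightarrow>
     (\<exists>c :: (nat \<Rightarrow> nat) \<Rightarrow> real. \<forall>v.
        F v = (\<Sum>a | (\<forall>i. i \<notin> I \<longrightarrow> a i = 0) \<and> (\<Sum>i\<in>I. a i) = d. c a * (\<Prod>i\<in>I. v i ^ a i)))"

(* Which coefficient is used to express C. Either one may fail to involve C: for n = 9 and
   foci 2 cos (\<pi>/5), 2 cos (2\<pi>/5), the coefficient of R_even of degree m - 1 does not. *)
datatype elim_source = From_even | From_odd

fun elim_coeff :: "nat \<Rightarrow> real \<Rightarrow> real \<Rightarrow> elim_source \<Rightarrow> real \<Rightarrow> (nat \<Rightarrow> real) \<Rightarrow> real" where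
  "elim_coeff n p X From_even C x = coeff (R_even n p X C x) (n div 2 - 1)"
| "elim_coeff n p X From_odd C x = coeff (R_odd n p X C x) (n div 2 - 2)"

(* elim_coeff is linear in C and x jointly, so its C-coefficient is its value at C = 1, x = 0 *)
definition can_eliminate :: "nat \<Rightarrow> real \<Rightarrow> real \<Rightarrow> elim_source \<Rightarrow> bool" where
  "can_eliminate n p X e \<longleftrightarrow> elim_coeff n p X e 1 (\<lambda>_. 0) \<noteq> 0"

definition elim_C :: "nat \<Rightarrow> real \<Rightarrow> real \<Rightarrow> elim_source \<Rightarrow> (nat \<Rightarrow> real) \<Rightarrow> real" where
  "elim_C n p X e x = - elim_coeff n p X e 0 x / elim_coeff n p X e 1 (\<lambda>_. 0)"

fun reduced_system ::
  "nat \<Rightarrow> real \<Rightarrow> real \<Rightarrow> elim_source \<Rightarrow> ((nat \<Rightarrow> real) \<Rightarrow> real) list" where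
  "reduced_system n p X From_even =
     map (\<lambda>j x. coeff (R_even n p X (elim_C n p X From_even x) x) j) [0..<n div 2 - 1] @
     map (\<lambda>j x. coeff (R_odd n p X (elim_C n p X From_even x) x) j) [0..<n div 2 - 1]"
| "reduced_system n p X From_odd =
     map (\<lambda>j x. coeff (R_even n p X (elim_C n p X From_odd x) x) j) [0..<n div 2] @
     map (\<lambda>j x. coeff (R_odd n p X (elim_C n p X From_odd x) x) j) [0..<n div 2 - 2]"

definition solves :: "((nat \<Rightarrow> real) \<Rightarrow> real) list \<Rightarrow> (nat \<Rightarrow> real) \<Rightarrow> bool" where
  "solves Fs x \<longleftrightarrow> (\<forall>F\<in>set Fs. F x = 0)"

end

theory Submission
  imports Defs "HOL-Computational_Algebra.Field_as_Ring"
begin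

text \<open>
  The matrix \<open>Re (cis \<theta> * A)\<close> is tridiagonal, and the products of its off-diagonal entries are
  \<open>\<xi>\<^sub>k + cos\<^sup>2 \<theta>\<close>, so everything about \<open>A\<close> is encoded in a three-term recurrence. A line
  tangent to the ellipse centred at \<open>p\<close> with foci \<open>p \<plusminus> X\<close> and squared minor half-axis \<open>C\<close> has
  \<open>\<lambda> = p cos \<theta> \<plusminus> sqrt (C + X\<^sup>2 cos\<^sup>2 \<theta>)\<close>, and then \<open>\<lambda>\<^sup>2\<close> is \<open>\<zeta>\<^sub>\<plusminus>\<close>. Hence vanishing of \<open>R\<^sub>e\<close> and
  \<open>R\<^sub>o\<close> says that all tangents of \<open>E\<close> and \<open>-E\<close> belong to the family.

  For the converse put \<open>t = - tan \<theta>\<close>. A point \<open>z\<close> of the curve yields a multiple root of the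
  polynomial in \<open>t\<close> obtained by restricting the family to the pencil through \<open>z\<close>. Let \<open>z\<close> run
  along a rational parametrization of \<open>E\<close>. By an algebraic Sard theorem the derivative along \<open>E\<close>
  vanishes at all but finitely many of these points, and since the roots of the recurrence are
  simple, the line is tangent to \<open>E\<close>. So infinitely many tangents belong to the family, and the
  dual conic, being prime, divides the polynomial of the family. At \<open>t = \<i>\<close> this divisibility
  shows that the foci are distinct eigenvalues of \<open>A\<close>.
\<close>

section \<open>Continuants\<close>

text \<open>The definition of the curve only provides, for each point of \<open>E\<close>, some
  branch of roots touching there. Different points may use different branches, and nothing says that
  the touching line is tangent to \<open>E\<close>. This is the obstacle, and the reason for an
  algebraic argument with all points of \<open>E\<close> at once instead of following one branch.
  The parameter \<open>t\<close> makes both the family and the dual of \<open>E\<close> polynomial.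
  The value \<open>t = \<i>\<close> is an isotropic direction: the tangents of a conic in it pass
  through the foci (Pluecker), while the dependence on \<open>xi\<close> disappears, leaving the
  Chebyshev polynomial common to all reciprocal matrices. Its zeros are real and simple. A solution
  of the equations always has \<open>0 \<le> C\<close>, since the continuants involved have only
  real zeros. For \<open>C = 0\<close> the dual conic splits into the pencils of lines through the
  two foci. Hence the theorem has one equivalence for genuine ellipses, with \<open>0 < C\<close>,
  and another that admits such pairs of pencils.\<close>

fun ctn :: "(nat \<Rightarrow> 'a::comm_ring_1) \<Rightarrow> 'a \<Rightarrow> nat \<Rightarrow> 'a" where
  "ctn b l 0 = 1"
| "ctn b l (Suc 0) = l"
| "ctn b l (Suc (Suc k)) = l * ctn b l (Suc k) - b (Suc k) * ctn b l k"

lemma (in comm_ring_hom) hom_ctn: "hom (ctn b l n) = ctn (\<lambda>k. hom (b k)) (hom l) n"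
  by (induction b l n rule: ctn.induct) (simp_all add: hom_distribs)

text \<open>Multiplying a tridiagonal matrix by \<open>c\<close> multiplies its diagonal by
  \<open>c\<close> and the products of opposite off-diagonal entries by
  \<open>c ^ 2\<close>.\<close>

lemma ctn_scale: "ctn (\<lambda>k. c\<^sup>2 * b k) (c * l) n = c ^ n * ctn b l n"
proof (induction b l n rule: ctn.induct)
  case (3 b l k)
  then show ?case by (simp add: algebra_simps power2_eq_square)
qed simp_all

definition ctn_poly :: "(nat \<Rightarrow> 'a::comm_ring_1) \<Rightarrow> nat \<Rightarrow> 'a poly" where
  "ctn_poly b n = ctn (\<lambda>k. [:b k:]) [:0, 1:] n"

lemma poly_ctn_poly [simp]: "poly (ctn_poly b n) l = ctn b l n"
  unfolding ctn_poly_def by (subst poly_hom.hom_ctn) simp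

lemma ctn_poly_monic:
  "degree (ctn_poly b n :: 'a::idom poly) = n \<and> lead_coeff (ctn_poly b n :: 'a poly) = 1"
proof (induction n rule: less_induct)
  case (less n)
  consider "n = 0" | "n = 1" | k where "n = Suc (Suc k)"
    by (metis One_nat_def not0_implies_Suc)
  then show ?case
  proof cases
    case (3 k)
    have e: "ctn_poly b n = pCons 0 (ctn_poly b (Suc k)) - smult (b (Suc k)) (ctn_poly b k)"
      by (simp add: 3 ctn_poly_def)
    have IH: "degree (ctn_poly b (Suc k)) = Suc k" "coeff (ctn_poly b (Suc k)) (Suc k) = 1"
      "degree (ctn_poly b k) = k" using less[of "Suc k"] less[of k] 3 by auto
    have c: "coeff (ctn_poly b n) n = 1"
      unfolding e using IH by (simp add: 3 coeff_eq_0)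
    have "degree (ctn_poly b n) \<le> n"
      unfolding e using IH
      by (intro degree_diff_le) (auto simp: 3 degree_pCons_eq_if intro: order_trans[OF degree_smult_le])
    then show ?thesis using c by (metis le_antisym le_degree zero_neq_one)
  qed (auto simp: ctn_poly_def)
qed

lemma ctn_poly_nonzero [simp]: "ctn_poly b n \<noteq> (0 :: 'a::idom poly)"
  using ctn_poly_monic[of b n] by (metis leading_coeff_0_iff zero_neq_one)

text \<open>Confluent Christoffel-Darboux identity: the Wronskian of neighbouring continuants starts
  at 1, and each step multiplies it by \<open>b (Suc n) > 0\<close> and adds a square.\<close>

lemma ctn_wronskian_pos:
  fixes b :: "nat \<Rightarrow> real"
  assumes "\<And>k. 1 \<le> k \<Longrightarrow> k \<le> n \<Longrightarrow> 0 < b k"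
  shows "poly (pderiv (ctn_poly b (Suc n))) l * ctn b l n
       - ctn b l (Suc n) * poly (pderiv (ctn_poly b n)) l > 0"
  using assms
proof (induction n)
  case 0
  then show ?case by (simp add: ctn_poly_def pderiv_pCons)
next
  case (Suc n)
  have e: "ctn_poly b (Suc (Suc n)) = [:0, 1:] * ctn_poly b (Suc n) - [:b (Suc n):] * ctn_poly b n"
    by (simp add: ctn_poly_def)
  let ?q = "\<lambda>k. ctn b l k" and ?d = "\<lambda>k. poly (pderiv (ctn_poly b k)) l"
  have d: "?d (Suc (Suc n)) = ?q (Suc n) + l * ?d (Suc n) - b (Suc n) * ?d n"
    unfolding e by (simp add: pderiv_mult pderiv_diff pderiv_pCons pderiv_smult)
  have "?d (Suc (Suc n)) * ?q (Suc n) - ?q (Suc (Suc n)) * ?d (Suc n)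
      = (?q (Suc n))\<^sup>2 + b (Suc n) * (?d (Suc n) * ?q n - ?q (Suc n) * ?d n)"
    unfolding d by (simp add: algebra_simps power2_eq_square)
  moreover have "b (Suc n) * (?d (Suc n) * ?q n - ?q (Suc n) * ?d n) > 0"
    using Suc by (intro mult_pos_pos) auto
  ultimately show ?case by (smt (verit) zero_le_power2)
qed

lemma ctn_simple_roots:
  fixes b :: "nat \<Rightarrow> real"
  assumes "\<And>k. 1 \<le> k \<Longrightarrow> k < n \<Longrightarrow> 0 < b k" and "ctn b l n = 0"
  shows "poly (pderiv (ctn_poly b n)) l \<noteq> 0"
proof (cases n)
  case 0
  then show ?thesis using assms by simp
next
  case (Suc k)
  then show ?thesis using ctn_wronskian_pos[of k b l] assms by force
qed

text \<open>Non-real counterpart of the Wronskian argument: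
  \<open>Im (q (k + 1) * cnj (q k)) * Im l\<close> obeys the same kind of recurrence and stays
  positive, so no continuant vanishes at \<open>l\<close>.\<close>

lemma ctn_real_rooted:
  fixes b :: "nat \<Rightarrow> real"
  assumes "\<And>k. 1 \<le> k \<Longrightarrow> k < n \<Longrightarrow> 0 < b k" and "Im l \<noteq> 0"
  shows "ctn (\<lambda>k. complex_of_real (b k)) l n \<noteq> 0"
proof (cases n)
  case 0
  then show ?thesis by simp
next
  case (Suc k)
  let ?q = "ctn (\<lambda>k. complex_of_real (b k)) l"
  have "0 < Im (?q (Suc k) * cnj (?q k)) * Im l"
    using assms(1) unfolding Suc
  proof (induction k)
    case 0
    then show ?case using assms(2) by (simp add: zero_less_mult_iff linorder_neq_iff disj_commute)
  next
    case (Suc k)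
    have "Im (?q (Suc (Suc k)) * cnj (?q (Suc k)))
        = Im l * (cmod (?q (Suc k)))\<^sup>2 + b (Suc k) * Im (?q (Suc k) * cnj (?q k))"
      unfolding ctn.simps(3)[of _ l k] cmod_power2 by (simp add: algebra_simps power2_eq_square)
    then have "Im (?q (Suc (Suc k)) * cnj (?q (Suc k))) * Im l
        = (Im l * cmod (?q (Suc k)))\<^sup>2 + b (Suc k) * (Im (?q (Suc k) * cnj (?q k)) * Im l)"
      by (simp add: algebra_simps power2_eq_square)
    moreover have "0 < b (Suc k) * (Im (?q (Suc k) * cnj (?q k)) * Im l)"
      using Suc.IH Suc.prems by (rule_tac mult_pos_pos) auto
    ultimately show ?case by (smt (verit) zero_le_power2)
  qed
  then show ?thesis using Suc by auto
qed

text \<open>The left factor is the Chebyshev polynomial of the second kind at \<open>cos t\<close>.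
  The recurrence is the addition theorem for \<open>sin\<close>.\<close>

lemma ctn_chebyshev: "ctn (\<lambda>_. 1) (2 * cos t) n * sin t = sin (real (Suc n) * t)"
proof (induction n rule: less_induct)
  case (less n)
  consider "n = 0" | "n = 1" | k where "n = Suc (Suc k)"
    by (metis One_nat_def not0_implies_Suc)
  then show ?case
  proof cases
    case 2
    then show ?thesis using sin_double[of t] by (simp add: mult_ac)
  next
    case (3 k)
    have "ctn (\<lambda>_. 1) (2 * cos t) n * sin t
      = 2 * cos t * sin (real (k + 2) * t) - sin (real (k + 1) * t)"
      using less[of "Suc k"] less[of k] by (simp add: 3 algebra_simps)
    also have "\<dots> = sin (real (k + 2) * t + t)"
    proof -
      have "real (k + 1) * t = real (k + 2) * t - t" by (simp add: algebra_simps)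
      then show ?thesis by (simp only: sin_add sin_diff) simp
    qed
    finally show ?thesis by (simp add: 3 algebra_simps)
  qed simp
qed

section \<open>Eigenvalues of reciprocal matrices, in decreasing order\<close>

definition cheb_root :: "nat \<Rightarrow> nat \<Rightarrow> real" where
  "cheb_root n k = 2 * cos (real k * pi / real (Suc n))"

lemma cheb_root_less:
  assumes "i < j" "j \<le> Suc n" shows "cheb_root n j < cheb_root n i"
proof -
  have "real i * pi / real (Suc n) < real j * pi / real (Suc n)"
    using assms(1) by (simp add: divide_strict_right_mono)
  moreover have "real j * pi / real (Suc n) \<le> pi"
    using assms(2) by (simp add: divide_le_eq mult.commute)
  ultimately show ?thesis
    unfolding cheb_root_def by (simp add: cos_monotone_0_pi)
qed

lemma cheb_root_reflect: "k \<le> Suc n \<Longrightarrow> cheb_root n (Suc n - k) = - cheb_root n k"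
proof -
  assume "k \<le> Suc n"
  then have "real (Suc n - k) * pi / real (Suc n) = pi - real k * pi / real (Suc n)"
    by (simp add: of_nat_diff field_simps)
  then show ?thesis unfolding cheb_root_def by simp
qed

text \<open>The values \<open>cheb_root n k\<close> are \<open>n\<close> distinct zeros, and the
  degree \<open>n\<close> leaves room for no other.\<close>

lemma ctn_one_roots: "{l. ctn (\<lambda>_. 1) l n = 0} = cheb_root n ` {1..n}"
proof -
  have sub: "cheb_root n ` {1..n} \<subseteq> {l. ctn (\<lambda>_. 1) l n = 0}"
  proof safe
    fix k assume k: "k \<in> {1..n}"
    let ?t = "real k * pi / real (Suc n)"
    have "sin ?t > 0" using k
      by (intro sin_gt_zero) (auto simp: divide_less_eq mult.commute intro!: divide_pos_pos)
    moreover have "sin (real (Suc n) * ?t) = 0" by (simp add: sin_npi)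
    ultimately show "ctn (\<lambda>_. 1) (cheb_root n k) n = 0"
      using ctn_chebyshev[of ?t n] by (simp add: cheb_root_def)
  qed
  have inj: "inj_on (cheb_root n) {1..n}"
  proof (rule inj_onI)
    fix i j assume "i \<in> {1..n}" "j \<in> {1..n}" "cheb_root n i = cheb_root n j"
    then show "i = j"
      using cheb_root_less[of i j n] cheb_root_less[of j i n] by (cases i j rule: linorder_cases) auto
  qed
  let ?p = "ctn_poly (\<lambda>_. 1) n :: real poly"
  have eq: "{l. ctn (\<lambda>_. 1) l n = 0} = {l. poly ?p l = 0}" by simp
  have "card {l. poly ?p l = 0} \<le> n"
    using poly_roots_degree[of ?p] ctn_poly_monic[of "\<lambda>_. 1::real" n] ctn_poly_nonzero by metis
  then show ?thesis
    using sub inj unfolding eq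
    by (metis card_image card_seteq card_atLeastAtMost diff_Suc_1 poly_roots_finite ctn_poly_nonzero)
qed

section \<open>Coefficients of continuants as sums over sparse sets\<close>

definition esum :: "(nat \<Rightarrow> 'a::comm_ring_1) \<Rightarrow> nat \<Rightarrow> nat \<Rightarrow> 'a" where
  "esum b n j = (\<Sum>S\<in>sparse_subsets n j. \<Prod>k\<in>S. b k)"

lemma finite_sparse_subsets [simp]: "finite (sparse_subsets n j)"
  by (rule finite_subset[of _ "Pow {1..<n}"]) (auto simp: sparse_subsets_def)

lemma esum_0 [simp]: "esum b n 0 = 1"
proof -
  have "sparse_subsets n 0 = {{}}"
    by (auto simp: sparse_subsets_def dest: finite_subset)
  then show ?thesis by (simp add: esum_def)
qed

lemma esum_le_1 [simp]: "n \<le> 1 \<Longrightarrow> esum b n (Suc j) = 0"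
proof -
  assume "n \<le> 1"
  then have "sparse_subsets n (Suc j) = {}" by (auto simp: sparse_subsets_def)
  then show ?thesis by (simp add: esum_def)
qed

text \<open>Split by whether the largest index \<open>Suc n\<close> belongs to the set. If it does,
  \<open>n\<close> is excluded and the rest is sparse in \<open>{1..<n}\<close>.\<close>

lemma esum_Suc_Suc:
  "esum b (Suc (Suc n)) (Suc j) = esum b (Suc n) (Suc j) + b (Suc n) * esum b n j"
proof -
  let ?A = "sparse_subsets (Suc n) (Suc j)" and ?B = "sparse_subsets n j"
  have fin: "finite S" "Suc n \<notin> S" if "S \<in> ?B" for S
    using that by (auto simp: sparse_subsets_def intro: finite_subset)
  have split: "sparse_subsets (Suc (Suc n)) (Suc j) = ?A \<union> insert (Suc n) ` ?B"
  proof safe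
    fix S assume S: "S \<in> sparse_subsets (Suc (Suc n)) (Suc j)" "S \<notin> insert (Suc n) ` ?B"
    have finS: "finite S" using S by (auto simp: sparse_subsets_def intro: finite_subset)
    have "Suc n \<notin> S"
    proof
      assume mem: "Suc n \<in> S"
      have "S - {Suc n} \<in> ?B"
      proof -
        have "x < n" if "x \<in> S" "x \<noteq> Suc n" for x
        proof -
          have "x < Suc n" using S(1) that by (force simp: sparse_subsets_def)
          then have "Suc n - x > 1" using S(1) that mem by (auto simp: sparse_subsets_def)
          then show ?thesis by simp
        qed
        then show ?thesis using S(1) mem finS by (fastforce simp: sparse_subsets_def)
      qed
      then show False using S(2) mem by (metis imageI insert_Diff)
    qed
    then show "S \<in> ?A" using S(1) by (force simp: sparse_subsets_def less_Suc_eq)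
  next
    fix S assume "S \<in> ?A" then show "S \<in> sparse_subsets (Suc (Suc n)) (Suc j)"
      by (auto simp: sparse_subsets_def)
  next
    fix S assume S: "S \<in> ?B"
    have "x < n" if "x \<in> S" for x using S that by (auto simp: sparse_subsets_def)
    then show "insert (Suc n) S \<in> sparse_subsets (Suc (Suc n)) (Suc j)"
      using S fin[OF S] by (fastforce simp: sparse_subsets_def)
  qed
  have disj: "?A \<inter> insert (Suc n) ` ?B = {}" by (auto simp: sparse_subsets_def)
  have inj: "inj_on (insert (Suc n)) ?B"
    by (rule inj_onI) (metis fin(2) insert_ident)
  have "(\<Sum>S\<in>insert (Suc n) ` ?B. \<Prod>k\<in>S. b k) = b (Suc n) * esum b n j"
    unfolding esum_def sum.reindex[OF inj] sum_distrib_left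
    by (rule sum.cong) (auto simp: fin)
  then show ?thesis
    unfolding esum_def split by (subst sum.union_disjoint[OF _ _ disj]) auto
qed

lemma esum_eq_0: "n < 2 * j \<Longrightarrow> esum b n j = 0"
proof (induction n arbitrary: j rule: less_induct)
  case (less n)
  then obtain i where j: "j = Suc i" by (cases j) auto
  show ?case
  proof (cases "n \<le> 1")
    case False
    then obtain k where "n = Suc (Suc k)" by (metis One_nat_def nat_le_linear not0_implies_Suc le_0_eq)
    then show ?thesis using less.IH[of "Suc k" j] less.IH[of k i] less.prems j
      by (simp add: esum_Suc_Suc)
  qed (simp add: j)
qed

text \<open>A sparse set selects disjoint pairs of neighbouring indices, so this is the matching
  polynomial of a weighted path. The bound \<open>N\<close> is left free because the two earlier
  continuants are summed over ranges of different length.\<close>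

lemma ctn_esum:
  "n \<le> N \<Longrightarrow> ctn b z n = (\<Sum>j\<le>N. (-1) ^ j * esum b n j * z ^ (n - 2 * j))"
proof (induction n arbitrary: N rule: less_induct)
  case (less n)
  have short: "(\<Sum>j\<le>N. (-1) ^ j * esum b n j * z ^ (n - 2 * j)) = z ^ n" if "n \<le> 1"
  proof -
    have "(\<Sum>j\<le>N. (-1) ^ j * esum b n j * z ^ (n - 2 * j))
        = (\<Sum>j\<le>N. if j = 0 then z ^ n else 0)"
    proof (rule sum.cong)
      fix j show "(-1) ^ j * esum b n j * z ^ (n - 2 * j) = (if j = 0 then z ^ n else 0)"
        using that by (cases j) auto
    qed simp
    then show ?thesis by simp
  qed
  consider "n = 0" | "n = 1" | k where "n = Suc (Suc k)"
    by (metis One_nat_def not0_implies_Suc)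
  then show ?case
  proof cases
    case (3 k)
    then obtain M where N: "N = Suc M" and M: "k \<le> M" using less.prems by (cases N) auto
    let ?f = "\<lambda>n j. (-1) ^ j * esum b n j * z ^ (n - 2 * j)"
    have a: "ctn b z (Suc k) = z ^ Suc k + (\<Sum>j\<le>M. ?f (Suc k) (Suc j))"
      using less.IH[of "Suc k" N] less.prems by (simp add: 3 N sum.atMost_Suc_shift del: sum.atMost_Suc)
    have bb: "ctn b z k = (\<Sum>j\<le>M. ?f k j)" using less.IH[of k M] M by (simp add: 3)
    have c: "?f (Suc (Suc k)) (Suc j) = z * ?f (Suc k) (Suc j) - b (Suc k) * ?f k j" for j
    proof -
      \<comment> \<open>The exponents differ by one except when subtraction truncates; in that case
        the sum over sparse sets is 0.\<close>
      have p: "esum b (Suc k) (Suc j) * z ^ (k - 2 * j)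
             = esum b (Suc k) (Suc j) * (z * z ^ (Suc k - 2 * Suc j))"
      proof (cases "Suc k < 2 * Suc j")
        case False
        then have "k - 2 * j = Suc (Suc k - 2 * Suc j)" by simp
        then show ?thesis by simp
      qed (simp add: esum_eq_0)
      show ?thesis using p by (simp add: esum_Suc_Suc algebra_simps)
    qed
    have "(\<Sum>j\<le>N. ?f n j) = z ^ n + (\<Sum>j\<le>M. ?f (Suc (Suc k)) (Suc j))"
      by (simp add: 3 N sum.atMost_Suc_shift del: sum.atMost_Suc)
    also have "\<dots> = z * ctn b z (Suc k) - b (Suc k) * ctn b z k"
      unfolding a bb c by (simp add: 3 sum_subtractf sum_distrib_left algebra_simps)
    finally show ?thesis by (simp add: 3)
  qed (use short in auto)
qed

lemma p_coeff_esum: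
  "p_coeff n x \<rho> i = (-1) ^ (n div 2 - i) * esum (\<lambda>k. x k + \<rho>) n (n div 2 - i)"
  by (simp add: p_coeff_def esum_def Let_def)

lemma P_sum: "P n x \<rho> \<zeta> = (\<Sum>j\<le>n div 2. complex_of_real (p_coeff n x \<rho> j) * \<zeta> ^ j)"
  unfolding P_def
  by (simp add: lessThan_Suc_atMost[symmetric] p_coeff_esum)

text \<open>Only powers of the parity of \<open>n\<close> occur, which leaves the factor
  \<open>z\<close> for odd \<open>n\<close>. The sum is reversed since \<open>p_coeff\<close> counts
  powers from below whereas \<open>esum\<close> counts from the top.\<close>

lemma ctn_eq_P:
  "ctn (\<lambda>k. complex_of_real (x k + \<rho>)) z n = z ^ (n mod 2) * P n x \<rho> (z\<^sup>2)"
proof -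
  let ?m = "n div 2" and ?c = "\<lambda>k. complex_of_real (x k + \<rho>)"
  have e: "esum ?c n j = complex_of_real (esum (\<lambda>k. x k + \<rho>) n j)" for j
    by (simp add: esum_def)
  have "ctn ?c z n = (\<Sum>j\<le>n. (-1) ^ j * esum ?c n j * z ^ (n - 2 * j))"
    by (rule ctn_esum) simp
  also have "\<dots> = (\<Sum>j\<le>?m. (-1) ^ j * esum ?c n j * z ^ (n - 2 * j))"
    by (rule sum.mono_neutral_right) (auto simp: esum_eq_0)
  also have "\<dots> = (\<Sum>j\<le>?m. (-1) ^ (?m - j) * esum ?c n (?m - j) * z ^ (n - 2 * (?m - j)))"
    by (rule sum.reindex_bij_witness[of _ "\<lambda>j. ?m - j" "\<lambda>j. ?m - j"]) auto
  also have "\<dots> = (\<Sum>j\<le>?m. z ^ (n mod 2) * (complex_of_real (p_coeff n x \<rho> j) * (z\<^sup>2) ^ j))"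
  proof (rule sum.cong)
    fix j assume "j \<in> {..?m}"
    then have "n - 2 * (?m - j) = n mod 2 + 2 * j" by auto presburger
    then show "(-1) ^ (?m - j) * esum ?c n (?m - j) * z ^ (n - 2 * (?m - j))
      = z ^ (n mod 2) * (complex_of_real (p_coeff n x \<rho> j) * (z\<^sup>2) ^ j)"
      unfolding e p_coeff_esum by (simp add: power_add power_mult)
  qed simp
  finally show ?thesis by (simp add: P_sum sum_distrib_left)
qed

section \<open>Tridiagonal matrices\<close>

text \<open>Expansion along the last row leaves two terms. The recurrence then only sees the
  products of opposite off-diagonal entries.\<close>

lemma det_tridiagonal:
  fixes M :: "'a::comm_ring_1 mat"
  assumes "M \<in> carrier_mat n n"
    and "\<And>i. i < n \<Longrightarrow> M $$ (i, i) = d"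
    and "\<And>i j. i < n \<Longrightarrow> j < n \<Longrightarrow> i \<noteq> j \<Longrightarrow> i \<noteq> Suc j \<Longrightarrow> j \<noteq> Suc i \<Longrightarrow> M $$ (i, j) = 0"
    and "\<And>i. Suc i < n \<Longrightarrow> M $$ (i, Suc i) * M $$ (Suc i, i) = b (Suc i)"
  shows "det M = ctn b d n"
  using assms
proof (induction n arbitrary: M rule: less_induct)
  case (less n)
  note M = less.prems
  consider "n = 0" | "n = 1" | k where "n = Suc (Suc k)"
    by (metis One_nat_def not0_implies_Suc)
  then show ?case
  proof cases
    case 1
    then show ?thesis using M(1) by (auto simp: det_dim_zero)
  next
    case 2
    have "mat_delete M 0 0 \<in> carrier_mat 0 0"
      using mat_delete_carrier[OF M(1), of 0 0] 2 by simp
    then show ?thesis using M(2)[of 0] 2 laplace_expansion_row[OF M(1), of 0]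
      by (simp add: cofactor_def det_dim_zero)
  next
    case (3 k)
    \<comment> \<open>The minor of the entry left of the last diagonal entry. Its last column has at
      most one non-zero entry, \<open>M $$ (k, Suc k)\<close>, so a second expansion along that
      column suffices.\<close>
    define N where "N = mat_delete M (Suc k) k"
    have N: "N \<in> carrier_mat (Suc k) (Suc k)"
      unfolding N_def using mat_delete_carrier[OF M(1)] 3 by simp
    have Nlast: "N $$ (i, k) = M $$ (i, Suc k)" if "i < Suc k" for i
      unfolding N_def mat_delete_def using M(1) 3 that by auto
    have "det N = (\<Sum>i<Suc k. N $$ (i, k) * cofactor N i k)"
      by (rule laplace_expansion_column[OF N]) simp
    also have "\<dots> = (\<Sum>i<Suc k. if i = k then N $$ (i, k) * cofactor N i k else 0)"
      by (rule sum.cong) (auto simp: Nlast M(3) 3)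
    also have "\<dots> = M $$ (k, Suc k) * cofactor N k k" by (simp add: Nlast)
    also have "cofactor N k k = det (mat_delete N k k)"
      by (simp add: cofactor_def flip: mult_2)
    also have "\<dots> = ctn b d k"
    proof (rule less.IH)
      show "k < n" using 3 by simp
      show "mat_delete N k k \<in> carrier_mat k k" using mat_delete_carrier[OF N] by simp
      have idx: "mat_delete N k k $$ (i, j) = M $$ (i, j)" if "i < k" "j < k" for i j
        using that M(1) 3 unfolding N_def mat_delete_def by auto
      show "mat_delete N k k $$ (i, i) = d" if "i < k" for i using idx that M(2) 3 by simp
      show "mat_delete N k k $$ (i, j) = 0"
        if "i < k" "j < k" "i \<noteq> j" "i \<noteq> Suc j" "j \<noteq> Suc i" for i j
        using idx that M(3) 3 by simp
      show "mat_delete N k k $$ (i, Suc i) * mat_delete N k k $$ (Suc i, i) = b (Suc i)"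
        if "Suc i < k" for i using idx that M(4) 3 by simp
    qed
    finally have detN: "det N = M $$ (k, Suc k) * ctn b d k" .
    have det1: "det (mat_delete M (Suc k) (Suc k)) = ctn b d (Suc k)"
    proof (rule less.IH)
      let ?D = "mat_delete M (Suc k) (Suc k)"
      show "Suc k < n" using 3 by simp
      show "?D \<in> carrier_mat (Suc k) (Suc k)" using mat_delete_carrier[OF M(1)] 3 by simp
      have idx: "?D $$ (i, j) = M $$ (i, j)" if "i < Suc k" "j < Suc k" for i j
        using that M(1) 3 unfolding mat_delete_def by auto
      show "?D $$ (i, i) = d" if "i < Suc k" for i using idx that M(2) 3 by simp
      show "?D $$ (i, j) = 0"
        if "i < Suc k" "j < Suc k" "i \<noteq> j" "i \<noteq> Suc j" "j \<noteq> Suc i" for i j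
        using idx that M(3) 3 by simp
      show "?D $$ (i, Suc i) * ?D $$ (Suc i, i) = b (Suc i)"
        if "Suc i < Suc k" for i using idx that M(4) 3 by simp
    qed
    have c1: "cofactor M (Suc k) (Suc k) = ctn b d (Suc k)"
      using det1 by (simp add: cofactor_def flip: mult_2)
    have c2: "cofactor M (Suc k) k = - (M $$ (k, Suc k) * ctn b d k)"
      using detN by (simp add: cofactor_def N_def flip: mult_2)
    have "det M = (\<Sum>j<n. M $$ (Suc k, j) * cofactor M (Suc k) j)"
      by (rule laplace_expansion_row[OF M(1)]) (simp add: 3)
    also have "\<dots> = M $$ (Suc k, k) * cofactor M (Suc k) k
        + M $$ (Suc k, Suc k) * cofactor M (Suc k) (Suc k)"
    proof -
      have "(\<Sum>j<k. M $$ (Suc k, j) * cofactor M (Suc k) j) = 0"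
        by (rule sum.neutral) (auto simp: M(3) 3)
      then show ?thesis by (simp add: 3)
    qed
    also have "\<dots> = d * ctn b d (Suc k) - b (Suc k) * ctn b d k"
      using M(2)[of "Suc k"] M(4)[of k] by (simp add: c1 c2 3 algebra_simps)
    finally show ?thesis by (simp add: 3)
  qed
qed

lemma ctn_minus: "ctn b (- l) n = (-1) ^ n * ctn b l n"
  using ctn_scale[of "-1" b l n] by simp

lemma reciprocal_matsD:
  assumes "A \<in> reciprocal_mats n"
  shows "A \<in> carrier_mat n n"
    and "i < n \<Longrightarrow> j < n \<Longrightarrow> i \<noteq> Suc j \<Longrightarrow> j \<noteq> Suc i \<Longrightarrow> A $$ (i, j) = 0"
    and "Suc i < n \<Longrightarrow> A $$ (i, Suc i) * A $$ (Suc i, i) = 1"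
  using assms by (auto simp: reciprocal_mats_def)

lemma eigenvalue_iff_ctn:
  assumes "A \<in> reciprocal_mats n"
  shows "eigenvalue A e \<longleftrightarrow> ctn (\<lambda>_. 1) e n = 0"
proof -
  note A = reciprocal_matsD[OF assms]
  have "det (char_matrix A e) = ctn (\<lambda>_. 1) (- e) n"
    by (rule det_tridiagonal) (use A in \<open>auto simp: char_matrix_def\<close>)
  then show ?thesis by (simp add: eigenvalue_det[OF A(1)] ctn_minus)
qed

lemma mat_adjoint_index:
  assumes "A \<in> carrier_mat n n" "i < n" "j < n"
  shows "mat_adjoint A $$ (i, j) = conjugate (A $$ (j, i))"
  using assms by (auto simp: mat_adjoint_def mat_of_rows_index)

lemma xi_nonneg: "0 \<le> xi A j"
  by (simp add: xi_def)

text \<open>The squares of \<open>u\<close> and \<open>cnj u\<close> add up to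
  \<open>2 * cos (2 * \<theta>)\<close>, and \<open>cmod a * cmod b = 1\<close> turns
  \<open>(cmod a) ^ 2 + (cmod b) ^ 2 - 2\<close> into the square of the difference.\<close>

lemma re_part_offdiag:
  fixes a b u :: complex
  assumes "a * b = 1" "u = cis \<theta>"
  shows "(u * a + cnj (u * b)) / 2 * ((u * b + cnj (u * a)) / 2)
    = complex_of_real ((cmod a - cmod b)\<^sup>2 / 4 + (cos \<theta>)\<^sup>2)"
proof -
  have ab: "cmod a * cmod b = 1" using assms(1) by (metis norm_mult norm_one)
  have uu: "u * cnj u = 1" by (simp add: assms(2) cis_mult cis_cnj)
  have cc: "cnj a * cnj b = 1" using assms(1) by (metis complex_cnj_mult complex_cnj_one)
  have na: "a * cnj a = complex_of_real ((cmod a)\<^sup>2)" "b * cnj b = complex_of_real ((cmod b)\<^sup>2)"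
    by (simp_all only: complex_norm_square)
  have u2: "u\<^sup>2 + (cnj u)\<^sup>2 = complex_of_real (4 * (cos \<theta>)\<^sup>2 - 2)"
  proof -
    have "u + cnj u = complex_of_real (2 * cos \<theta>)"
      by (simp add: assms(2) complex_add_cnj)
    then have "(u + cnj u)\<^sup>2 = complex_of_real (4 * (cos \<theta>)\<^sup>2)"
      by (simp add: power2_eq_square)
    then show ?thesis using uu by (simp add: power2_sum mult.assoc eq_diff_eq)
  qed
  have "(u * a + cnj (u * b)) * (u * b + cnj (u * a))
    = u\<^sup>2 * (a * b) + (u * cnj u) * (a * cnj a) + (u * cnj u) * (b * cnj b)
      + (cnj u)\<^sup>2 * (cnj a * cnj b)"
    by (simp add: algebra_simps power2_eq_square)
  also have "\<dots> = complex_of_real (4 * (cos \<theta>)\<^sup>2 - 2 + (cmod a)\<^sup>2 + (cmod b)\<^sup>2)"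
    using u2 by (simp add: assms(1) cc uu na algebra_simps)
  also have "4 * (cos \<theta>)\<^sup>2 - 2 + (cmod a)\<^sup>2 + (cmod b)\<^sup>2
      = 4 * ((cmod a - cmod b)\<^sup>2 / 4 + (cos \<theta>)\<^sup>2)"
    using ab by (simp add: power2_diff)
  finally show ?thesis by simp
qed

lemma kippenhahn_poly_eq_ctn:
  assumes "A \<in> reciprocal_mats n"
  shows "kippenhahn_poly A l \<theta>
    = (-1) ^ n * ctn (\<lambda>k. complex_of_real (xi A k + (cos \<theta>)\<^sup>2)) l n"
proof -
  note A = reciprocal_matsD[OF assms]
  define B where "B = cis \<theta> \<cdot>\<^sub>m A"
  have B: "B \<in> carrier_mat n n" using A by (simp add: B_def)
  have Bidx: "B $$ (i, j) = cis \<theta> * A $$ (i, j)" if "i < n" "j < n" for i j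
    using that A(1) by (simp add: B_def)
  have adj: "mat_adjoint B \<in> carrier_mat n n" using B by (auto simp: mat_adjoint_def)
  have R: "re_part B $$ (i, j) = (B $$ (i, j) + cnj (B $$ (j, i))) / 2" if "i < n" "j < n" for i j
    using that B adj by (simp add: re_part_def mat_adjoint_index[OF B])
  have RC: "re_part B \<in> carrier_mat n n" using B adj by (auto simp: re_part_def)
  have dim: "dim_row A = n" using A(1) by simp
  have "det (re_part B - l \<cdot>\<^sub>m 1\<^sub>m n) = ctn (\<lambda>k. complex_of_real (xi A k + (cos \<theta>)\<^sup>2)) (- l) n"
  proof (rule det_tridiagonal)
    fix i assume i: "Suc i < n"
    have "(re_part B - l \<cdot>\<^sub>m 1\<^sub>m n) $$ (i, Suc i) * (re_part B - l \<cdot>\<^sub>m 1\<^sub>m n) $$ (Suc i, i)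
      = re_part B $$ (i, Suc i) * re_part B $$ (Suc i, i)"
      using i RC by simp
    also have "\<dots> = complex_of_real ((cmod (A $$ (i, Suc i)) - cmod (A $$ (Suc i, i)))\<^sup>2 / 4 + (cos \<theta>)\<^sup>2)"
      using i by (simp only: R Bidx Suc_lessD re_part_offdiag[OF A(3)])
    finally show "(re_part B - l \<cdot>\<^sub>m 1\<^sub>m n) $$ (i, Suc i) * (re_part B - l \<cdot>\<^sub>m 1\<^sub>m n) $$ (Suc i, i)
      = complex_of_real (xi A (Suc i) + (cos \<theta>)\<^sup>2)"
      by (simp add: xi_def)
  qed (use RC A in \<open>auto simp: R Bidx\<close>)
  then show ?thesis by (simp add: kippenhahn_poly_def B_def dim ctn_minus)
qed

section \<open>The polynomials \<open>R\<^sub>e\<close> and \<open>R\<^sub>o\<close>\<close>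

lemma finite_exponents:
  fixes I :: "nat set"
  assumes "finite I"
  shows "finite {a :: nat \<Rightarrow> nat. (\<forall>i. i \<notin> I \<longrightarrow> a i = 0) \<and> (\<Sum>i\<in>I. a i) = d}"
proof (rule finite_subset)
  show "finite {a :: nat \<Rightarrow> nat. \<forall>i. (i \<in> I \<longrightarrow> a i \<in> {..d}) \<and> (i \<notin> I \<longrightarrow> a i = 0)}"
    using assms by (intro finite_set_of_finite_funs) auto
  show "{a :: nat \<Rightarrow> nat. (\<forall>i. i \<notin> I \<longrightarrow> a i = 0) \<and> (\<Sum>i\<in>I. a i) = d}
    \<subseteq> {a. \<forall>i. (i \<in> I \<longrightarrow> a i \<in> {..d}) \<and> (i \<notin> I \<longrightarrow> a i = 0)}"
    using assms by (auto intro: member_le_sum)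
qed

lemma homogeneous_form_monomial:
  fixes I :: "nat set"
  assumes "finite I" "\<forall>i. i \<notin> I \<longrightarrow> a i = 0" "(\<Sum>i\<in>I. a i) = d"
  shows "homogeneous_form I d (\<lambda>v. k * (\<Prod>i\<in>I. v i ^ a i))"
  unfolding homogeneous_form_def
proof (intro exI allI)
  fix v :: "nat \<Rightarrow> real"
  let ?E = "{a :: nat \<Rightarrow> nat. (\<forall>i. i \<notin> I \<longrightarrow> a i = 0) \<and> (\<Sum>i\<in>I. a i) = d}"
  have "(\<Sum>b\<in>?E. (if b = a then k else 0) * (\<Prod>i\<in>I. v i ^ b i))
      = (\<Sum>b\<in>?E. if b = a then k * (\<Prod>i\<in>I. v i ^ b i) else 0)"
    by (rule sum.cong) auto
  also have "\<dots> = k * (\<Prod>i\<in>I. v i ^ a i)"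
    using assms finite_exponents[OF assms(1), of d] by simp
  finally show "k * (\<Prod>i\<in>I. v i ^ a i) = (\<Sum>b\<in>?E. (if b = a then k else 0) * (\<Prod>i\<in>I. v i ^ b i))"
    by simp
qed

lemma homogeneous_form_0: "homogeneous_form I d (\<lambda>v. 0)"
  unfolding homogeneous_form_def by (rule exI[of _ "\<lambda>_. 0"]) simp

lemma homogeneous_form_add:
  assumes "homogeneous_form I d F" "homogeneous_form I d G"
  shows "homogeneous_form I d (\<lambda>v. F v + G v)"
proof -
  obtain c c' where "\<And>v. F v = (\<Sum>a | (\<forall>i. i \<notin> I \<longrightarrow> a i = 0) \<and> (\<Sum>i\<in>I. a i) = d. c a * (\<Prod>i\<in>I. v i ^ a i))"
    "\<And>v. G v = (\<Sum>a | (\<forall>i. i \<notin> I \<longrightarrow> a i = 0) \<and> (\<Sum>i\<in>I. a i) = d. c' a * (\<Prod>i\<in>I. v i ^ a i))"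
    using assms unfolding homogeneous_form_def by blast
  then show ?thesis unfolding homogeneous_form_def
    by (intro exI[of _ "\<lambda>a. c a + c' a"]) (simp add: sum.distrib distrib_right)
qed

lemma homogeneous_form_sum:
  "(\<And>s. s \<in> S \<Longrightarrow> homogeneous_form I d (F s)) \<Longrightarrow> homogeneous_form I d (\<lambda>v. \<Sum>s\<in>S. F s v)"
  by (induction S rule: infinite_finite_induct) (simp_all add: homogeneous_form_0 homogeneous_form_add)

lemma homogeneous_form_mult:
  assumes "finite I" "homogeneous_form I d F" "homogeneous_form I e G"
  shows "homogeneous_form I (d + e) (\<lambda>v. F v * G v)"
proof -
  let ?E = "\<lambda>d. {a :: nat \<Rightarrow> nat. (\<forall>i. i \<notin> I \<longrightarrow> a i = 0) \<and> (\<Sum>i\<in>I. a i) = d}"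
  obtain c c' where F: "\<And>v. F v = (\<Sum>a\<in>?E d. c a * (\<Prod>i\<in>I. v i ^ a i))"
    and G: "\<And>v. G v = (\<Sum>a\<in>?E e. c' a * (\<Prod>i\<in>I. v i ^ a i))"
    using assms unfolding homogeneous_form_def by blast
  have "F v * G v = (\<Sum>a\<in>?E d. \<Sum>b\<in>?E e. (c a * c' b) * (\<Prod>i\<in>I. v i ^ (a i + b i)))" for v
    unfolding F G sum_product by (simp add: power_add prod.distrib mult_ac)
  moreover have "homogeneous_form I (d + e)
      (\<lambda>v. \<Sum>a\<in>?E d. \<Sum>b\<in>?E e. (c a * c' b) * (\<Prod>i\<in>I. v i ^ (a i + b i)))"
    by (intro homogeneous_form_sum homogeneous_form_monomial assms) (auto simp: sum.distrib)
  ultimately show ?thesis by simp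
qed

lemma homogeneous_form_const: "finite I \<Longrightarrow> homogeneous_form I 0 (\<lambda>v. k)"
  using homogeneous_form_monomial[of I "\<lambda>_. 0" 0 k] by simp

lemma homogeneous_form_var:
  assumes "finite I" "j \<in> I" shows "homogeneous_form I 1 (\<lambda>v. v j)"
proof -
  have "(\<Prod>i\<in>I. v i ^ (if i = j then 1 else 0)) = v j" for v :: "nat \<Rightarrow> real"
  proof -
    have "(\<Prod>i\<in>I. v i ^ (if i = j then 1 else 0)) = (\<Prod>i\<in>I. if i = j then v i else 1)"
      by (rule prod.cong) auto
    then show ?thesis using assms by simp
  qed
  then show ?thesis
    using homogeneous_form_monomial[of I "\<lambda>i. if i = j then 1 else 0" 1 1] assms by simp
qed

lemma homogeneous_form_cmult:
  "finite I \<Longrightarrow> homogeneous_form I d F \<Longrightarrow> homogeneous_form I d (\<lambda>v. k * F v)"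
  using homogeneous_form_mult[of I 0 "\<lambda>_. k" d F] homogeneous_form_const by simp

lemma homogeneous_form_power:
  "finite I \<Longrightarrow> homogeneous_form I d F \<Longrightarrow> homogeneous_form I (k * d) (\<lambda>v. F v ^ k)"
  by (induction k) (simp_all add: homogeneous_form_const homogeneous_form_mult)

lemma homogeneous_form_prod:
  "finite I \<Longrightarrow> finite S \<Longrightarrow> (\<And>s. s \<in> S \<Longrightarrow> homogeneous_form I (d s) (F s)) \<Longrightarrow>
    homogeneous_form I (\<Sum>s\<in>S. d s) (\<lambda>v. \<Prod>s\<in>S. F s v)"
  by (induction S rule: infinite_finite_induct)
     (simp_all add: homogeneous_form_const homogeneous_form_mult)

lemma homogeneous_form_degree_0:
  "homogeneous_form I 0 F \<Longrightarrow> finite I \<Longrightarrow> F v = F w"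
proof -
  assume F: "homogeneous_form I 0 F" and I: "finite I"
  obtain c where c: "\<And>v. F v = (\<Sum>a | (\<forall>i. i \<notin> I \<longrightarrow> a i = 0) \<and> (\<Sum>i\<in>I. a i) = 0. c a * (\<Prod>i\<in>I. v i ^ a i))"
    using F unfolding homogeneous_form_def by blast
  have "c a * (\<Prod>i\<in>I. v i ^ a i) = c a * (\<Prod>i\<in>I. w i ^ a i)" if "(\<Sum>i\<in>I. a i) = 0" for a
  proof -
    have "a i = 0" if "i \<in> I" for i using that \<open>(\<Sum>i\<in>I. a i) = 0\<close> I by simp
    then show ?thesis by simp
  qed
  then show ?thesis unfolding c by (intro sum.cong) auto
qed

lemma homogeneous_form_degree_1:
  assumes "homogeneous_form I 1 F" "finite I"
  shows "F (\<lambda>i. s * v i + w i) = s * F v + F w"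
proof -
  obtain c where c: "\<And>v. F v = (\<Sum>a | (\<forall>i. i \<notin> I \<longrightarrow> a i = 0) \<and> (\<Sum>i\<in>I. a i) = 1. c a * (\<Prod>i\<in>I. v i ^ a i))"
    using assms(1) unfolding homogeneous_form_def by blast
  have lin: "c a * (\<Prod>i\<in>I. (s * v i + w i) ^ a i)
      = s * (c a * (\<Prod>i\<in>I. v i ^ a i)) + c a * (\<Prod>i\<in>I. w i ^ a i)"
    if "(\<Sum>i\<in>I. a i) = 1" for a :: "nat \<Rightarrow> nat"
  proof -
    \<comment> \<open>An exponent vector of total degree 1 is a unit vector, so the monomial is a
      single variable.\<close>
    from that assms(2) obtain j where j: "j \<in> I" "a j = 1" "\<And>i. i \<in> I \<Longrightarrow> j \<noteq> i \<Longrightarrow> a i = 0"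
      by (subst (asm) sum_eq_1_iff) auto
    have "(\<Prod>i\<in>I. u i ^ a i) = u j" for u :: "nat \<Rightarrow> real"
    proof -
      have "(\<Prod>i\<in>I. u i ^ a i) = (\<Prod>i\<in>I. if i = j then u i else 1)"
        using j by (intro prod.cong) auto
      then show ?thesis using j assms(2) by simp
    qed
    then show ?thesis by (simp add: algebra_simps)
  qed
  show ?thesis unfolding c sum_distrib_left sum.distrib[symmetric]
    by (rule sum.cong) (use lin in auto)
qed

text \<open>Variable 0 holds \<open>C\<close> and the variables from 1 on hold the
  \<open>xi\<close>. Replacing \<open>C\<close> by a linear form in the others keeps the
  degree.\<close>

lemma homogeneous_form_subst:
  assumes "homogeneous_form {0..<n} d F" "homogeneous_form {1..<n} 1 L"
  shows "homogeneous_form {1..<n} d (\<lambda>x. F (x(0 := L x)))"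
proof -
  obtain c where c: "\<And>v. F v = (\<Sum>a | (\<forall>i. i \<notin> {0..<n} \<longrightarrow> a i = 0) \<and> (\<Sum>i\<in>{0..<n}. a i) = d.
      c a * (\<Prod>i\<in>{0..<n}. v i ^ a i))"
    using assms(1) unfolding homogeneous_form_def by blast
  have "homogeneous_form {1..<n} d (\<lambda>x. c a * (\<Prod>i\<in>{0..<n}. (x(0 := L x)) i ^ a i))"
    if "(\<Sum>i\<in>{0..<n}. a i) = d" for a :: "nat \<Rightarrow> nat"
  proof (rule homogeneous_form_cmult)
    have "homogeneous_form {1..<n} (a i * 1) (\<lambda>x. (x(0 := L x)) i ^ a i)" if "i \<in> {0..<n}" for i
    proof (cases "i = 0")
      case True
      then show ?thesis using homogeneous_form_power[OF _ assms(2), of "a 0"] by simp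
    next
      case False
      then show ?thesis
        using homogeneous_form_power[OF _ homogeneous_form_var[of "{1..<n}" i], of "a i"] that by simp
    qed
    then have "homogeneous_form {1..<n} (\<Sum>i\<in>{0..<n}. a i * 1)
        (\<lambda>x. \<Prod>i\<in>{0..<n}. (x(0 := L x)) i ^ a i)"
      by (intro homogeneous_form_prod) auto
    then show "homogeneous_form {1..<n} d (\<lambda>x. \<Prod>i\<in>{0..<n}. (x(0 := L x)) i ^ a i)"
      using that by simp
  qed simp
  then show ?thesis unfolding c by (intro homogeneous_form_sum) auto
qed

text \<open>Homogeneity of degree \<open>d\<close> in the variables \<open>v\<close> and the
  polynomial variable \<open>\<rho>\<close> jointly. It is stable under products, unlike a statement
  about single coefficients.\<close>

definition homogeneous_poly :: "nat \<Rightarrow> nat \<Rightarrow> ((nat \<Rightarrow> real) \<Rightarrow> real poly) \<Rightarrow> bool" where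
  "homogeneous_poly n d W \<longleftrightarrow> (\<forall>v. degree (W v) \<le> d) \<and>
     (\<forall>j\<le>d. homogeneous_form {0..<n} (d - j) (\<lambda>v. coeff (W v) j))"

lemma homogeneous_poly_0: "homogeneous_poly n d (\<lambda>v. 0)"
  by (simp add: homogeneous_poly_def homogeneous_form_0)

lemma homogeneous_poly_add:
  "homogeneous_poly n d V \<Longrightarrow> homogeneous_poly n d W \<Longrightarrow> homogeneous_poly n d (\<lambda>v. V v + W v)"
  by (simp add: homogeneous_poly_def homogeneous_form_add degree_add_le)

lemma homogeneous_poly_sum:
  "(\<And>s. s \<in> S \<Longrightarrow> homogeneous_poly n d (W s)) \<Longrightarrow> homogeneous_poly n d (\<lambda>v. \<Sum>s\<in>S. W s v)"
  by (induction S rule: infinite_finite_induct) (simp_all add: homogeneous_poly_0 homogeneous_poly_add)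

lemma homogeneous_poly_mult:
  assumes V: "homogeneous_poly n d V" and W: "homogeneous_poly n e W"
  shows "homogeneous_poly n (d + e) (\<lambda>v. V v * W v)"
  unfolding homogeneous_poly_def
proof (intro conjI allI impI)
  fix v show "degree (V v * W v) \<le> d + e"
    using V W unfolding homogeneous_poly_def
    by (meson add_mono degree_mult_le order_trans)
next
  fix j assume j: "j \<le> d + e"
  have z: "coeff (V v) i = 0" if "i > d" for v i
    using V that unfolding homogeneous_poly_def by (meson coeff_eq_0 le_less_trans)
  have z': "coeff (W v) i = 0" if "i > e" for v i
    using W that unfolding homogeneous_poly_def by (meson coeff_eq_0 le_less_trans)
  have "homogeneous_form {0..<n} (d + e - j) (\<lambda>v. coeff (V v) i * coeff (W v) (j - i))" if "i \<le> j" for i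
  proof (cases "i \<le> d \<and> j - i \<le> e")
    case True
    then have "homogeneous_form {0..<n} ((d - i) + (e - (j - i))) (\<lambda>v. coeff (V v) i * coeff (W v) (j - i))"
      using V W by (intro homogeneous_form_mult) (auto simp: homogeneous_poly_def)
    moreover have "(d - i) + (e - (j - i)) = d + e - j" using True that by linarith
    ultimately show ?thesis by simp
  next
    case False
    then show ?thesis using z z' by (auto simp: not_le homogeneous_form_0)
  qed
  then show "homogeneous_form {0..<n} (d + e - j) (\<lambda>v. coeff (V v * W v) j)"
    unfolding coeff_mult by (intro homogeneous_form_sum) auto
qed

lemma homogeneous_poly_const: "homogeneous_poly n 0 (\<lambda>v. [:c:])"
  by (simp add: homogeneous_poly_def homogeneous_form_const)

lemma homogeneous_poly_linear: "k < n \<Longrightarrow> homogeneous_poly n 1 (\<lambda>v. [:v k, c:])"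
  using homogeneous_form_var[of "{0..<n}" k]
  by (auto simp: homogeneous_poly_def homogeneous_form_const le_Suc_eq)

lemma homogeneous_poly_prod:
  "finite S \<Longrightarrow> (\<And>s. s \<in> S \<Longrightarrow> homogeneous_poly n 1 (W s)) \<Longrightarrow>
    homogeneous_poly n (card S) (\<lambda>v. \<Prod>s\<in>S. W s v)"
proof (induction S rule: finite_induct)
  case empty
  then show ?case using homogeneous_poly_const[of n 1] by (simp flip: one_pCons)
next
  case (insert s S)
  then show ?case using homogeneous_poly_mult[of n 1 "W s" "card S"] by simp
qed

text \<open>With \<open>\<alpha> k\<close> and \<open>\<beta> k\<close> the components below,
  \<open>\<zeta>\<^sub>\<plusminus> ^ k = \<alpha> k \<plusminus> \<beta> k * root_term X C \<rho>\<close>.\<close>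

primrec zeta_pow :: "real \<Rightarrow> real \<Rightarrow> real \<Rightarrow> nat \<Rightarrow> real poly \<times> real poly" where
  "zeta_pow p X C 0 = (1, 0)"
| "zeta_pow p X C (Suc k) =
    ([:C, p\<^sup>2 + X\<^sup>2:] * fst (zeta_pow p X C k)
       + [:2 * p:] * ([:0, 1:] * [:C, X\<^sup>2:]) * snd (zeta_pow p X C k),
     [:C, p\<^sup>2 + X\<^sup>2:] * snd (zeta_pow p X C k) + [:2 * p:] * fst (zeta_pow p X C k))"

lemma root_term_square: "(root_term X C \<rho>)\<^sup>2 = complex_of_real (\<rho> * (C + X\<^sup>2 * \<rho>))"
  by (simp add: root_term_def)

lemma zeta_pow_correct:
  shows "zeta_plus p X C \<rho> ^ k = complex_of_real (poly (fst (zeta_pow p X C k)) \<rho>)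
      + complex_of_real (poly (snd (zeta_pow p X C k)) \<rho>) * root_term X C \<rho>"
    and "zeta_minus p X C \<rho> ^ k = complex_of_real (poly (fst (zeta_pow p X C k)) \<rho>)
      - complex_of_real (poly (snd (zeta_pow p X C k)) \<rho>) * root_term X C \<rho>"
proof -
  define a r u w where "a = complex_of_real (C + (p\<^sup>2 + X\<^sup>2) * \<rho>)" and "r = root_term X C \<rho>"
    and "u k = complex_of_real (poly (fst (zeta_pow p X C k)) \<rho>)"
    and "w k = complex_of_real (poly (snd (zeta_pow p X C k)) \<rho>)" for k
  have r2: "r * r = complex_of_real (\<rho> * (C + X\<^sup>2 * \<rho>))"
    using root_term_square[of X C \<rho>] by (simp add: r_def power2_eq_square)
  have u: "u (Suc k) = a * u k + 2 * complex_of_real p * (r * r) * w k"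
    and w: "w (Suc k) = a * w k + 2 * complex_of_real p * u k" for k
    unfolding r2 by (simp_all add: u_def w_def a_def algebra_simps)
  have u0: "u 0 = 1" "w 0 = 0" by (simp_all add: u_def w_def)
  have "(a + 2 * complex_of_real p * r) ^ k = u k + w k * r"
  proof (induction k)
    case (Suc k)
    then show ?case unfolding power_Suc Suc u w by (simp add: algebra_simps)
  qed (simp add: u0)
  moreover have "(a - 2 * complex_of_real p * r) ^ k = u k - w k * r"
  proof (induction k)
    case (Suc k)
    then show ?case unfolding power_Suc Suc u w by (simp add: algebra_simps)
  qed (simp add: u0)
  ultimately show "zeta_plus p X C \<rho> ^ k = u k + w k * r" "zeta_minus p X C \<rho> ^ k = u k - w k * r"
    by (simp_all add: zeta_plus_def zeta_minus_def a_def r_def)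
qed

definition p_coeff_poly :: "nat \<Rightarrow> (nat \<Rightarrow> real) \<Rightarrow> nat \<Rightarrow> real poly" where
  "p_coeff_poly n x i = (-1) ^ (n div 2 - i) * esum (\<lambda>k. [:x k, 1:]) n (n div 2 - i)"

lemma poly_p_coeff_poly: "poly (p_coeff_poly n x i) \<rho> = p_coeff n x \<rho> i"
  by (simp add: p_coeff_poly_def p_coeff_esum esum_def poly_sum poly_prod)

definition even_poly :: "nat \<Rightarrow> real \<Rightarrow> real \<Rightarrow> real \<Rightarrow> (nat \<Rightarrow> real) \<Rightarrow> real poly" where
  "even_poly n p X C x = (\<Sum>j\<le>n div 2. [:2:] * p_coeff_poly n x j * fst (zeta_pow p X C j))"

definition odd_poly :: "nat \<Rightarrow> real \<Rightarrow> real \<Rightarrow> real \<Rightarrow> (nat \<Rightarrow> real) \<Rightarrow> real poly" where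
  "odd_poly n p X C x = (\<Sum>j\<le>n div 2. [:2:] * p_coeff_poly n x j * snd (zeta_pow p X C j))"

lemma even_poly_eq:
  "complex_of_real (poly (even_poly n p X C x) \<rho>)
    = P n x \<rho> (zeta_plus p X C \<rho>) + P n x \<rho> (zeta_minus p X C \<rho>)"
  unfolding P_sum even_poly_def poly_sum of_real_sum sum.distrib[symmetric] zeta_pow_correct
  by (rule sum.cong) (simp_all add: poly_p_coeff_poly algebra_simps)

lemma odd_poly_eq:
  "complex_of_real (poly (odd_poly n p X C x) \<rho>) * root_term X C \<rho>
    = P n x \<rho> (zeta_plus p X C \<rho>) - P n x \<rho> (zeta_minus p X C \<rho>)"
  unfolding P_sum odd_poly_def poly_sum of_real_sum sum_subtractf[symmetric] zeta_pow_correct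
    sum_distrib_right
  by (rule sum.cong) (simp_all add: poly_p_coeff_poly algebra_simps)

lemma represents_even_poly: "represents_R_even n p X C x (even_poly n p X C x)"
  by (simp add: represents_R_even_def R_even_fun_def even_poly_eq)

lemma represents_odd_poly: "represents_R_odd n p X C x (odd_poly n p X C x)"
  unfolding represents_R_odd_def R_odd_fun_def
proof (intro allI impI)
  fix \<rho> assume "\<rho> * (C + X\<^sup>2 * \<rho>) \<noteq> 0"
  then have "root_term X C \<rho> \<noteq> 0"
    using root_term_square[of X C \<rho>] by (metis of_real_eq_0_iff zero_power2)
  then show "complex_of_real (poly (odd_poly n p X C x) \<rho>)
      = (P n x \<rho> (zeta_plus p X C \<rho>) - P n x \<rho> (zeta_minus p X C \<rho>)) / root_term X C \<rho>"
    by (simp add: field_simps flip: odd_poly_eq)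
qed

lemma poly_eq_if_infinite:
  fixes f g :: "'a::idom poly"
  assumes "infinite S" "\<And>t. t \<in> S \<Longrightarrow> poly f t = poly g t"
  shows "f = g"
proof (rule ccontr)
  assume "f \<noteq> g"
  then have "finite {t. poly (f - g) t = 0}" by (intro poly_roots_finite) simp
  moreover have "S \<subseteq> {t. poly (f - g) t = 0}" using assms(2) by auto
  ultimately show False using assms(1) finite_subset by blast
qed

lemma R_even_eq: "R_even n p X C x = even_poly n p X C x"
  unfolding R_even_def
proof (rule the_equality[of "represents_R_even n p X C x"])
  fix q assume "represents_R_even n p X C x q"
  then have "complex_of_real (poly q \<rho>) = complex_of_real (poly (even_poly n p X C x) \<rho>)" for \<rho>
    using represents_even_poly[of n p X C x] by (simp add: represents_R_even_def)
  then have "poly q \<rho> = poly (even_poly n p X C x) \<rho>" for \<rho> using of_real_eq_iff by blast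
  then show "q = even_poly n p X C x" by (simp add: poly_eq_poly_eq_iff[symmetric] ext)
qed (rule represents_even_poly)

lemma R_odd_eq:
  assumes "X \<noteq> 0" shows "R_odd n p X C x = odd_poly n p X C x"
  unfolding R_odd_def
proof (rule the_equality[of "represents_R_odd n p X C x"])
  fix q assume q: "represents_R_odd n p X C x q"
  have "[:0, C, X\<^sup>2:] \<noteq> 0" using assms by simp
  then have "finite {\<rho>. poly [:0, C, X\<^sup>2:] \<rho> = 0}" by (rule poly_roots_finite)
  then have "infinite (UNIV - {\<rho>. poly [:0, C, X\<^sup>2:] \<rho> = 0})"
    using infinite_UNIV_char_0 by (rule Diff_infinite_finite)
  then show "q = odd_poly n p X C x"
  proof (rule poly_eq_if_infinite)
    fix \<rho> assume "\<rho> \<in> UNIV - {\<rho>. poly [:0, C, X\<^sup>2:] \<rho> = 0}"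
    then have "\<rho> * (C + X\<^sup>2 * \<rho>) \<noteq> 0" by (simp add: mult.commute)
    then have "complex_of_real (poly q \<rho>) = complex_of_real (poly (odd_poly n p X C x) \<rho>)"
      using represents_odd_poly[of n p X C x] q by (simp add: represents_R_odd_def)
    then show "poly q \<rho> = poly (odd_poly n p X C x) \<rho>" using of_real_eq_iff by blast
  qed
qed (rule represents_odd_poly)

text \<open>Both \<open>zeta_plus\<close> and \<open>root_term\<close> have weight 1 in
  \<open>C\<close> and \<open>\<rho>\<close>, so the cofactor of \<open>root_term\<close> has one
  degree less than the power. Stating it for \<open>Suc k\<close> avoids subtraction.\<close>

lemma homogeneous_zeta_pow:
  assumes "0 < n"
  shows "homogeneous_poly n k (\<lambda>v. fst (zeta_pow p X (v 0) k))"
    and "homogeneous_poly n k (\<lambda>v. snd (zeta_pow p X (v 0) (Suc k)))"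
proof -
  let ?a = "\<lambda>v. [:v 0 :: real, p\<^sup>2 + X\<^sup>2:]"
  let ?f = "\<lambda>k v. fst (zeta_pow p X (v 0) k)" and ?s = "\<lambda>k v. snd (zeta_pow p X (v 0) k)"
  note lin = homogeneous_poly_linear[OF assms]
  note const = homogeneous_poly_const
  have X1: "homogeneous_poly n 1 (\<lambda>v. [:0, 1:])"
    by (auto simp: homogeneous_poly_def homogeneous_form_const homogeneous_form_0 le_Suc_eq)
  have snd_step: "homogeneous_poly n k (?s (Suc k))"
    if "homogeneous_poly n k (?f k)" "homogeneous_poly n k (\<lambda>v. ?a v * ?s k v)" for k
    using homogeneous_poly_add[OF that(2) homogeneous_poly_mult[OF const[of n "2 * p"] that(1), simplified add_0]]
    by (simp only: zeta_pow.simps snd_conv)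
  \<comment> \<open>At \<open>k = 0\<close> the second component is 0 and its degree would be -1.
    Multiplying it by a linear polynomial gives an invariant of degree \<open>k\<close> that also
    covers this case.\<close>
  have main: "homogeneous_poly n k (?f k) \<and> homogeneous_poly n k (\<lambda>v. [:0, 1:] * ?s k v)
    \<and> homogeneous_poly n k (\<lambda>v. ?a v * ?s k v)" for k
  proof (induction k)
    case 0
    show ?case using const[of n 1] by (simp add: homogeneous_poly_0 flip: one_pCons)
  next
    case (Suc k)
    have e: "?f (Suc k) v = ?a v * ?f k v + [:2 * p:] * ([:v 0, X\<^sup>2:] * ([:0, 1:] * ?s k v))" for v
      by (simp only: zeta_pow.simps fst_conv mult_ac)
    have "homogeneous_poly n (1 + k) (\<lambda>v. ?a v * ?f k v)"
      by (rule homogeneous_poly_mult[OF lin]) (use Suc in blast)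
    moreover have "homogeneous_poly n (0 + (1 + k)) (\<lambda>v. [:2 * p:] * ([:v 0, X\<^sup>2:] * ([:0, 1:] * ?s k v)))"
      by (rule homogeneous_poly_mult[OF const homogeneous_poly_mult[OF lin]]) (use Suc in blast)
    ultimately have "homogeneous_poly n (Suc k) (?f (Suc k))"
      unfolding e plus_1_eq_Suc add_0 by (rule homogeneous_poly_add)
    moreover have s: "homogeneous_poly n k (?s (Suc k))" using snd_step Suc by blast
    moreover have "homogeneous_poly n (Suc k) (\<lambda>v. [:0, 1:] * ?s (Suc k) v)"
      using homogeneous_poly_mult[OF X1 s] by (simp only: plus_1_eq_Suc)
    moreover have "homogeneous_poly n (Suc k) (\<lambda>v. ?a v * ?s (Suc k) v)"
      using homogeneous_poly_mult[OF lin s] by (simp only: plus_1_eq_Suc)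
    ultimately show ?case by blast
  qed
  show "homogeneous_poly n k (?f k)" "homogeneous_poly n k (?s (Suc k))"
    using main snd_step by blast+
qed

lemma homogeneous_p_coeff_poly:
  "homogeneous_poly n (n div 2 - j) (\<lambda>v. p_coeff_poly n v j)"
proof -
  let ?k = "n div 2 - j"
  have "homogeneous_poly n ?k (\<lambda>v. \<Prod>i\<in>S. [:v i, 1:])" if "S \<in> sparse_subsets n ?k" for S
  proof -
    have S: "finite S" "S \<subseteq> {1..<n}" "card S = ?k"
      using that by (auto simp: sparse_subsets_def intro: finite_subset)
    then have "homogeneous_poly n (card S) (\<lambda>v. \<Prod>i\<in>S. [:v i, 1:])"
      by (intro homogeneous_poly_prod homogeneous_poly_linear) auto
    then show ?thesis using S by simp
  qed
  then have "homogeneous_poly n (0 + ?k) (\<lambda>v. [:(-1) ^ ?k:] * esum (\<lambda>k. [:v k, 1:]) n ?k)"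
    unfolding esum_def by (intro homogeneous_poly_mult homogeneous_poly_const homogeneous_poly_sum)
  moreover have "[:(-1) ^ ?k:] = (-1 :: real poly) ^ ?k"
    by (metis poly_const_pow one_pCons minus_pCons minus_zero)
  ultimately show ?thesis by (simp add: p_coeff_poly_def)
qed

lemma homogeneous_even_poly:
  assumes "0 < n" shows "homogeneous_poly n (n div 2) (\<lambda>v. even_poly n p X (v 0) v)"
  unfolding even_poly_def
proof (rule homogeneous_poly_sum)
  fix j assume "j \<in> {..n div 2}"
  then show "homogeneous_poly n (n div 2) (\<lambda>v. [:2:] * p_coeff_poly n v j * fst (zeta_pow p X (v 0) j))"
    using homogeneous_poly_mult[OF homogeneous_poly_mult[OF homogeneous_poly_const[of n 2]
          homogeneous_p_coeff_poly[of n j]] homogeneous_zeta_pow(1)[OF assms, of j p X]] by simp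
qed

lemma homogeneous_odd_poly:
  assumes "0 < n" shows "homogeneous_poly n (n div 2 - 1) (\<lambda>v. odd_poly n p X (v 0) v)"
  unfolding odd_poly_def
proof (rule homogeneous_poly_sum)
  fix j assume j: "j \<in> {..n div 2}"
  show "homogeneous_poly n (n div 2 - 1) (\<lambda>v. [:2:] * p_coeff_poly n v j * snd (zeta_pow p X (v 0) j))"
  proof (cases j)
    case 0
    then show ?thesis by (simp add: homogeneous_poly_0)
  next
    case (Suc i)
    have "0 + (n div 2 - j) + i = n div 2 - 1" using j Suc by simp
    then show ?thesis
      using homogeneous_poly_mult[OF homogeneous_poly_mult[OF homogeneous_poly_const[of n 2]
          homogeneous_p_coeff_poly[of n j]] homogeneous_zeta_pow(2)[OF assms, of i p X]] Suc by metis
  qed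
qed

lemma p_coeff_poly_cong:
  "(\<And>k. 1 \<le> k \<Longrightarrow> k < n \<Longrightarrow> x k = y k) \<Longrightarrow> p_coeff_poly n x j = p_coeff_poly n y j"
  unfolding p_coeff_poly_def esum_def
  by (intro arg_cong2[of _ _ _ _ "(*)"] refl sum.cong prod.cong) (auto simp: sparse_subsets_def)

text \<open>Sparse sets start at index 1, so slot 0 of \<open>x\<close> is free to store
  \<open>C\<close>.\<close>

lemma even_odd_poly_upd:
  "even_poly n p X C (x(0 := c)) = even_poly n p X C x"
  "odd_poly n p X C (x(0 := c)) = odd_poly n p X C x"
  using p_coeff_poly_cong[of n "x(0 := c)" x] by (simp_all add: even_poly_def odd_poly_def)

text \<open>With \<open>w = sqrt (X ^ 2 + C / \<rho>)\<close> both zetas are \<open>\<rho>\<close>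
  times a square. The numbers \<open>p + w\<close> and \<open>p - w\<close> are the intercepts
  \<open>l\<close> of the two tangents of \<open>E\<close> with
  \<open>1 + t ^ 2 = 1 / \<rho>\<close>.\<close>

lemma zeta_sqrt:
  assumes "0 < \<rho>" "0 \<le> w" "\<rho> * w\<^sup>2 = C + X\<^sup>2 * \<rho>"
  shows "root_term X C \<rho> = complex_of_real (\<rho> * w)"
    and "zeta_plus p X C \<rho> = complex_of_real (\<rho> * (p + w)\<^sup>2)"
    and "zeta_minus p X C \<rho> = complex_of_real (\<rho> * (p - w)\<^sup>2)"
proof -
  have "\<rho> * (C + X\<^sup>2 * \<rho>) = (\<rho> * w)\<^sup>2"
    unfolding assms(3)[symmetric] by (simp add: power2_eq_square)
  then show r: "root_term X C \<rho> = complex_of_real (\<rho> * w)"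
    unfolding root_term_def using assms by (subst csqrt_of_real_nonneg) auto
  have C: "C = \<rho> * w\<^sup>2 - X\<^sup>2 * \<rho>" using assms(3) by simp
  have e: "C + (p\<^sup>2 + X\<^sup>2) * \<rho> + 2 * p * (\<rho> * w) = \<rho> * (p + w)\<^sup>2"
    "C + (p\<^sup>2 + X\<^sup>2) * \<rho> - 2 * p * (\<rho> * w) = \<rho> * (p - w)\<^sup>2"
    unfolding C by (simp_all add: power2_eq_square algebra_simps)
  have "zeta_plus p X C \<rho> = complex_of_real (C + (p\<^sup>2 + X\<^sup>2) * \<rho> + 2 * p * (\<rho> * w))"
    "zeta_minus p X C \<rho> = complex_of_real (C + (p\<^sup>2 + X\<^sup>2) * \<rho> - 2 * p * (\<rho> * w))"
    unfolding zeta_plus_def zeta_minus_def r by simp_all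
  then show "zeta_plus p X C \<rho> = complex_of_real (\<rho> * (p + w)\<^sup>2)"
    "zeta_minus p X C \<rho> = complex_of_real (\<rho> * (p - w)\<^sup>2)"
    unfolding e .
qed

text \<open>\<open>ctn_scale\<close> with factor \<open>sqrt \<rho>\<close>; this passes between the
  normalization by \<open>cos \<theta>\<close> in \<open>P\<close> and the one by \<open>t\<close>
  in the lines.\<close>

lemma P_of_ctn:
  assumes "0 < \<rho>"
  shows "complex_of_real (sqrt \<rho> ^ n * ctn (\<lambda>k. x k / \<rho> + 1) l n)
    = complex_of_real (sqrt \<rho> * l) ^ (n mod 2) * P n x \<rho> (complex_of_real (\<rho> * l\<^sup>2))"
proof -
  have "sqrt \<rho> ^ n * ctn (\<lambda>k. x k / \<rho> + 1) l n
      = ctn (\<lambda>k. (sqrt \<rho>)\<^sup>2 * (x k / \<rho> + 1)) (sqrt \<rho> * l) n"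
    by (simp only: ctn_scale)
  also have "\<dots> = ctn (\<lambda>k. x k + \<rho>) (sqrt \<rho> * l) n"
    using assms by (simp add: distrib_left)
  finally have "complex_of_real (sqrt \<rho> ^ n * ctn (\<lambda>k. x k / \<rho> + 1) l n)
      = ctn (\<lambda>k. complex_of_real (x k + \<rho>)) (complex_of_real (sqrt \<rho> * l)) n"
    by (simp only: of_real_hom.hom_ctn)
  also have "(complex_of_real (sqrt \<rho> * l))\<^sup>2 = complex_of_real (\<rho> * l\<^sup>2)"
    using assms by (simp add: power_mult_distrib flip: of_real_power)
  ultimately show ?thesis by (simp only: ctn_eq_P)
qed

lemma P_eq_0_of_ctn:
  assumes "0 < \<rho>" "ctn (\<lambda>k. x k / \<rho> + 1) l n = 0" "l \<noteq> 0"
  shows "P n x \<rho> (complex_of_real (\<rho> * l\<^sup>2)) = 0"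
  using P_of_ctn[OF assms(1), of n x l] assms by simp

text \<open>Infinitely many \<open>\<rho>\<close> determine a polynomial. The condition on
  \<open>root_term\<close> allows it to be cancelled from the odd part.\<close>

lemma even_odd_poly_eq_0I:
  assumes "infinite S"
    and "\<And>\<rho>. \<rho> \<in> S \<Longrightarrow> P n x \<rho> (zeta_plus p X C \<rho>) = 0 \<and> P n x \<rho> (zeta_minus p X C \<rho>) = 0
      \<and> root_term X C \<rho> \<noteq> 0"
  shows "even_poly n p X C x = 0 \<and> odd_poly n p X C x = 0"
proof (intro conjI poly_eq_if_infinite[OF assms(1)])
  fix \<rho> assume "\<rho> \<in> S"
  note * = assms(2)[OF this]
  show "poly (even_poly n p X C x) \<rho> = poly 0 \<rho>"
    using even_poly_eq[of n p X C x \<rho>] * by simp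
  show "poly (odd_poly n p X C x) \<rho> = poly 0 \<rho>"
    using odd_poly_eq[of n p X C x \<rho>] * by simp
qed

lemma even_odd_poly_eq_0D:
  assumes "even_poly n p X C x = 0" "odd_poly n p X C x = 0"
  shows "P n x \<rho> (zeta_plus p X C \<rho>) = 0" "P n x \<rho> (zeta_minus p X C \<rho>) = 0"
proof -
  have "P n x \<rho> (zeta_plus p X C \<rho>) + P n x \<rho> (zeta_minus p X C \<rho>) = 0"
    using even_poly_eq[of n p X C x \<rho>] assms by simp
  moreover have "P n x \<rho> (zeta_plus p X C \<rho>) - P n x \<rho> (zeta_minus p X C \<rho>) = 0"
    using odd_poly_eq[of n p X C x \<rho>] assms by simp
  ultimately show "P n x \<rho> (zeta_plus p X C \<rho>) = 0" "P n x \<rho> (zeta_minus p X C \<rho>) = 0"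
    by simp_all
qed

text \<open>The reflection \<open>k \<mapsto> Suc n - k\<close> changes the sign of these decreasing
  numbers, so the sign changes in the middle of the index range.\<close>

lemma cheb_root_pos:
  assumes "k \<le> Suc n" shows "0 < cheb_root n k \<longleftrightarrow> 2 * k < Suc n"
proof -
  have "cheb_root n (Suc n - k) = - cheb_root n k" using assms by (rule cheb_root_reflect)
  moreover have "cheb_root n (Suc n - k) < cheb_root n k" if "2 * k < Suc n"
    using that by (intro cheb_root_less) auto
  moreover have "cheb_root n k \<le> cheb_root n (Suc n - k)" if "\<not> 2 * k < Suc n"
  proof -
    have "Suc n - k < k \<or> Suc n - k = k" using that assms by linarith
    then show ?thesis using cheb_root_less[of "Suc n - k" k n] assms by auto
  qed
  ultimately show ?thesis by force
qed

text \<open>The left side is the reversed polynomial. Two missing top coefficients become a double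
  zero at \<open>\<epsilon> = 0\<close>.\<close>

lemma scaled_reverse_double_zero:
  fixes q :: "real poly"
  assumes "degree q \<le> d" "coeff q d = 0" "coeff q (d - 1) = 0" "1 \<le> d"
  shows "\<exists>A. \<forall>\<epsilon>. \<epsilon> \<noteq> 0 \<longrightarrow> \<epsilon> ^ d * poly q (1 / \<epsilon>) = \<epsilon>\<^sup>2 * poly A \<epsilon>"
proof (intro exI allI impI)
  fix \<epsilon> :: real assume \<epsilon>: "\<epsilon> \<noteq> 0"
  define A where "A = (\<Sum>j<d - 1. monom (coeff q j) (d - 2 - j))"
  have "poly q (1 / \<epsilon>) = (\<Sum>j\<le>d. coeff q j * (1 / \<epsilon>) ^ j)"
    unfolding poly_altdef by (rule sum.mono_neutral_left) (use assms(1) in \<open>auto simp: coeff_eq_0\<close>)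
  also have "\<dots> = (\<Sum>j<d - 1. coeff q j * (1 / \<epsilon>) ^ j)"
  proof (rule sum.mono_neutral_right)
    show "\<forall>i\<in>{..d} - {..<d - 1}. coeff q i * (1 / \<epsilon>) ^ i = 0"
    proof
      fix i assume "i \<in> {..d} - {..<d - 1}"
      then have "i = d \<or> i = d - 1" by auto
      then show "coeff q i * (1 / \<epsilon>) ^ i = 0" using assms by auto
    qed
  qed auto
  also have "\<epsilon> ^ d * \<dots> = (\<Sum>j<d - 1. \<epsilon>\<^sup>2 * (coeff q j * \<epsilon> ^ (d - 2 - j)))"
    unfolding sum_distrib_left
  proof (rule sum.cong)
    fix j assume "j \<in> {..<d - 1}"
    then have "d = 2 + (d - 2 - j) + j" by auto
    then have "\<epsilon> ^ d = \<epsilon>\<^sup>2 * \<epsilon> ^ (d - 2 - j) * \<epsilon> ^ j" by (metis power_add)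
    then show "\<epsilon> ^ d * (coeff q j * (1 / \<epsilon>) ^ j) = \<epsilon>\<^sup>2 * (coeff q j * \<epsilon> ^ (d - 2 - j))"
      using \<epsilon> by (simp add: power_one_over)
  qed simp
  also have "\<dots> = \<epsilon>\<^sup>2 * poly A \<epsilon>"
    by (simp add: A_def poly_sum poly_monom sum_distrib_left)
  finally show "\<epsilon> ^ d * poly q (1 / \<epsilon>) = \<epsilon>\<^sup>2 * poly A \<epsilon>" .
qed

section \<open>Focal pairs and the elimination of \<open>C\<close>\<close>

locale focal =
  fixes n :: nat and p X :: real
  assumes p_pos: "0 < p" and X_pos: "0 < X" and p_ne_X: "p - X \<noteq> 0"
    and root_add: "ctn (\<lambda>_. 1) (p + X) n = 0" and root_diff: "ctn (\<lambda>_. 1) (p - X) n = 0"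
begin

text \<open>\<open>p + X\<close> and \<open>\<bar>p - X\<bar>\<close> are two different positive
  eigenvalues, and positive eigenvalues have indices at most \<open>n div 2\<close>.\<close>

lemma two_le_half: "2 \<le> n div 2"
proof -
  obtain k where k: "k \<in> {1..n}" "p + X = cheb_root n k"
    using root_add ctn_one_roots[of n] by blast
  obtain k1 where k1: "k1 \<in> {1..n}" "p - X = cheb_root n k1"
    using root_diff ctn_one_roots[of n] by blast
  obtain k' where k': "k' \<in> {1..n}" "\<bar>p - X\<bar> = cheb_root n k'"
  proof (cases "0 \<le> p - X")
    case True
    then show ?thesis using that k1 by simp
  next
    case False
    then have "\<bar>p - X\<bar> = cheb_root n (Suc n - k1)" using k1 cheb_root_reflect[of k1 n] by simp
    moreover have "Suc n - k1 \<in> {1..n}" using k1 by auto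
    ultimately show ?thesis using that by blast
  qed
  have "cheb_root n k' < cheb_root n k" using k k' p_pos X_pos by linarith
  then have "k < k'" using cheb_root_less[of k' k n] k by (cases k k' rule: linorder_cases) auto
  moreover have "2 * k' < Suc n" using cheb_root_pos[of k' n] k' p_ne_X by auto
  ultimately show ?thesis using k by auto
qed

lemma n_pos: "0 < n" using two_le_half by (cases n) auto

text \<open>For \<open>C = 0\<close> one has \<open>w = X\<close>, and for vanishing
  \<open>x\<close> the continuant is the characteristic polynomial, which vanishes at
  \<open>p + X\<close> and \<open>p - X\<close>.\<close>

lemma even_odd_poly_0: "even_poly n p X 0 (\<lambda>_. 0) = 0 \<and> odd_poly n p X 0 (\<lambda>_. 0) = 0"
proof (rule even_odd_poly_eq_0I[of "{0<..}"])
  fix \<rho> :: real assume "\<rho> \<in> {0<..}"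
  then have \<rho>: "0 < \<rho>" by simp
  note z = zeta_sqrt[OF \<rho>, of X 0 X]
  have "ctn (\<lambda>k. 0 / \<rho> + 1) (p + X) n = 0" "ctn (\<lambda>k. 0 / \<rho> + 1) (p - X) n = 0"
    using root_add root_diff by simp_all
  then have "P n (\<lambda>_. 0) \<rho> (complex_of_real (\<rho> * (p + X)\<^sup>2)) = 0"
    "P n (\<lambda>_. 0) \<rho> (complex_of_real (\<rho> * (p - X)\<^sup>2)) = 0"
    using P_eq_0_of_ctn[OF \<rho>, of "\<lambda>_. 0" "p + X" n] P_eq_0_of_ctn[OF \<rho>, of "\<lambda>_. 0" "p - X" n]
      add_pos_pos[OF p_pos X_pos] p_ne_X by (metis order_less_irrefl)+
  then show "P n (\<lambda>_. 0) \<rho> (zeta_plus p X 0 \<rho>) = 0 \<and> P n (\<lambda>_. 0) \<rho> (zeta_minus p X 0 \<rho>) = 0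
      \<and> root_term X 0 \<rho> \<noteq> 0"
    using z X_pos \<rho> by (simp add: mult.commute)
qed (simp add: infinite_Ioi)

text \<open>The top coefficient is a form of degree 0, hence constant, and can be computed at
  \<open>C = 0\<close>, \<open>x = 0\<close>.\<close>

lemma coeff_even_top: "coeff (even_poly n p X C x) (n div 2) = 0"
proof -
  have "homogeneous_form {0..<n} (n div 2 - (n div 2)) (\<lambda>v. coeff (even_poly n p X (v 0) v) (n div 2))"
    using homogeneous_even_poly[OF n_pos, of p X] unfolding homogeneous_poly_def by blast
  from homogeneous_form_degree_0[OF this[unfolded diff_self_eq_0], of "x(0 := C)" "\<lambda>_. 0"]
  show ?thesis by (simp add: even_odd_poly_upd even_odd_poly_0)
qed

lemma coeff_odd_top: "coeff (odd_poly n p X C x) (n div 2 - 1) = 0"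
proof -
  have "homogeneous_form {0..<n} (n div 2 - 1 - (n div 2 - 1)) (\<lambda>v. coeff (odd_poly n p X (v 0) v) (n div 2 - 1))"
    using homogeneous_odd_poly[OF n_pos, of p X] unfolding homogeneous_poly_def by blast
  from homogeneous_form_degree_0[OF this[unfolded diff_self_eq_0], of "x(0 := C)" "\<lambda>_. 0"]
  show ?thesis by (simp add: even_odd_poly_upd even_odd_poly_0)
qed

lemma degree_even: "degree (even_poly n p X C x) \<le> n div 2"
proof -
  have "\<forall>v. degree (even_poly n p X (v 0) v) \<le> n div 2"
    using homogeneous_even_poly[OF n_pos, of p X] unfolding homogeneous_poly_def by blast
  from this[rule_format, of "x(0 := C)"] show ?thesis by (simp add: even_odd_poly_upd)
qed

lemma degree_odd: "degree (odd_poly n p X C x) \<le> n div 2 - 1"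
proof -
  have "\<forall>v. degree (odd_poly n p X (v 0) v) \<le> n div 2 - 1"
    using homogeneous_odd_poly[OF n_pos, of p X] unfolding homogeneous_poly_def by blast
  from this[rule_format, of "x(0 := C)"] show ?thesis by (simp add: even_odd_poly_upd)
qed

lemma R_even: "R_even n p X C x = even_poly n p X C x"
  and R_odd: "R_odd n p X C x = odd_poly n p X C x"
  using X_pos by (simp_all add: R_even_eq R_odd_eq)

text \<open>If neither coefficient involved \<open>C\<close>, then \<open>P n 0 \<rho> (zeta_plus p X 1 \<rho>)\<close> would drop
  two degrees as \<open>\<rho> \<longrightarrow> \<infinity>\<close>. With \<open>w\<^sup>2 = X\<^sup>2 + 1 / \<rho>\<close> and
  \<open>zeta_plus p X 1 \<rho> = \<rho> * (p + w)\<^sup>2\<close> this makes \<open>p + X\<close> a double eigenvalue.\<close>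

lemma ex_can_eliminate: "\<exists>e. can_eliminate n p X e"
proof (rule ccontr)
  let ?m = "n div 2" and ?x = "\<lambda>_. 0 :: real"
  let ?E = "even_poly n p X 1 ?x" and ?O = "odd_poly n p X 1 ?x"
  assume "\<nexists>e. can_eliminate n p X e"
  then have "\<not> can_eliminate n p X From_even" "\<not> can_eliminate n p X From_odd" by blast+
  then have c: "coeff ?E (?m - 1) = 0" "coeff ?O (?m - 2) = 0"
    by (simp_all add: can_eliminate_def R_even R_odd)
  have m: "2 \<le> ?m" by (rule two_le_half)
  obtain Ae where Ae: "\<And>\<epsilon>. \<epsilon> \<noteq> 0 \<Longrightarrow> \<epsilon> ^ ?m * poly ?E (1 / \<epsilon>) = \<epsilon>\<^sup>2 * poly Ae \<epsilon>"
    using scaled_reverse_double_zero[OF degree_even coeff_even_top c(1)] m by auto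
  have c2: "coeff ?O (?m - 1 - 1) = 0" using c(2) by (simp add: numeral_2_eq_2)
  have m1: "1 \<le> ?m - 1" using m by simp
  obtain Ao where Ao: "\<And>\<epsilon>. \<epsilon> \<noteq> 0 \<Longrightarrow> \<epsilon> ^ (?m - 1) * poly ?O (1 / \<epsilon>) = \<epsilon>\<^sup>2 * poly Ao \<epsilon>"
    using scaled_reverse_double_zero[OF degree_odd coeff_odd_top c2 m1] by blast
  define chi where "chi = (ctn_poly (\<lambda>_. 1) n :: real poly)"
  define s where "s = [:- X\<^sup>2, 0, 1:]"
  define B where "B = [:p, 1:] ^ (n mod 2) * (pcompose Ae s + [:0, 1:] * pcompose Ao s)"
  \<comment> \<open>Since \<open>\<epsilon> = 1 / \<rho>\<close> is \<open>s\<close> evaluated at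
    \<open>w\<close>, the two degrees missing in \<open>\<rho>\<close> become the factor
    \<open>s ^ 2\<close>, and \<open>s\<close> vanishes at \<open>w = X\<close>.\<close>
  have "smult 2 (pcompose chi [:p, 1:]) = s ^ 2 * B"
  proof (rule poly_eq_if_infinite)
    fix w :: real assume "w \<in> {X<..}"
    then have w: "X < w" by simp
    define \<epsilon> \<rho> where "\<epsilon> = w\<^sup>2 - X\<^sup>2" and "\<rho> = 1 / \<epsilon>"
    have \<epsilon>: "0 < \<epsilon>" unfolding \<epsilon>_def using w X_pos by (simp add: power_strict_mono)
    have \<rho>: "0 < \<rho>" using \<epsilon> by (simp add: \<rho>_def)
    have "\<rho> * w\<^sup>2 = 1 + X\<^sup>2 * \<rho>" using \<epsilon> by (simp add: \<rho>_def field_simps) (simp add: \<epsilon>_def)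
    note z = zeta_sqrt[OF \<rho> _ this]
    have w0: "0 \<le> w" using w X_pos by simp
    have "complex_of_real (poly ?E \<rho> + poly ?O \<rho> * (\<rho> * w))
        = 2 * P n ?x \<rho> (complex_of_real (\<rho> * (p + w)\<^sup>2))"
      using even_poly_eq[of n p X 1 ?x \<rho>] odd_poly_eq[of n p X 1 ?x \<rho>] z[OF w0] by simp
    then have "complex_of_real (2 * (sqrt \<rho> ^ n * ctn (\<lambda>k. 1) (p + w) n))
      = complex_of_real ((sqrt \<rho> * (p + w)) ^ (n mod 2) * (poly ?E \<rho> + poly ?O \<rho> * (\<rho> * w)))"
      using P_of_ctn[OF \<rho>, of n ?x "p + w"] by simp
    then have "2 * (sqrt \<rho> ^ n * ctn (\<lambda>k. 1) (p + w) n)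
      = (sqrt \<rho> * (p + w)) ^ (n mod 2) * (poly ?E \<rho> + poly ?O \<rho> * (\<rho> * w))"
      using of_real_eq_iff by blast
    also have "sqrt \<rho> ^ n = sqrt \<rho> ^ (n mod 2) * \<rho> ^ ?m"
    proof -
      have "sqrt \<rho> ^ n = sqrt \<rho> ^ (n mod 2 + 2 * ?m)" by simp
      also have "\<dots> = sqrt \<rho> ^ (n mod 2) * (sqrt \<rho> ^ 2) ^ ?m" by (simp only: power_add power_mult)
      finally show ?thesis using \<rho> by simp
    qed
    finally have "sqrt \<rho> ^ (n mod 2) * (2 * (\<rho> ^ ?m * ctn (\<lambda>k. 1) (p + w) n))
      = sqrt \<rho> ^ (n mod 2) * ((p + w) ^ (n mod 2) * (poly ?E \<rho> + poly ?O \<rho> * (\<rho> * w)))"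
      by (simp add: power_mult_distrib mult_ac)
    then have "\<epsilon> ^ ?m * (2 * (\<rho> ^ ?m * ctn (\<lambda>k. 1) (p + w) n))
      = \<epsilon> ^ ?m * ((p + w) ^ (n mod 2) * (poly ?E \<rho> + poly ?O \<rho> * (\<rho> * w)))"
      using \<rho> by simp
    moreover have "\<epsilon> ^ ?m * (2 * (\<rho> ^ ?m * ctn (\<lambda>k. 1) (p + w) n)) = 2 * ctn (\<lambda>k. 1) (p + w) n"
      using \<epsilon> by (simp add: \<rho>_def power_one_over)
    moreover have "\<epsilon> ^ ?m * ((p + w) ^ (n mod 2) * (poly ?E \<rho> + poly ?O \<rho> * (\<rho> * w)))
      = (p + w) ^ (n mod 2) * (\<epsilon> ^ ?m * poly ?E \<rho> + w * (\<epsilon> ^ (?m - 1) * poly ?O \<rho>))"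
    proof -
      have "\<epsilon> ^ ?m * \<rho> = \<epsilon> ^ (?m - 1)"
        using \<epsilon> m by (simp add: \<rho>_def power_diff)
      then have "\<epsilon> ^ ?m * (poly ?O \<rho> * (\<rho> * w)) = w * (\<epsilon> ^ (?m - 1) * poly ?O \<rho>)"
        by (metis mult.assoc mult.commute)
      then show ?thesis by (auto simp: distrib_left mult.left_commute)
    qed
    ultimately have "2 * ctn (\<lambda>k. 1) (p + w) n
        = (p + w) ^ (n mod 2) * (\<epsilon>\<^sup>2 * poly Ae \<epsilon> + w * (\<epsilon>\<^sup>2 * poly Ao \<epsilon>))"
      using Ae[of \<epsilon>] Ao[of \<epsilon>] \<epsilon> by (simp add: \<rho>_def)
    moreover have "poly s w = \<epsilon>" by (simp add: s_def \<epsilon>_def power2_eq_square)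
    ultimately show "poly (smult 2 (pcompose chi [:p, 1:])) w = poly (s ^ 2 * B) w"
      by (simp add: chi_def B_def poly_pcompose algebra_simps)
  qed (simp add: infinite_Ioi)
  then have "poly (pderiv (smult 2 (pcompose chi [:p, 1:]))) X = poly (pderiv (s ^ 2 * B)) X"
    by simp
  moreover have "poly s X = 0" by (simp add: s_def power2_eq_square)
  ultimately have "poly (pderiv chi) (p + X) = 0"
    by (simp add: pderiv_smult pderiv_pcompose pderiv_mult poly_pcompose pderiv_pCons power2_eq_square)
  then show False
    using ctn_simple_roots[of n "\<lambda>_. 1" "p + X"] root_add by (simp add: chi_def)
qed

lemma homogeneous_elim_coeff:
  "homogeneous_form {0..<n} 1 (\<lambda>v. elim_coeff n p X e (v 0) v)"
proof (cases e)
  case From_even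
  have "homogeneous_form {0..<n} (n div 2 - (n div 2 - 1)) (\<lambda>v. coeff (even_poly n p X (v 0) v) (n div 2 - 1))"
    using homogeneous_even_poly[OF n_pos, of p X] unfolding homogeneous_poly_def by simp
  moreover have "n div 2 - (n div 2 - 1) = 1" using two_le_half by simp
  ultimately show ?thesis by (simp add: From_even R_even)
next
  case From_odd
  have "homogeneous_form {0..<n} (n div 2 - 1 - (n div 2 - 2)) (\<lambda>v. coeff (odd_poly n p X (v 0) v) (n div 2 - 2))"
    using homogeneous_odd_poly[OF n_pos, of p X] unfolding homogeneous_poly_def by simp
  moreover have "n div 2 - 1 - (n div 2 - 2) = 1" using two_le_half by simp
  ultimately show ?thesis by (simp add: From_odd R_odd)
qed

lemma elim_coeff_upd: "elim_coeff n p X e C (x(0 := c)) = elim_coeff n p X e C x"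
  by (cases e) (simp_all add: R_even R_odd even_odd_poly_upd)

lemma elim_coeff_split:
  "elim_coeff n p X e C x = C * elim_coeff n p X e 1 (\<lambda>_. 0) + elim_coeff n p X e 0 x"
proof -
  let ?v = "(\<lambda>_. 0)(0 := 1) :: nat \<Rightarrow> real"
  \<comment> \<open>Splits the argument into \<open>C\<close> times the unit vector of slot 0 and a
    vector with 0 in that slot, ready for linearity.\<close>
  have "(\<lambda>i. C * ?v i + (x(0 := 0)) i) = x(0 := C)" by auto
  then show ?thesis
    using homogeneous_form_degree_1[OF homogeneous_elim_coeff[of e], of C ?v "x(0 := 0)"]
    by (simp add: elim_coeff_upd)
qed

lemma elim_coeff_eq_0_iff:
  "can_eliminate n p X e \<Longrightarrow> elim_coeff n p X e C x = 0 \<longleftrightarrow> C = elim_C n p X e x"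
  by (auto simp: elim_coeff_split[of e C x] can_eliminate_def elim_C_def field_simps)

lemma homogeneous_elim_C: "homogeneous_form {1..<n} 1 (elim_C n p X e)"
proof -
  have "homogeneous_form {1..<n} 1 (\<lambda>x. elim_coeff n p X e ((x(0 := 0)) 0) (x(0 := 0)))"
    by (rule homogeneous_form_subst[OF homogeneous_elim_coeff[of e]]) (rule homogeneous_form_0)
  from homogeneous_form_cmult[OF _ this, of "- (1 / elim_coeff n p X e 1 (\<lambda>_. 0))"]
  have "homogeneous_form {1..<n} 1
      (\<lambda>x. - (1 / elim_coeff n p X e 1 (\<lambda>_. 0)) * elim_coeff n p X e 0 x)"
    by (simp add: elim_coeff_upd)
  moreover have "elim_C n p X e = (\<lambda>x. - (1 / elim_coeff n p X e 1 (\<lambda>_. 0)) * elim_coeff n p X e 0 x)"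
    by (rule ext) (simp add: elim_C_def)
  ultimately show ?thesis by simp
qed

lemma homogeneous_R:
  "j \<le> n div 2 \<Longrightarrow>
    homogeneous_form {0..<n} (n div 2 - j) (\<lambda>v. coeff (R_even n p X (v 0) v) j)"
  "j \<le> n div 2 - 1 \<Longrightarrow>
    homogeneous_form {0..<n} (n div 2 - j - 1) (\<lambda>v. coeff (R_odd n p X (v 0) v) j)"
  using homogeneous_even_poly[OF n_pos, of p X] homogeneous_odd_poly[OF n_pos, of p X]
  unfolding homogeneous_poly_def R_even R_odd by (simp_all add: diff_commute[of _ j 1])

lemma homogeneous_reduced:
  "j \<le> n div 2 \<Longrightarrow> \<exists>d. homogeneous_form {1..<n} d (\<lambda>x. coeff (R_even n p X (elim_C n p X e x) x) j)"
  "j \<le> n div 2 - 1 \<Longrightarrow> \<exists>d. homogeneous_form {1..<n} d (\<lambda>x. coeff (R_odd n p X (elim_C n p X e x) x) j)"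
  using homogeneous_form_subst[OF homogeneous_R(1) homogeneous_elim_C[of e], of j]
    homogeneous_form_subst[OF homogeneous_R(2) homogeneous_elim_C[of e], of j]
  by (auto simp: R_even R_odd even_odd_poly_upd)

lemma homogeneous_reduced_system:
  assumes "F \<in> set (reduced_system n p X e)"
  shows "\<exists>d. homogeneous_form {1..<n} d F"
proof (cases e)
  case From_even
  then obtain j where "j < n div 2 - 1"
    "F = (\<lambda>x. coeff (R_even n p X (elim_C n p X e x) x) j) \<or>
     F = (\<lambda>x. coeff (R_odd n p X (elim_C n p X e x) x) j)"
    using assms by auto
  then show ?thesis using homogeneous_reduced[of j e] by auto
next
  case From_odd
  then consider
    j where "j < n div 2" "F = (\<lambda>x. coeff (R_even n p X (elim_C n p X e x) x) j)"
    | j where "j < n div 2 - 2" "F = (\<lambda>x. coeff (R_odd n p X (elim_C n p X e x) x) j)"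
    using assms by auto
  then show ?thesis
  proof cases
    case (1 j)
    then show ?thesis using homogeneous_reduced(1)[of j e] by auto
  next
    case (2 j)
    then show ?thesis using homogeneous_reduced(2)[of j e] by auto
  qed
qed

lemma length_reduced_system: "length (reduced_system n p X e) = 2 * (n div 2) - 2"
  using two_le_half by (cases e) auto

text \<open>Of all coefficients the list omits only the two top ones, which vanish for every focal
  pair, and the one used for elimination, which vanishes by the choice of \<open>C\<close>.\<close>

lemma solves_iff:
  assumes "can_eliminate n p X e"
  shows "solves (reduced_system n p X e) x \<longleftrightarrow>
    even_poly n p X (elim_C n p X e x) x = 0 \<and> odd_poly n p X (elim_C n p X e x) x = 0"
proof
  let ?C = "elim_C n p X e x" and ?m = "n div 2"
  assume s: "solves (reduced_system n p X e) x"
  have e0: "elim_coeff n p X e ?C x = 0" using elim_coeff_eq_0_iff[OF assms] by simp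
  have m: "2 \<le> ?m" by (rule two_le_half)
  have from_even: "coeff (even_poly n p X ?C x) j = 0 \<and> coeff (odd_poly n p X ?C x) j = 0"
    if "e = From_even" "j < ?m - 1" for j
    using s that by (auto simp: solves_def R_even R_odd)
  have from_odd: "(j < ?m \<longrightarrow> coeff (even_poly n p X ?C x) j = 0) \<and>
      (j < ?m - 2 \<longrightarrow> coeff (odd_poly n p X ?C x) j = 0)" if "e = From_odd" for j
    using s that by (auto simp: solves_def R_even R_odd)
  have "coeff (even_poly n p X ?C x) j = 0" for j
  proof (cases "j < ?m - 1")
    case True
    then show ?thesis using from_even[of j] from_odd[of j] by (cases e) auto
  next
    case False
    then consider "j = ?m - 1" | "j = ?m" | "j > ?m" by linarith
    then show ?thesis
    proof cases
      case 1
      then show ?thesis using from_odd[of j] e0 m by (cases e) (auto simp: R_even)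
    next
      case 2
      then show ?thesis by (simp add: coeff_even_top)
    next
      case 3
      then show ?thesis using degree_even[of ?C x] by (intro coeff_eq_0) linarith
    qed
  qed
  moreover have "coeff (odd_poly n p X ?C x) j = 0" for j
  proof (cases "j < ?m - 2")
    case True
    then show ?thesis using from_even[of j] from_odd[of j] by (cases e) auto
  next
    case False
    then consider "j = ?m - 2" | "j = ?m - 1" | "j > ?m - 1" by linarith
    then show ?thesis
    proof cases
      case 1
      then show ?thesis using from_even[of j] e0 m by (cases e) (auto simp: R_odd)
    next
      case 2
      then show ?thesis using coeff_odd_top by simp
    next
      case 3
      then show ?thesis using degree_odd[of ?C x] by (intro coeff_eq_0) linarith
    qed
  qed
  ultimately show "even_poly n p X ?C x = 0 \<and> odd_poly n p X ?C x = 0"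
    by (simp add: poly_eq_iff)
next
  assume "even_poly n p X (elim_C n p X e x) x = 0 \<and> odd_poly n p X (elim_C n p X e x) x = 0"
  then show "solves (reduced_system n p X e) x"
    by (cases e) (auto simp: solves_def R_even R_odd)
qed

lemma elim_C_eqI:
  assumes "can_eliminate n p X e" "even_poly n p X C x = 0" "odd_poly n p X C x = 0"
  shows "C = elim_C n p X e x"
proof -
  have "elim_coeff n p X e C x = 0" using assms by (cases e) (simp_all add: R_even R_odd)
  then show ?thesis using elim_coeff_eq_0_iff[OF assms(1)] by simp
qed

end

section \<open>Multiple zeros of bivariate polynomials\<close>

text \<open>Inserting the outer value first leaves \<open>poly G [:t:]\<close>, a polynomial in
  \<open>s\<close>. Thus \<open>pderiv\<close> expresses either partial derivative, applied to
  \<open>G\<close> for \<open>t\<close> and to \<open>poly G [:t:]\<close> for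
  \<open>s\<close>.\<close>

definition eval2 :: "'a::comm_ring_1 poly poly \<Rightarrow> 'a \<Rightarrow> 'a \<Rightarrow> 'a" where
  "eval2 G s t = poly (poly G [:t:]) s"

lemma eval2_simps [simp]:
  "eval2 (F + G) s t = eval2 F s t + eval2 G s t"
  "eval2 (F - G) s t = eval2 F s t - eval2 G s t"
  "eval2 (F * G) s t = eval2 F s t * eval2 G s t"
  "eval2 [:c:] s t = poly c s"
  "eval2 0 s t = 0" "eval2 1 s t = 1"
  by (simp_all add: eval2_def)

lemma eval2_has_derivative_outer:
  fixes G :: "real poly poly"
  shows "((\<lambda>t. eval2 G s t) has_field_derivative eval2 (pderiv G) s t) (at t)"
proof (induction G)
  case (pCons a G)
  have e: "eval2 (pCons a G) s t = poly a s + t * eval2 G s t" for t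
    by (simp add: eval2_def)
  have d: "eval2 (pderiv (pCons a G)) s t = eval2 G s t + t * eval2 (pderiv G) s t"
    by (simp add: eval2_def pderiv_pCons)
  show ?case unfolding e d
    by (auto intro!: derivative_eq_intros pCons.IH)
qed simp

text \<open>Bezout over the fraction field of the coefficients, with denominators cleared. A
  non-zero combination \<open>g\<close> of least degree divides multiples of \<open>p\<close> and
  \<open>K\<close> by coefficients. If its degree were positive, primality of \<open>p\<close> would
  force \<open>p dvd g\<close> and then \<open>p dvd K\<close>.\<close>

lemma bezout_over_coefficients:
  fixes p K :: "'a::idom poly"
  assumes "prime_elem p" "\<not> p dvd K"
  shows "\<exists>c U V. c \<noteq> 0 \<and> [:c:] = U * p + V * K"
proof (cases "degree p = 0")
  case True
  then obtain c where "p = [:c:]" by (rule degree_eq_zeroE)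
  moreover from this have "c \<noteq> 0" using assms(1) by auto
  ultimately have "c \<noteq> 0 \<and> [:c:] = 1 * p + 0 * K" by simp
  then show ?thesis by blast
next
  case False
  define J where "J g \<longleftrightarrow> g \<noteq> 0 \<and> (\<exists>U V. g = U * p + V * K)" for g
  have "p \<noteq> 0" using assms(1) by auto
  have p: "p = 1 * p + 0 * K" and K: "K = 0 * p + 1 * K" by simp_all
  have "J p" unfolding J_def using p \<open>p \<noteq> 0\<close> by blast
  then obtain g where g: "J g" "\<And>h. J h \<Longrightarrow> degree g \<le> degree h"
    using ex_has_least_nat[of J p degree] by blast
  obtain U V where UV: "g = U * p + V * K" and g0: "g \<noteq> 0" using g(1) by (auto simp: J_def)
  \<comment> \<open>The pseudo-remainder is again a combination of \<open>p\<close> and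
    \<open>K\<close>, of smaller degree than \<open>g\<close>, hence 0.\<close>
  have divides: "\<exists>a q. a \<noteq> 0 \<and> smult a f = g * q" if f: "f = U' * p + V' * K" for f U' V'
  proof -
    obtain a q where aq: "a \<noteq> 0" "smult a f = g * q + pseudo_mod f g"
      using pseudo_mod(1)[OF g0] by blast
    have "pseudo_mod f g = smult a f - g * q" using aq by simp
    also have "\<dots> = (smult a U' - q * U) * p + (smult a V' - q * V) * K"
      by (simp add: f UV smult_add_right algebra_simps)
    finally have "pseudo_mod f g = 0"
      using g(2)[of "pseudo_mod f g"] pseudo_mod(2)[OF g0, of f] unfolding J_def by fastforce
    then show ?thesis using aq by auto
  qed
  obtain a q where aq: "a \<noteq> 0" "smult a p = g * q" using divides[OF p] by blast
  obtain a' q' where aq': "a' \<noteq> 0" "smult a' K = g * q'" using divides[OF K] by blast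
  have "degree g = 0"
  proof (rule ccontr)
    assume dg: "degree g \<noteq> 0"
    have "p dvd g * q" using aq(2) by (metis dvd_smult dvd_refl)
    then have "p dvd g \<or> p dvd q" using assms(1) prime_elem_dvd_mult_iff by blast
    moreover have "\<not> p dvd q"
    proof
      assume "p dvd q"
      then obtain r where "q = p * r" by blast
      then have "p * [:a:] = p * (g * r)" using aq(2) by (simp add: algebra_simps)
      then have "[:a:] = g * r" using \<open>p \<noteq> 0\<close> by (simp only: mult_cancel_left simp_thms)
      moreover from this have "r \<noteq> 0" using aq(1) by auto
      ultimately have "degree [:a:] = degree g + degree r" using g0 by (metis degree_mult_eq)
      then show False using dg by simp
    qed
    ultimately have "p dvd smult a' K" unfolding aq'(2) by simp
    then have "p dvd [:a':] * K" by simp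
    then have "p dvd [:a':]" using assms by (metis prime_elem_dvd_mult_iff)
    then have "degree p \<le> degree [:a':]" using aq'(1) by (intro dvd_imp_degree_le) auto
    then show False using False by simp
  qed
  then obtain c where "g = [:c:]" by (rule degree_eq_zeroE)
  then show ?thesis using g0 UV by (intro exI[of _ c] exI[of _ U] exI[of _ V]) simp
qed

text \<open>The constant \<open>c\<close> from Bezout is a non-zero polynomial in \<open>s\<close>
  alone that vanishes at every common zero.\<close>

lemma finite_common_zeros:
  fixes p K :: "'a::idom poly poly"
  assumes "prime_elem p" "\<not> p dvd K"
  shows "finite {s. \<exists>t. eval2 p s t = 0 \<and> eval2 K s t = 0}"
proof -
  obtain c U V where c: "c \<noteq> 0" "[:c:] = U * p + V * K"
    using bezout_over_coefficients[OF assms] by blast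
  have "poly c s = 0" if "eval2 p s t = 0" "eval2 K s t = 0" for s t
    using arg_cong[OF c(2), of "\<lambda>G. eval2 G s t"] that by simp
  then have "{s. \<exists>t. eval2 p s t = 0 \<and> eval2 K s t = 0} \<subseteq> {s. poly c s = 0}" by blast
  then show ?thesis using c(1) poly_roots_finite finite_subset by blast
qed

lemma ex_prime_factor_zero:
  fixes G :: "real poly poly"
  assumes "G \<noteq> 0" "eval2 G s t = 0"
  shows "\<exists>p. prime p \<and> p dvd G \<and> eval2 p s t = 0"
  using assms
proof (induction G rule: prime_divisors_induct)
  case zero
  then show ?case by simp
next
  case (unit G)
  then obtain H where "1 = G * H" by blast
  from arg_cong[OF this, of "\<lambda>G. eval2 G s t"] unit show ?case by simp
next
  case (factor p G)
  then show ?case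
    by (metis (no_types, lifting) dvd_mult dvd_triv_left eval2_simps(3) mult_eq_0_iff)
qed

text \<open>An algebraic Sard theorem. A multiple zero of \<open>G s\<close> at \<open>t\<close> comes either from a square
  factor of \<open>G\<close>, at which all partial derivatives vanish, or from a common zero of coprime
  polynomials, which happens for finitely many \<open>s\<close> only.\<close>

lemma finite_noncritical_multiple_zeros:
  fixes G :: "real poly poly"
  assumes "G \<noteq> 0"
  shows "finite {s. \<exists>t. eval2 G s t = 0 \<and> eval2 (pderiv G) s t = 0
    \<and> poly (pderiv (poly G [:t:])) s \<noteq> 0}" (is "finite ?S")
proof (rule finite_subset)
  let ?Z = "\<lambda>p K. {s. \<exists>t. eval2 p s t = 0 \<and> eval2 K s t = (0::real)}"
  \<comment> \<open>Exceptional values of \<open>s\<close> due to one prime factor \<open>p\<close>: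
    zeros of \<open>p\<close> if it does not involve \<open>t\<close>, none if \<open>p\<close> is a
    repeated factor, otherwise common zeros with the cofactor or with
    \<open>pderiv p\<close>.\<close>
  define B where "B p = (if degree p = 0 then {s. \<exists>t. eval2 p s t = 0}
      else if p * p dvd G then {} else ?Z p (G div p) \<union> ?Z p (pderiv p))" for p
  let ?D = "{p. prime p \<and> p dvd G}"
  show "?S \<subseteq> (\<Union>p\<in>?D. B p)"
  proof
    fix s assume "s \<in> ?S"
    then obtain t where t: "eval2 G s t = 0" "eval2 (pderiv G) s t = 0"
      "poly (pderiv (poly G [:t:])) s \<noteq> 0" by blast
    obtain p where p: "prime p" "p dvd G" "eval2 p s t = 0"
      using ex_prime_factor_zero[OF assms t(1)] by blast
    have np: "\<not> p * p dvd G"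
    proof
      assume "p * p dvd G"
      then obtain K where K: "G = p * p * K" by blast
      have "poly (pderiv (poly G [:t:])) s = 0"
        using p(3) unfolding K by (simp add: pderiv_mult eval2_def)
      then show False using t(3) by simp
    qed
    have G: "G = p * (G div p)" using p(2) by simp
    \<comment> \<open>At a zero of \<open>p\<close> the product rule leaves one product, so the
      cofactor or \<open>pderiv p\<close> vanishes as well.\<close>
    have "eval2 (pderiv G) s t = eval2 (G div p) s t * eval2 (pderiv p) s t"
      using p(3) by (subst G) (simp add: pderiv_mult del: dvd_mult_div_cancel)
    then have "s \<in> B p" using t(2) p(3) np by (auto simp: B_def)
    then show "s \<in> (\<Union>p\<in>?D. B p)" using p by blast
  qed
  show "finite (\<Union>p\<in>?D. B p)"
  proof (rule finite_UN_I)
    show "finite ?D" using assms by (rule finite_prime_divisors)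
    fix p assume "p \<in> ?D"
    then have p: "prime_elem p" "p dvd G" and p0: "p \<noteq> 0" by auto
    show "finite (B p)"
    proof (cases "degree p = 0")
      case True
      then obtain c where c: "p = [:c:]" by (rule degree_eq_zeroE)
      then show ?thesis using p0 poly_roots_finite[of c] by (simp add: B_def)
    next
      case False
      show ?thesis
      proof (cases "p * p dvd G")
        case True
        then show ?thesis using False by (simp add: B_def)
      next
        case np: False
        have "\<not> p dvd G div p" using np p(2) p0 by (metis dvd_div_iff_mult mult.commute)
        moreover have "\<not> p dvd pderiv p"
        proof
          assume "p dvd pderiv p"
          moreover have "pderiv p \<noteq> 0" using False by (simp add: pderiv_eq_0_iff)
          ultimately have "degree p \<le> degree (pderiv p)" by (rule dvd_imp_degree_le)
          then show False using False by (simp add: degree_pderiv)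
        qed
        ultimately show ?thesis using False np finite_common_zeros[OF p(1)] by (simp add: B_def)
      qed
    qed
  qed
qed

text \<open>The polynomial is \<open>(l - c) ^ 2 - \<Delta>\<close> in the outer variable
  \<open>l\<close>. A factorization would make \<open>\<Delta>\<close> a square, but
  \<open>\<Delta>\<close> is positive on the reals and has degree 2, whereas a linear square root
  would have a real zero.\<close>

lemma prime_conic:
  fixes b c\<^sub>x c\<^sub>y u v :: real
  assumes "b \<noteq> 0"
  shows "prime_elem [: [:c\<^sub>x, c\<^sub>y:]\<^sup>2 - ([:u, v:]\<^sup>2 + [:b\<^sup>2, 0, b\<^sup>2:]), - (2 * [:c\<^sub>x, c\<^sub>y:]), 1 :]"
    (is "prime_elem ?D")
proof (rule irreducible_imp_prime_elem, rule irreducibleI)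
  let ?c = "[:c\<^sub>x, c\<^sub>y:]" and ?\<Delta> = "[:u, v:]\<^sup>2 + [:b\<^sup>2, 0, b\<^sup>2:]"
  have pos: "0 < poly ?\<Delta> t" for t
  proof -
    have "poly ?\<Delta> t = (u + t * v)\<^sup>2 + (b\<^sup>2 + (t * b)\<^sup>2)"
      by (simp add: power2_eq_square algebra_simps)
    moreover have "0 < b\<^sup>2" using assms by simp
    ultimately show ?thesis by (smt (verit) zero_le_power2)
  qed
  have "?\<Delta> = [:u\<^sup>2 + b\<^sup>2, 2 * u * v, v\<^sup>2 + b\<^sup>2:]"
    by (simp add: power2_eq_square algebra_simps)
  moreover have "v\<^sup>2 + b\<^sup>2 \<noteq> 0" using assms by (simp add: sum_power2_eq_zero_iff)
  ultimately have deg: "degree ?\<Delta> = 2" by simp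
  have no_root: "y\<^sup>2 \<noteq> ?\<Delta>" for y
  proof
    assume y: "y\<^sup>2 = ?\<Delta>"
    have "y \<noteq> 0" using pos[of 0] y by (metis order_less_irrefl poly_0 zero_power2)
    then have "degree (y\<^sup>2) = 2 * degree y" by (simp add: power2_eq_square degree_mult_eq)
    then have "degree y = 1" using deg y by simp
    then obtain y0 y1 where "y = [:y0, y1:]" "y1 \<noteq> 0"
      by (metis degree1_coeffs)
    then have "poly (y\<^sup>2) (- y0 / y1) = 0" by (simp add: power2_eq_square)
    then show False using pos[of "- y0 / y1"] y by simp
  qed
  show "?D \<noteq> 0" by simp
  have dD: "degree ?D = 2" by simp
  show "\<not> ?D dvd 1"
  proof
    assume "?D dvd 1"
    then have "degree ?D \<le> degree (1 :: real poly poly)" by (intro dvd_imp_degree_le) auto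
    then show False using dD by simp
  qed
  fix F G assume FG: "?D = F * G"
  then have ne: "F \<noteq> 0" "G \<noteq> 0" by auto
  have "degree F + degree G = 2" using dD ne unfolding FG by (simp add: degree_mult_eq)
  moreover have "lead_coeff F * lead_coeff G = 1"
    using arg_cong[OF FG, of lead_coeff] unfolding lead_coeff_mult by simp
  then have lu: "lead_coeff F dvd 1" "lead_coeff G dvd 1" by (metis dvd_triv_left, metis dvd_triv_right)
  have unit: "H dvd 1" if "degree H = 0" "lead_coeff H dvd 1" for H :: "real poly poly"
    using that by (metis degree_eq_zeroE is_unit_const_poly_iff lead_coeff_pCons(2) degree_pCons_0 coeff_pCons_0)
  ultimately consider "degree F = 0" | "degree G = 0" | "degree F = 1" by linarith
  then show "F dvd 1 \<or> G dvd 1"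
  proof cases
    case 3
    then obtain a0 a1 where F: "F = [:a0, a1:]" "a1 \<noteq> 0"
      by (metis degree1_coeffs)
    then have "a1 dvd 1" using lu by simp
    then obtain k where k: "1 = a1 * k" by blast
    \<comment> \<open>The leading coefficient of the linear factor is a unit with inverse
      \<open>k\<close>, so the factor has a root in the coefficient ring.\<close>
    let ?r = "- (a0 * k)"
    have "poly F ?r = a0 * (1 - a1 * k)" unfolding F by (simp add: algebra_simps)
    then have "poly F ?r = 0" using k by simp
    then have "poly ?D ?r = 0" unfolding FG by simp
    moreover have "poly [: c\<^sup>2 - d, - (2 * c), 1 :] r = (r - c)\<^sup>2 - d" for c d r :: "real poly"
      by (simp add: power2_eq_square algebra_simps)
    ultimately have "(?r - ?c)\<^sup>2 = ?\<Delta>" by (metis eq_iff_diff_eq_0)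
    then show ?thesis using no_root by blast
  qed (use unit lu in auto)
qed

section \<open>Ellipses contained in the curve\<close>

text \<open>With \<open>t = - tan \<theta>\<close> the line \<open>{z. Re (cis \<theta> * z) = \<lambda>}\<close> becomes
  \<open>Re z + t * Im z = l\<close> with \<open>\<lambda> = l * cos \<theta>\<close>. The family is then the zero set of the following
  polynomial in \<open>l\<close> (outer) and \<open>t\<close> (inner variable).\<close>

definition line_poly :: "(nat \<Rightarrow> real) \<Rightarrow> nat \<Rightarrow> real poly poly" where
  "line_poly x n = ctn_poly (\<lambda>k. [:1 + x k, 0, x k:]) n"

definition point_poly :: "(nat \<Rightarrow> real) \<Rightarrow> nat \<Rightarrow> complex \<Rightarrow> real poly" where
  "point_poly x n z = ctn (\<lambda>k. [:1 + x k, 0, x k:]) [:Re z, Im z:] n"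

lemma eval2_line_poly: "eval2 (line_poly x n) t l = ctn (\<lambda>k. 1 + x k * (1 + t\<^sup>2)) l n"
proof -
  have "poly (ctn (\<lambda>k. [:1 + x k, 0, x k:]) [:l:] n) t
      = ctn (\<lambda>k. poly [:1 + x k, 0, x k:] t) (poly [:l:] t) n"
    by (rule poly_hom.hom_ctn)
  then show ?thesis
    by (simp add: eval2_def line_poly_def algebra_simps power2_eq_square)
qed

lemma poly_point_poly:
  "poly (point_poly x n z) t = ctn (\<lambda>k. 1 + x k * (1 + t\<^sup>2)) (Re z + t * Im z) n"
  unfolding point_poly_def poly_hom.hom_ctn by (simp add: algebra_simps power2_eq_square)

lemma ctn_cos_eq:
  assumes "cos \<theta> \<noteq> 0"
  shows "ctn (\<lambda>k. x k + (cos \<theta>)\<^sup>2) (Re (cis \<theta> * z)) n = cos \<theta> ^ n * poly (point_poly x n z) (- tan \<theta>)"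
proof -
  have "(cos \<theta>)\<^sup>2 * (1 + (- tan \<theta>)\<^sup>2) = 1"
    using tan_sec[OF assms] assms by (simp flip: power_mult_distrib)
  then have "(cos \<theta>)\<^sup>2 * (1 + x k * (1 + (- tan \<theta>)\<^sup>2)) = x k + (cos \<theta>)\<^sup>2" for k
    by (metis (no_types, opaque_lifting) add.commute distrib_left mult.left_commute mult.right_neutral)
  moreover have "cos \<theta> * (Re z + (- tan \<theta>) * Im z) = Re (cis \<theta> * z)"
    using assms by (simp add: tan_def algebra_simps)
  ultimately show ?thesis
    unfolding poly_point_poly
    using ctn_scale[of "cos \<theta>" "\<lambda>k. 1 + x k * (1 + (- tan \<theta>)\<^sup>2)" "Re z + (- tan \<theta>) * Im z" n]
    by simp
qed

text \<open>Here \<open>D\<close> is chosen before \<open>f\<close>: the derivative depends only on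
  the value and the slope of \<open>f\<close> at \<open>\<theta>\<close>. This replaces partial
  derivatives when two functions that agree to first order are compared.\<close>

lemma ctn_has_derivative:
  fixes x :: "nat \<Rightarrow> real"
  shows "\<exists>D. \<forall>f. f \<theta> = a \<longrightarrow> (f has_real_derivative d) (at \<theta>) \<longrightarrow>
    ((\<lambda>t. ctn (\<lambda>k. x k + (cos t)\<^sup>2) (f t) n) has_real_derivative D) (at \<theta>)"
proof (induction n rule: less_induct)
  case (less n)
  consider "n = 0" | "n = 1" | k where "n = Suc (Suc k)"
    by (metis One_nat_def not0_implies_Suc)
  then show ?case
  proof cases
    case 1
    then show ?thesis by (intro exI[of _ 0]) simp
  next
    case 2
    then show ?thesis by (intro exI[of _ d]) simp
  next
    case (3 k)
    let ?q = "\<lambda>f k t. ctn (\<lambda>k. x k + (cos t)\<^sup>2) (f t) k"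
    have lt: "Suc k < n" "k < n" using 3 by simp_all
    obtain D1 where "\<forall>f. f \<theta> = a \<longrightarrow> (f has_real_derivative d) (at \<theta>) \<longrightarrow>
        (?q f (Suc k) has_real_derivative D1) (at \<theta>)" using less[OF lt(1)] by (rule exE)
    note D1 = this[rule_format]
    obtain D0 where "\<forall>f. f \<theta> = a \<longrightarrow> (f has_real_derivative d) (at \<theta>) \<longrightarrow>
        (?q f k has_real_derivative D0) (at \<theta>)" using less[OF lt(2)] by (rule exE)
    note D0 = this[rule_format]
    let ?c = "\<lambda>k. ctn (\<lambda>k. x k + (cos \<theta>)\<^sup>2) a k"
    show ?thesis
    proof (intro exI allI impI)
      fix f assume f: "f \<theta> = a" "(f has_real_derivative d) (at \<theta>)"
      show "(?q f n has_real_derivative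
          (d * ?c (Suc k) + D1 * a - (- (2 * cos \<theta> * sin \<theta>) * ?c k + D0 * (x (Suc k) + (cos \<theta>)\<^sup>2)))) (at \<theta>)"
        unfolding 3 ctn.simps
        by (rule derivative_eq_intros f(2) D1[OF f] D0[OF f] refl | simp add: f(1))+
    qed
  qed
qed

lemma kippenhahn_root_iff:
  assumes "A \<in> reciprocal_mats n"
  shows "kippenhahn_poly A (complex_of_real l) \<theta> = 0 \<longleftrightarrow>
    ctn (\<lambda>k. xi A k + (cos \<theta>)\<^sup>2) l n = 0"
proof -
  have "ctn (\<lambda>k. complex_of_real (xi A k + (cos \<theta>)\<^sup>2)) (complex_of_real l) n
      = complex_of_real (ctn (\<lambda>k. xi A k + (cos \<theta>)\<^sup>2) l n)"
    by (simp only: of_real_hom.hom_ctn)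
  then show ?thesis unfolding kippenhahn_poly_eq_ctn[OF assms] by simp
qed

text \<open>Along the branch \<open>lam\<close> the continuant is 0 near \<open>\<theta>\<close>. As
  \<open>lam\<close> and \<open>Re (cis t * z)\<close> agree to first order there, the restriction
  to the pencil through \<open>z\<close> has zero value and zero derivative. The first alternative
  is the direction \<open>cos \<theta> = 0\<close>, which the chart
  \<open>t = - tan \<theta>\<close> misses.\<close>

lemma kippenhahn_curve_double_root:
  assumes A: "A \<in> reciprocal_mats n" and z: "z \<in> kippenhahn_curve A"
  shows "ctn (xi A) (Im z) n = 0 \<or>
    (\<exists>t. poly (point_poly (xi A) n z) t = 0 \<and> poly (pderiv (point_poly (xi A) n z)) t = 0)"
proof -
  let ?x = "xi A" and ?g = "point_poly (xi A) n z"
  let ?q = "\<lambda>f t. ctn (\<lambda>k. ?x k + (cos t)\<^sup>2) (f t) n"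
  obtain \<theta> lam where ev: "\<forall>\<^sub>F t in nhds \<theta>. ?q lam t = 0"
    and lam: "Re (cis \<theta> * z) = lam \<theta>"
    and deriv: "((\<lambda>t. Re (cis t * z) - lam t) has_real_derivative 0) (at \<theta>)"
    using z unfolding kippenhahn_curve_def kippenhahn_root_iff[OF A] by blast
  let ?h = "\<lambda>t. Re (cis t * z)"
  have root: "?q lam \<theta> = 0" using ev by (rule eventually_nhds_x_imp_x)
  show ?thesis
  proof (cases "cos \<theta> = 0")
    case True
    then have "sin \<theta> = 1 \<or> sin \<theta> = -1"
      using sin_cos_squared_add[of \<theta>] by (simp add: power2_eq_1_iff)
    then have "lam \<theta> = Im z \<or> lam \<theta> = - Im z" using lam True by auto
    then show ?thesis using root True ctn_minus[of ?x "Im z" n] by auto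
  next
    case False
    define d where "d = - sin \<theta> * Re z - cos \<theta> * Im z"
    have h': "(?h has_real_derivative d) (at \<theta>)"
      unfolding d_def by (auto intro!: derivative_eq_intros)
    have "((\<lambda>t. ?h t - (?h t - lam t)) has_real_derivative d - 0) (at \<theta>)"
      by (rule DERIV_diff[OF h' deriv])
    then have lam': "(lam has_real_derivative d) (at \<theta>)" by simp
    obtain D where D: "\<And>f. f \<theta> = lam \<theta> \<Longrightarrow> (f has_real_derivative d) (at \<theta>) \<Longrightarrow>
        (?q f has_real_derivative D) (at \<theta>)"
      using ctn_has_derivative[of \<theta> "lam \<theta>" d ?x n] by blast
    have "((\<lambda>t. 0) has_real_derivative D) (at \<theta>)"
      using D[OF refl lam'] ev DERIV_cong_ev[OF refl _ refl, of "?q lam" "\<lambda>t. 0"] by blast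
    then have "D = 0" using DERIV_const DERIV_unique by blast
    then have qh: "(?q ?h has_real_derivative 0) (at \<theta>)" using D[OF lam h'] by simp
    have "\<forall>\<^sub>F t in nhds \<theta>. cos t \<noteq> 0"
    proof (rule eventually_nhds_in_open[THEN eventually_mono])
      show "open (cos -` (- {0::real}))" by (intro open_vimage) (auto intro: continuous_intros)
    qed (use False in auto)
    then have "\<forall>\<^sub>F t in nhds \<theta>. ?q ?h t = cos t ^ n * poly ?g (- tan t)"
      by (rule eventually_mono) (rule ctn_cos_eq)
    then have gd: "((\<lambda>t. cos t ^ n * poly ?g (- tan t)) has_real_derivative 0) (at \<theta>)"
      using qh by (subst (asm) DERIV_cong_ev[OF refl _ refl])
    have g0: "poly ?g (- tan \<theta>) = 0"
      using root ctn_cos_eq[OF False, of ?x z n] lam False by simp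
    have tan': "((\<lambda>t. - tan t) has_real_derivative - inverse ((cos \<theta>)\<^sup>2)) (at \<theta>)"
      using DERIV_minus[OF DERIV_tan[OF False]] .
    have g': "((\<lambda>t. poly ?g (- tan t)) has_real_derivative
        poly (pderiv ?g) (- tan \<theta>) * - inverse ((cos \<theta>)\<^sup>2)) (at \<theta>)"
      using DERIV_chain[OF poly_DERIV tan'] by (simp add: o_def)
    have c': "((\<lambda>t. cos t ^ n) has_real_derivative real n * (cos \<theta> ^ (n - Suc 0) * - sin \<theta>)) (at \<theta>)"
      by (rule DERIV_cong[OF DERIV_power[OF DERIV_cos]]) simp
    have "((\<lambda>t. cos t ^ n * poly ?g (- tan t)) has_real_derivative
        cos \<theta> ^ n * (poly (pderiv ?g) (- tan \<theta>) * - inverse ((cos \<theta>)\<^sup>2))) (at \<theta>)"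
      by (rule DERIV_cong[OF DERIV_mult[OF c' g']]) (simp add: g0)
    then have "cos \<theta> ^ n * (poly (pderiv ?g) (- tan \<theta>) * - inverse ((cos \<theta>)\<^sup>2)) = 0"
      using gd DERIV_unique by blast
    then have "poly (pderiv ?g) (- tan \<theta>) = 0" using False by simp
    then show ?thesis using g0 by blast
  qed
qed

text \<open>Dual of the ellipse with foci \<open>f\<close>, \<open>g\<close> and distance sum
  \<open>s\<close>: \<open>c\<close> is the centre, \<open>d\<close> the half focal vector,
  \<open>b\<close> the minor half-axis. The line \<open>Re z + t * Im z = l\<close> is tangent iff
  \<open>(l - Re c - t * Im c) ^ 2 = (Re d + t * Im d) ^ 2 + b ^ 2 * (1 + t ^ 2)\<close>.\<close>

definition conic_poly :: "complex \<Rightarrow> complex \<Rightarrow> real \<Rightarrow> real poly poly" where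
  "conic_poly f g s = (let c = (f + g) / 2; d = (f - g) / 2; b = sqrt (s\<^sup>2 - (dist f g)\<^sup>2) / 2 in
    [: [:Re c, Im c:]\<^sup>2 - ([:Re d, Im d:]\<^sup>2 + [:b\<^sup>2, 0, b\<^sup>2:]), - (2 * [:Re c, Im c:]), 1 :])"

lemma ellipse_conic_dvd:
  assumes A: "A \<in> reciprocal_mats n" and fg: "dist f g < s"
    and E: "{z. dist z f + dist z g = s} \<subseteq> kippenhahn_curve A"
  shows "conic_poly f g s dvd line_poly (xi A) n"
proof -
  define x where "x = xi A"
  have x0: "0 \<le> x k" for k by (simp add: x_def xi_nonneg)
  define c where "c = (f + g) / 2"
  define a X b where "a = s / 2" and "X = cmod ((f - g) / 2)"
    and "b = sqrt (s\<^sup>2 - (dist f g)\<^sup>2) / 2"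
  define \<alpha> where "\<alpha> = Arg ((f - g) / 2)"
  have X_dist: "X = dist f g / 2" by (simp add: X_def dist_norm norm_divide)
  have polar: "(f - g) / 2 = complex_of_real X * cis \<alpha>"
    using rcis_cmod_Arg[of "(f - g) / 2"] by (simp add: X_def \<alpha>_def rcis_def)
  have X0: "0 \<le> X" and Xa: "X < a" using fg unfolding X_dist a_def by simp_all
  have "(dist f g)\<^sup>2 < s\<^sup>2" using fg by (simp add: power_strict_mono)
  then have b0: "0 < b" and b2: "b\<^sup>2 = a\<^sup>2 - X\<^sup>2"
    by (simp_all add: b_def a_def X_dist power_divide field_simps)
  define u v where "u = X * cos \<alpha>" and "v = X * sin \<alpha>"
  have uv: "Re ((f - g) / 2) = u" "Im ((f - g) / 2) = v" unfolding polar u_def v_def by simp_all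
  have D: "conic_poly f g s = [: [:Re c, Im c:]\<^sup>2 - ([:u, v:]\<^sup>2 + [:b\<^sup>2, 0, b\<^sup>2:]), - (2 * [:Re c, Im c:]), 1 :]"
    unfolding conic_poly_def Let_def c_def[symmetric] uv b_def[symmetric] ..

  let ?S = "\<lambda>\<sigma>::real. 1 + \<sigma>\<^sup>2"
  define S :: "real poly" where "S = [:1, 0, 1:]"
  \<comment> \<open>Numerators of the point
    \<open>c + cis \<alpha> * Complex (a * cos \<phi>) (b * sin \<phi>)\<close> in terms of
    \<open>\<sigma> = tan (\<phi> / 2)\<close>; the common denominator is \<open>S\<close>.\<close>
  define Xn where "Xn = [:Re c + a * cos \<alpha>, - (2 * b * sin \<alpha>), Re c - a * cos \<alpha>:]"
  define Yn where "Yn = [:Im c + a * sin \<alpha>, 2 * b * cos \<alpha>, Im c - a * sin \<alpha>:]"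
  have S: "poly S \<sigma> = 1 + \<sigma>\<^sup>2" for \<sigma> by (simp add: S_def power2_eq_square)
  have Spos: "0 < 1 + \<sigma>\<^sup>2" for \<sigma> :: real by (simp add: add_pos_nonneg)
  define z where "z \<sigma> = Complex (poly Xn \<sigma> / (1 + \<sigma>\<^sup>2)) (poly Yn \<sigma> / (1 + \<sigma>\<^sup>2))" for \<sigma>

  have zE: "z \<sigma> \<in> {z. dist z f + dist z g = s}" for \<sigma>
  proof -
    define C T where "C = (1 - \<sigma>\<^sup>2) / (1 + \<sigma>\<^sup>2)" and "T = 2 * \<sigma> / (1 + \<sigma>\<^sup>2)"
    have CT: "C\<^sup>2 + T\<^sup>2 = 1"
    proof -
      have "(1 - \<sigma>\<^sup>2)\<^sup>2 + (2 * \<sigma>)\<^sup>2 = (1 + \<sigma>\<^sup>2)\<^sup>2" by (simp add: power2_eq_square algebra_simps)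
      then show ?thesis
        using Spos[of \<sigma>] by (simp add: C_def T_def power_divide flip: add_divide_distrib)
    qed
    have C1: "\<bar>C\<bar> \<le> 1" using CT by (metis abs_square_le_1 le_add_same_cancel1 zero_le_power2)
    have lin: "(k * q + e * y - h * w) / q = k + e * (y / q) - h * (w / q)"
      "(k * q + e * y + h * w) / q = k + e * (y / q) + h * (w / q)" if "q \<noteq> 0" for k q e y h w :: real
      using that by (simp_all add: add_divide_distrib diff_divide_distrib)
    have "poly Xn \<sigma> = Re c * (1 + \<sigma>\<^sup>2) + a * cos \<alpha> * (1 - \<sigma>\<^sup>2) - b * sin \<alpha> * (2 * \<sigma>)"
      "poly Yn \<sigma> = Im c * (1 + \<sigma>\<^sup>2) + a * sin \<alpha> * (1 - \<sigma>\<^sup>2) + b * cos \<alpha> * (2 * \<sigma>)"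
      by (simp_all add: Xn_def Yn_def algebra_simps power2_eq_square)
    then have "poly Xn \<sigma> / (1 + \<sigma>\<^sup>2) = Re c + a * cos \<alpha> * C - b * sin \<alpha> * T"
      "poly Yn \<sigma> / (1 + \<sigma>\<^sup>2) = Im c + a * sin \<alpha> * C + b * cos \<alpha> * T"
      using Spos[of \<sigma>] lin[of "1 + \<sigma>\<^sup>2"] unfolding C_def T_def by simp_all
    then have zr: "z \<sigma> = c + cis \<alpha> * Complex (a * C) (b * T)"
      by (simp add: z_def complex_eq_iff algebra_simps)
    have foci: "f = c + cis \<alpha> * complex_of_real X" "g = c - cis \<alpha> * complex_of_real X"
      using polar unfolding c_def by (simp_all add: field_simps)
    \<comment> \<open>Used with \<open>Y = X\<close> and \<open>Y = - X\<close>, this yields the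
      distances \<open>a - X * C\<close> and \<open>a + X * C\<close> to the foci.\<close>
    have d: "dist (z \<sigma>) (c + cis \<alpha> * complex_of_real Y) = a - Y * C" if "Y\<^sup>2 = X\<^sup>2" for Y
    proof -
      have Y: "\<bar>Y\<bar> = X" using that X0 by (auto simp: power2_eq_iff)
      have "\<bar>Y * C\<bar> \<le> X * 1" unfolding abs_mult Y using C1 X0 by (rule mult_left_mono)
      then have "\<bar>Y * C\<bar> < a" using Xa by simp
      then have pos: "0 \<le> a - Y * C" by linarith
      have "z \<sigma> - (c + cis \<alpha> * complex_of_real Y) = cis \<alpha> * Complex (a * C - Y) (b * T)"
        unfolding zr by (simp add: complex_eq_iff algebra_simps)
      then have "dist (z \<sigma>) (c + cis \<alpha> * complex_of_real Y) = cmod (Complex (a * C - Y) (b * T))"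
        by (simp add: dist_norm norm_mult)
      also have "\<dots> = sqrt ((a * C - Y)\<^sup>2 + (b * T)\<^sup>2)" by (simp add: complex_norm)
      also have "(a * C - Y)\<^sup>2 + (b * T)\<^sup>2 = (a - Y * C)\<^sup>2"
      proof -
        have "b\<^sup>2 = a\<^sup>2 - Y\<^sup>2" "T\<^sup>2 = 1 - C\<^sup>2" using CT b2 that by simp_all
        then have "(b * T)\<^sup>2 = (a\<^sup>2 - Y\<^sup>2) * (1 - C\<^sup>2)" by (simp only: power_mult_distrib)
        then show ?thesis by (simp add: power2_eq_square algebra_simps)
      qed
      finally show ?thesis using pos by simp
    qed
    show ?thesis using d[of X] d[of "- X"] foci by (simp add: a_def)
  qed

  \<comment> \<open>\<open>point_poly\<close> along the ellipse with denominators cleared: by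
    \<open>ctn_scale\<close>, \<open>S\<close> in the second argument goes with \<open>S ^ 2\<close>
    in the first.\<close>
  define G where "G = ctn (\<lambda>k. [:smult (1 + x k) (S\<^sup>2), 0, smult (x k) (S\<^sup>2):]) [:Xn, Yn:] n"
  have G: "eval2 G \<sigma> t = (1 + \<sigma>\<^sup>2) ^ n * ctn (\<lambda>k. 1 + x k * (1 + t\<^sup>2)) ((poly Xn \<sigma> + t * poly Yn \<sigma>) / (1 + \<sigma>\<^sup>2)) n"
    for \<sigma> t
  proof -
    have "eval2 G \<sigma> t = ctn (\<lambda>k. (1 + \<sigma>\<^sup>2)\<^sup>2 * (1 + x k * (1 + t\<^sup>2))) (poly Xn \<sigma> + t * poly Yn \<sigma>) n"
      unfolding eval2_def G_def poly_hom.hom_ctn by (simp add: S algebra_simps power2_eq_square)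
    also have "poly Xn \<sigma> + t * poly Yn \<sigma> = (1 + \<sigma>\<^sup>2) * ((poly Xn \<sigma> + t * poly Yn \<sigma>) / (1 + \<sigma>\<^sup>2))"
      using Spos[of \<sigma>] by simp
    finally show ?thesis by (simp only: ctn_scale)
  qed
  have Gz: "eval2 G \<sigma> t = (1 + \<sigma>\<^sup>2) ^ n * poly (point_poly x n (z \<sigma>)) t" for \<sigma> t
    unfolding G poly_point_poly by (simp add: z_def add_divide_distrib)
  \<comment> \<open>Values of the functional \<open>Re z + t * Im z\<close> at the centre and on the
    two half-axis vectors. The tangents with parameter \<open>t\<close> are at offset
    \<open>l - m t\<close> with square \<open>(AA t) ^ 2 + (BB t) ^ 2\<close>.\<close>
  define m AA BB where "m t = Re c + t * Im c" and "AA t = a * (cos \<alpha> + t * sin \<alpha>)"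
    and "BB t = b * (t * cos \<alpha> - sin \<alpha>)" for t
  have XY: "poly Xn \<sigma> + t * poly Yn \<sigma> = m t * (1 + \<sigma>\<^sup>2) + AA t * (1 - \<sigma>\<^sup>2) + BB t * (2 * \<sigma>)" for \<sigma> t
    by (simp add: Xn_def Yn_def m_def AA_def BB_def algebra_simps power2_eq_square)
  have trig: "(cos \<alpha> + t * sin \<alpha>)\<^sup>2 + (t * cos \<alpha> - sin \<alpha>)\<^sup>2 = 1 + t\<^sup>2" for t
  proof -
    have "(p + t * q)\<^sup>2 + (t * p - q)\<^sup>2 = (1 + t\<^sup>2) * (q\<^sup>2 + p\<^sup>2)" for p q :: real
      by (simp add: power2_eq_square algebra_simps)
    then show ?thesis by simp
  qed
  have AB: "(AA t)\<^sup>2 + (BB t)\<^sup>2 = (u + t * v)\<^sup>2 + b\<^sup>2 * (1 + t\<^sup>2)" for t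
  proof -
    have "a\<^sup>2 = X\<^sup>2 + b\<^sup>2" using b2 by simp
    then have "(AA t)\<^sup>2 + (BB t)\<^sup>2 = (X * (cos \<alpha> + t * sin \<alpha>))\<^sup>2
        + b\<^sup>2 * ((cos \<alpha> + t * sin \<alpha>)\<^sup>2 + (t * cos \<alpha> - sin \<alpha>)\<^sup>2)"
      unfolding AA_def BB_def power_mult_distrib by (simp add: algebra_simps)
    then show ?thesis unfolding trig by (simp add: u_def v_def algebra_simps)
  qed
  have AB0: "AA t \<noteq> 0 \<or> BB t \<noteq> 0" for t
  proof -
    have "0 < b\<^sup>2 * (1 + t\<^sup>2)" using b0 Spos by simp
    then have "0 < (AA t)\<^sup>2 + (BB t)\<^sup>2" unfolding AB by (smt (verit) zero_le_power2)
    then show ?thesis by auto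
  qed
  have fin_level: "finite {\<sigma>. (poly Xn \<sigma> + t * poly Yn \<sigma>) / (1 + \<sigma>\<^sup>2) = l}" for t l
  proof -
    let ?p = "[:m t + AA t - l, 2 * BB t, m t - AA t - l:]"
    have "?p \<noteq> 0" using AB0[of t] by auto
    moreover have "{\<sigma>. (poly Xn \<sigma> + t * poly Yn \<sigma>) / (1 + \<sigma>\<^sup>2) = l} \<subseteq> {\<sigma>. poly ?p \<sigma> = 0}"
    proof safe
      fix \<sigma> assume "l = (poly Xn \<sigma> + t * poly Yn \<sigma>) / (1 + \<sigma>\<^sup>2)"
      show "poly [:m t + AA t - (poly Xn \<sigma> + t * poly Yn \<sigma>) / (1 + \<sigma>\<^sup>2), 2 * BB t,
          m t - AA t - (poly Xn \<sigma> + t * poly Yn \<sigma>) / (1 + \<sigma>\<^sup>2):] \<sigma> = 0"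
        unfolding XY using Spos[of \<sigma>] by (simp add: field_simps power2_eq_square)
    qed
    ultimately show ?thesis using poly_roots_finite finite_subset by blast
  qed
  \<comment> \<open>At \<open>t = 0\<close> a vanishing \<open>G\<close> would confine a rational
    function with finite fibres to the finitely many zeros of one polynomial.\<close>
  have G0: "G \<noteq> 0"
  proof
    assume "G = 0"
    let ?q = "ctn_poly (\<lambda>k. 1 + x k * (1 + 0\<^sup>2)) n :: real poly"
    have "poly ?q ((poly Xn \<sigma> + 0 * poly Yn \<sigma>) / (1 + \<sigma>\<^sup>2)) = 0" for \<sigma>
      using G[of \<sigma> 0] Spos[of \<sigma>] \<open>G = 0\<close> by simp
    then have "UNIV \<subseteq> (\<Union>l\<in>{l. poly ?q l = 0}. {\<sigma>. (poly Xn \<sigma> + 0 * poly Yn \<sigma>) / (1 + \<sigma>\<^sup>2) = l})"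
      by blast
    moreover have "finite (\<Union>l\<in>{l. poly ?q l = 0}. {\<sigma>. (poly Xn \<sigma> + 0 * poly Yn \<sigma>) / (1 + \<sigma>\<^sup>2) = l})"
      using fin_level[of 0] by (intro finite_UN_I poly_roots_finite) auto
    ultimately show False using infinite_UNIV_char_0 finite_subset by blast
  qed
  have fin_horizontal: "finite {\<sigma>. ctn x (Im (z \<sigma>)) n = 0}"
  proof -
    have fin: "finite {\<sigma>. poly Yn \<sigma> / (1 + \<sigma>\<^sup>2) = l}" for l
    proof -
      let ?p = "[:Im c + a * sin \<alpha> - l, 2 * b * cos \<alpha>, Im c - a * sin \<alpha> - l:]"
      have "a \<noteq> 0" using Xa X0 by simp
      then have "?p \<noteq> 0" using b0 sin_zero_abs_cos_one[of \<alpha>] by auto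
      moreover have "poly ?p \<sigma> = 0" if "poly Yn \<sigma> / (1 + \<sigma>\<^sup>2) = l" for \<sigma>
        unfolding that[symmetric] using Spos[of \<sigma>] by (simp add: Yn_def field_simps power2_eq_square)
      ultimately show ?thesis
        using poly_roots_finite finite_subset[of "{\<sigma>. poly Yn \<sigma> / (1 + \<sigma>\<^sup>2) = l}" "{\<sigma>. poly ?p \<sigma> = 0}"] by blast
    qed
    have "{\<sigma>. ctn x (Im (z \<sigma>)) n = 0} \<subseteq>
        (\<Union>l\<in>{l. poly (ctn_poly x n) l = 0}. {\<sigma>. poly Yn \<sigma> / (1 + \<sigma>\<^sup>2) = l})"
      by (auto simp: z_def)
    moreover have "finite \<dots>" using fin by (intro finite_UN_I poly_roots_finite) auto
    ultimately show ?thesis by (rule finite_subset)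
  qed
  \<comment> \<open>Parameters whose point may lie on the curve because of the direction missed by
    \<open>t\<close>, and the exceptional parameters of the Sard argument.\<close>
  define Bad where "Bad = {\<sigma>. ctn x (Im (z \<sigma>)) n = 0} \<union>
    {\<sigma>. \<exists>t. eval2 G \<sigma> t = 0 \<and> eval2 (pderiv G) \<sigma> t = 0 \<and> poly (pderiv (poly G [:t:])) \<sigma> \<noteq> 0}"
  have fin_Bad: "finite Bad"
    unfolding Bad_def using fin_horizontal finite_noncritical_multiple_zeros[OF G0] by simp

  have tangent: "\<exists>t l. eval2 (line_poly x n) t l = 0 \<and> eval2 (conic_poly f g s) t l = 0
      \<and> BB t * (1 - \<sigma>\<^sup>2) = AA t * (2 * \<sigma>)" if good: "\<sigma> \<notin> Bad" for \<sigma>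
  proof -
    let ?g = "point_poly x n (z \<sigma>)"
    obtain t where t: "poly ?g t = 0" "poly (pderiv ?g) t = 0"
      using kippenhahn_curve_double_root[OF A, of "z \<sigma>"] zE[of \<sigma>] E good
      unfolding Bad_def x_def by blast
    define l where "l = (poly Xn \<sigma> + t * poly Yn \<sigma>) / (1 + \<sigma>\<^sup>2)"
    define L where "L \<tau> = (poly Xn \<tau> + t * poly Yn \<tau>) / (1 + \<tau>\<^sup>2)" for \<tau>
    let ?q = "ctn_poly (\<lambda>k. 1 + x k * (1 + t\<^sup>2)) n"
    have e1: "eval2 G \<sigma> t = 0" using Gz t(1) by simp
    have "((\<lambda>t. (1 + \<sigma>\<^sup>2) ^ n * poly ?g t) has_field_derivative (1 + \<sigma>\<^sup>2) ^ n * poly (pderiv ?g) t) (at t)"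
      by (rule DERIV_cmult[OF poly_DERIV])
    then have "eval2 (pderiv G) \<sigma> t = (1 + \<sigma>\<^sup>2) ^ n * poly (pderiv ?g) t"
      using eval2_has_derivative_outer[of G \<sigma> t] unfolding Gz using DERIV_unique by blast
    then have e2: "eval2 (pderiv G) \<sigma> t = 0" using t(2) by simp
    \<comment> \<open>For a good parameter a multiple zero in \<open>t\<close> also has vanishing
      derivative in \<open>\<sigma>\<close>, that is, along the ellipse.\<close>
    have crit: "poly (pderiv (poly G [:t:])) \<sigma> = 0" using good e1 e2 unfolding Bad_def by blast
    have ql: "poly ?q l = 0" using e1 Spos[of \<sigma>] unfolding G l_def by simp
    have q': "poly (pderiv ?q) l \<noteq> 0"
    proof (rule ctn_simple_roots)
      show "0 < 1 + x k * (1 + t\<^sup>2)" for k using x0[of k] by (simp add: add_pos_nonneg)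
    qed (use ql in simp)
    \<comment> \<open>Derivative of the functional along the ellipse. The root \<open>l\<close> of
      \<open>?q\<close> is simple, so the vanishing derivative of \<open>G\<close> must come from
      this factor, which means tangency.\<close>
    let ?dL = "2 * (BB t * (1 - \<sigma>\<^sup>2) - AA t * (2 * \<sigma>)) / (1 + \<sigma>\<^sup>2)\<^sup>2"
    have L_eq: "L \<tau> = m t + (AA t * (1 - \<tau>\<^sup>2) + BB t * (2 * \<tau>)) / (1 + \<tau>\<^sup>2)" for \<tau>
      unfolding L_def XY using Spos[of \<tau>] by (simp add: field_simps)
    have L': "(L has_real_derivative ?dL) (at \<sigma>)"
      unfolding L_eq using Spos[of \<sigma>]
      by (auto intro!: derivative_eq_intros simp: field_simps power2_eq_square)
    have Ll: "L \<sigma> = l" by (simp add: L_def l_def)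
    have qL: "((\<lambda>\<tau>. poly ?q (L \<tau>)) has_real_derivative poly (pderiv ?q) l * ?dL) (at \<sigma>)"
      using DERIV_chain[OF poly_DERIV L', of ?q] by (simp add: o_def Ll)
    have S': "((\<lambda>\<tau>. (1 + \<tau>\<^sup>2) ^ n) has_real_derivative real n * ((1 + \<sigma>\<^sup>2) ^ (n - Suc 0) * (2 * \<sigma>))) (at \<sigma>)"
      by (auto intro!: derivative_eq_intros)
    have GL: "((\<lambda>\<tau>. (1 + \<tau>\<^sup>2) ^ n * poly ?q (L \<tau>)) has_real_derivative
        (1 + \<sigma>\<^sup>2) ^ n * (poly (pderiv ?q) l * ?dL)) (at \<sigma>)"
      by (rule DERIV_cong[OF DERIV_mult[OF S' qL]]) (simp add: Ll ql del: poly_ctn_poly)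
    have "poly (poly G [:t:]) = (\<lambda>\<tau>. (1 + \<tau>\<^sup>2) ^ n * poly ?q (L \<tau>))"
      using G unfolding eval2_def L_def by (intro ext) simp
    from DERIV_unique[OF GL[folded this] poly_DERIV]
    have "(1 + \<sigma>\<^sup>2) ^ n * (poly (pderiv ?q) l * ?dL) = 0" using crit by simp
    then have crit': "BB t * (1 - \<sigma>\<^sup>2) = AA t * (2 * \<sigma>)" using q' Spos[of \<sigma>] by simp
    have "(l - m t) * (1 + \<sigma>\<^sup>2) = AA t * (1 - \<sigma>\<^sup>2) + BB t * (2 * \<sigma>)"
      using L_eq[of \<sigma>] Ll Spos[of \<sigma>] by (simp add: field_simps)
    \<comment> \<open>The added square is 0 by tangency; it completes the two-squares identity with
      \<open>(1 - \<sigma> ^ 2) ^ 2 + (2 * \<sigma>) ^ 2 = (1 + \<sigma> ^ 2) ^ 2\<close>.\<close>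
    then have "(l - m t)\<^sup>2 * (1 + \<sigma>\<^sup>2)\<^sup>2 = (AA t * (1 - \<sigma>\<^sup>2) + BB t * (2 * \<sigma>))\<^sup>2
        + (BB t * (1 - \<sigma>\<^sup>2) - AA t * (2 * \<sigma>))\<^sup>2"
      using crit' by (simp flip: power_mult_distrib)
    also have "\<dots> = ((AA t)\<^sup>2 + (BB t)\<^sup>2) * (1 + \<sigma>\<^sup>2)\<^sup>2"
      by (simp add: power2_eq_square algebra_simps)
    finally have "(l - m t)\<^sup>2 = (u + t * v)\<^sup>2 + b\<^sup>2 * (1 + t\<^sup>2)"
      using Spos[of \<sigma>] unfolding AB by simp
    then have "eval2 (conic_poly f g s) t l = 0"
      unfolding D eval2_def m_def by (simp add: power2_eq_square algebra_simps)
    moreover have "eval2 (line_poly x n) t l = 0" using ql by (simp add: eval2_line_poly)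
    ultimately show ?thesis using crit' by blast
  qed

  let ?T = "{t. \<exists>l. eval2 (conic_poly f g s) t l = 0 \<and> eval2 (line_poly x n) t l = 0}"
  have "infinite ?T"
  proof
    assume finT: "finite ?T"
    \<comment> \<open>A single \<open>t\<close> is tangent for finitely many \<open>\<sigma>\<close>
      only, so finitely many \<open>t\<close> could not serve all good parameters.\<close>
    have "UNIV \<subseteq> Bad \<union> (\<Union>t\<in>?T. {\<sigma>. BB t * (1 - \<sigma>\<^sup>2) = AA t * (2 * \<sigma>)})"
      using tangent by fast
    moreover have "finite {\<sigma>. BB t * (1 - \<sigma>\<^sup>2) = AA t * (2 * \<sigma>)}" for t
    proof -
      let ?p = "[:BB t, - 2 * AA t, - BB t:]"
      have "?p \<noteq> 0" using AB0[of t] by auto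
      moreover have "{\<sigma>. BB t * (1 - \<sigma>\<^sup>2) = AA t * (2 * \<sigma>)} \<subseteq> {\<sigma>. poly ?p \<sigma> = 0}"
        by (auto simp: algebra_simps power2_eq_square)
      ultimately show ?thesis using poly_roots_finite finite_subset by blast
    qed
    ultimately have "finite (UNIV :: real set)"
      using finT fin_Bad by (meson finite_UN_I finite_UnI finite_subset)
    then show False using infinite_UNIV_char_0 by blast
  qed
  moreover have "prime_elem (conic_poly f g s)" unfolding D using b0 by (intro prime_conic) simp
  ultimately show ?thesis using finite_common_zeros unfolding x_def by blast
qed

text \<open>At \<open>t = \<i>\<close> one has \<open>1 + t\<^sup>2 = 0\<close>, so that \<open>line_poly\<close> turns into the
  characteristic polynomial of \<open>A\<close> and \<open>conic_poly f g s\<close> into \<open>(l - f) * (l - g)\<close>.\<close>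

definition at_i :: "real poly \<Rightarrow> complex" where
  "at_i q = poly (map_poly complex_of_real q) \<i>"

interpretation at_i: comm_ring_hom at_i
proof -
  interpret r: map_poly_comm_ring_hom complex_of_real ..
  show "comm_ring_hom at_i" by unfold_locales (simp_all add: at_i_def hom_distribs)
qed

interpretation at_i_poly: map_poly_comm_ring_hom at_i ..

lemma at_i_simps [simp]: "at_i [:a, b:] = Complex a b" "at_i [:a, b, c:] = Complex (a - c) b"
  by (simp_all add: at_i_def of_real_hom.map_poly_pCons_hom complex_eq_iff)

lemma at_i_line_poly: "map_poly at_i (line_poly x n) = ctn_poly (\<lambda>_. 1) n"
  unfolding line_poly_def ctn_poly_def at_i_poly.hom_ctn
  by (simp add: one_complex.code[symmetric])

lemma at_i_point_poly: "at_i (point_poly x n z) = ctn (\<lambda>_. 1) z n"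
  unfolding point_poly_def at_i.hom_ctn by (simp add: one_complex.code[symmetric])

lemma at_i_conic_poly: "map_poly at_i (conic_poly f g s) = [:- f, 1:] * [:- g, 1:]"
proof -
  define c d b where "c = (f + g) / 2" and "d = (f - g) / 2"
    and "b = sqrt (s\<^sup>2 - (dist f g)\<^sup>2) / 2"
  have "at_i ([:Re c, Im c:]\<^sup>2 - ([:Re d, Im d:]\<^sup>2 + [:b\<^sup>2, 0, b\<^sup>2:])) = c\<^sup>2 - d\<^sup>2"
    by (simp only: at_i.hom_minus at_i.hom_add at_i.hom_power at_i_simps complex_surj)
       (simp add: Complex_eq_0)
  moreover have "at_i (- (2 * [:Re c, Im c:])) = - (2 * c)"
    by (simp only: at_i.hom_uminus at_i.hom_mult at_i.hom_numeral at_i_simps complex_surj)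
  ultimately have "map_poly at_i (conic_poly f g s) = [:c\<^sup>2 - d\<^sup>2, - (2 * c), 1:]"
    unfolding conic_poly_def Let_def c_def[symmetric] d_def[symmetric] b_def[symmetric]
    by (simp only: at_i.map_poly_pCons_hom at_i.hom_one map_poly_0)
  also have "c\<^sup>2 - d\<^sup>2 = f * g" by (simp add: c_def d_def power2_eq_square field_simps)
  also have "2 * c = f + g" by (simp add: c_def)
  finally show ?thesis by (simp add: algebra_simps)
qed

lemma ctn_one_complex_root:
  fixes z :: complex
  assumes "ctn (\<lambda>_. 1) z n = 0"
  obtains r where "z = complex_of_real r" "ctn (\<lambda>_. 1) r n = 0"
    "poly (pderiv (ctn_poly (\<lambda>_. 1) n)) z \<noteq> 0"
proof -
  interpret r: map_poly_comm_ring_hom complex_of_real ..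
  have "Im z = 0" using ctn_real_rooted[of n "\<lambda>_. 1" z] assms by auto
  then obtain r where z: "z = complex_of_real r" by (metis complex_is_Real_iff Reals_cases)
  have "complex_of_real (ctn (\<lambda>_. 1) r n) = 0"
    using assms unfolding z of_real_hom.hom_ctn by simp
  then have root: "ctn (\<lambda>_. 1) r n = 0" by simp
  have "ctn_poly (\<lambda>_. 1) n = map_poly complex_of_real (ctn_poly (\<lambda>_. 1) n)"
    unfolding ctn_poly_def r.hom_ctn by (simp add: of_real_hom.map_poly_pCons_hom)
  then have "poly (pderiv (ctn_poly (\<lambda>_. 1) n)) z
      = complex_of_real (poly (pderiv (ctn_poly (\<lambda>_. 1) n)) r)"
    by (simp only: z of_real_hom.map_poly_pderiv[symmetric] of_real_hom.poly_map_poly)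
  then show ?thesis using that z root ctn_simple_roots[of n "\<lambda>_. 1" r] by simp
qed

lemma ctn_at_0:
  "odd n \<Longrightarrow> ctn b 0 n = 0" "even n \<Longrightarrow> ctn (\<lambda>_. 1) (0::real) n \<noteq> 0"
  by (induction n rule: nat_induct2) auto

text \<open>At \<open>\<i>\<close> the divisibility puts \<open>(l - f) * (l - g)\<close> into a
  polynomial with simple real zeros, so the foci are real and distinct. If one of them were 0, then
  \<open>n\<close> is odd and the family vanishes at \<open>l = 0\<close> for all \<open>t\<close>.
  The conic does not vanish there, so the cofactor \<open>Q\<close> does, and 0 would be a double
  eigenvalue.\<close>

lemma ellipse_foci:
  assumes A: "A \<in> reciprocal_mats n" and fg: "dist f g < s"
    and E: "{z. dist z f + dist z g = s} \<subseteq> kippenhahn_curve A"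
  obtains r r' where "f = complex_of_real r" "g = complex_of_real r'" "r \<noteq> r'" "r \<noteq> 0" "r' \<noteq> 0"
    "ctn (\<lambda>_. 1) r n = 0" "ctn (\<lambda>_. 1) r' n = 0"
    "\<And>t l. eval2 (conic_poly f g s) t l = 0 \<Longrightarrow> ctn (\<lambda>k. 1 + xi A k * (1 + t\<^sup>2)) l n = 0"
proof -
  obtain Q where Q: "line_poly (xi A) n = conic_poly f g s * Q"
    using ellipse_conic_dvd[OF assms] by (rule dvdE)
  define chi :: "complex poly" where "chi = ctn_poly (\<lambda>_. 1) n"
  define R where "R = map_poly at_i Q"
  have chi: "chi = [:- f, 1:] * [:- g, 1:] * R"
    using arg_cong[OF Q, of "map_poly at_i"]
    unfolding at_i_poly.hom_mult at_i_line_poly at_i_conic_poly chi_def R_def .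
  have "poly chi f = 0" "poly chi g = 0" unfolding chi by (simp_all add: algebra_simps)
  then have "ctn (\<lambda>_. 1) f n = 0" "ctn (\<lambda>_. 1) g n = 0" by (simp_all add: chi_def)
  obtain r where r: "f = complex_of_real r" "ctn (\<lambda>_. 1) r n = 0" "poly (pderiv chi) f \<noteq> 0"
    using ctn_one_complex_root[OF \<open>ctn (\<lambda>_. 1) f n = 0\<close>] unfolding chi_def by blast
  obtain r' where r': "g = complex_of_real r'" "ctn (\<lambda>_. 1) r' n = 0" "poly (pderiv chi) g \<noteq> 0"
    using ctn_one_complex_root[OF \<open>ctn (\<lambda>_. 1) g n = 0\<close>] unfolding chi_def by blast
  have "f \<noteq> g"
  proof
    assume "f = g"
    then have "poly (pderiv chi) f = 0" unfolding chi pderiv_mult poly_add poly_mult by simp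
    then show False using r by simp
  qed
  have nonzero: "f \<noteq> 0 \<and> g \<noteq> 0"
  proof (rule ccontr)
    assume "\<not> (f \<noteq> 0 \<and> g \<noteq> 0)"
    then have z: "f = 0 \<or> g = 0" by blast
    then have "odd n" using r r' ctn_at_0(2)[of n] by auto
    then have line0: "eval2 (line_poly (xi A) n) t 0 = 0" for t
      by (simp add: eval2_line_poly ctn_at_0)
    have "(dist f g)\<^sup>2 < s\<^sup>2" using fg by (simp add: power_strict_mono)
    then have "eval2 (conic_poly f g s) t 0 \<noteq> 0" for t
    proof -
      define b where "b = sqrt (s\<^sup>2 - (dist f g)\<^sup>2) / 2"
      have "0 < b" using \<open>(dist f g)\<^sup>2 < s\<^sup>2\<close> by (simp add: b_def)
      have "eval2 (conic_poly f g s) t 0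
          = (Re f + t * Im f) * (Re g + t * Im g) - b\<^sup>2 * (1 + t\<^sup>2)"
        unfolding conic_poly_def Let_def b_def[symmetric] eval2_def
        by (simp add: power2_eq_square field_simps)
      then have "eval2 (conic_poly f g s) t 0 = - (b\<^sup>2 * (1 + t\<^sup>2))" using z by auto
      moreover have "0 < b\<^sup>2 * (1 + t\<^sup>2)" using \<open>0 < b\<close> by (simp add: add_pos_nonneg)
      ultimately show ?thesis by linarith
    qed
    then have "poly (poly Q [:0:]) t = 0" for t
      using line0[of t] unfolding Q by (simp add: eval2_def)
    then have "poly Q [:0:] = 0" using poly_all_0_iff_0 by blast
    then have "poly Q 0 = 0" by simp
    then have "coeff Q 0 = 0" by (simp add: poly_0_coeff_0)
    then have R0: "poly R 0 = 0" unfolding R_def by (simp add: poly_0_coeff_0 coeff_map_poly)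
    have "poly (pderiv chi) 0 = 0"
      unfolding chi pderiv_mult poly_add poly_mult using z R0 by (auto simp: pderiv_pCons)
    then show False using r r' z by auto
  qed
  have "ctn (\<lambda>k. 1 + xi A k * (1 + t\<^sup>2)) l n = 0" if "eval2 (conic_poly f g s) t l = 0" for t l
    using that arg_cong[OF Q, of "\<lambda>G. eval2 G t l"] by (simp add: eval2_line_poly)
  then show ?thesis using that[OF r(1) r'(1)] r r' \<open>f \<noteq> g\<close> nonzero by auto
qed

lemma eval2_conic_poly_real:
  "eval2 (conic_poly (complex_of_real r) (complex_of_real r') s) t l
    = (l - (r + r') / 2)\<^sup>2 - ((r - r') / 2)\<^sup>2 - (sqrt (s\<^sup>2 - (r - r')\<^sup>2) / 2)\<^sup>2 * (1 + t\<^sup>2)"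
proof -
  have "dist (complex_of_real r) (complex_of_real r') = \<bar>r - r'\<bar>"
    by (simp add: dist_norm flip: of_real_diff)
  then show ?thesis
    unfolding conic_poly_def Let_def eval2_def
    by (simp add: power2_eq_square algebra_simps)
qed

text \<open>With \<open>\<rho> = 1 / (1 + t ^ 2)\<close> the tangents are \<open>l = p + w\<close>
  and \<open>l = p - w\<close>, whose scaled squares are the two zetas.\<close>

lemma (in focal) even_odd_poly_eq_0_of_lines:
  assumes C: "0 \<le> C"
    and lines: "\<And>t l. (l - p)\<^sup>2 = X\<^sup>2 + C * (1 + t\<^sup>2) \<Longrightarrow> ctn (\<lambda>k. 1 + x k * (1 + t\<^sup>2)) l n = 0"
  shows "even_poly n p X C x = 0 \<and> odd_poly n p X C x = 0"
proof (rule even_odd_poly_eq_0I)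
  \<comment> \<open>For \<open>\<rho>\<close> below this bound \<open>p - w \<noteq> 0\<close>: if
    \<open>C > 0\<close> then \<open>p ^ 2 < C / \<rho>\<close> gives \<open>p < w\<close>, and if
    \<open>C = 0\<close> then \<open>w = X\<close>. A zero intercept would say nothing about
    \<open>P\<close> when \<open>n\<close> is odd. The bound 1 keeps \<open>t\<close> real.\<close>
  define B where "B = (if C = 0 then 1 else min 1 (C / p\<^sup>2))"
  have "0 < B" using C p_pos by (simp add: B_def)
  then show "infinite {0<..<B}" by (rule infinite_Ioo)
  fix \<rho> assume "\<rho> \<in> {0<..<B}"
  then have \<rho>: "0 < \<rho>" "\<rho> < 1" "C \<noteq> 0 \<Longrightarrow> \<rho> < C / p\<^sup>2" by (auto simp: B_def split: if_splits)
  define t w where "t = sqrt (1 / \<rho> - 1)" and "w = sqrt (X\<^sup>2 + C / \<rho>)"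
  have t: "1 + t\<^sup>2 = 1 / \<rho>" using \<rho> by (simp add: t_def)
  have w2: "w\<^sup>2 = X\<^sup>2 + C / \<rho>" using \<rho> C by (simp add: w_def)
  have "0 < X\<^sup>2 + C / \<rho>" using \<rho> C X_pos by (simp add: add_pos_nonneg)
  then have w0: "0 < w" by (simp add: w_def)
  have "p - w \<noteq> 0"
  proof (cases "C = 0")
    case True
    then have "w = X" using X_pos by (simp add: w_def)
    then show ?thesis using p_ne_X by simp
  next
    case False
    then have "p\<^sup>2 < C / \<rho>" using \<rho> p_pos by (simp add: field_simps)
    then have "p\<^sup>2 < w\<^sup>2" unfolding w2 by (simp add: add_pos_nonneg less_le_trans)
    then show ?thesis by auto
  qed
  have b: "(\<lambda>k. 1 + x k * (1 + t\<^sup>2)) = (\<lambda>k. x k / \<rho> + 1)" unfolding t by (simp add: add.commute)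
  have "ctn (\<lambda>k. x k / \<rho> + 1) (p + w) n = 0" "ctn (\<lambda>k. x k / \<rho> + 1) (p - w) n = 0"
    using lines[of "p + w" t, unfolded b] lines[of "p - w" t, unfolded b]
    by (simp_all only: t w2 add_diff_cancel_left' diff_diff_eq2 power2_minus minus_diff_eq
        diff_minus_eq_add times_divide_eq_right mult_1_right) (simp_all add: w2)
  moreover have "p + w \<noteq> 0" using p_pos w0 by simp
  moreover have "\<rho> * w\<^sup>2 = C + X\<^sup>2 * \<rho>" unfolding w2 using \<rho> by (simp add: distrib_left)
  note z = zeta_sqrt[OF \<rho>(1) less_imp_le[OF w0] this]
  ultimately show "P n x \<rho> (zeta_plus p X C \<rho>) = 0 \<and> P n x \<rho> (zeta_minus p X C \<rho>) = 0
      \<and> root_term X C \<rho> \<noteq> 0"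
    unfolding z using P_eq_0_of_ctn[OF \<rho>(1), of x "p + w" n] P_eq_0_of_ctn[OF \<rho>(1), of x "p - w" n]
      \<open>p - w \<noteq> 0\<close> \<rho> w0 by simp
qed

section \<open>Necessity: focal pairs from ellipses and pencils\<close>

lemma focal_of_roots:
  assumes "r' < r" "0 < r + r'" "r' \<noteq> 0" "ctn (\<lambda>_. 1) r n = 0" "ctn (\<lambda>_. 1) r' n = 0"
  shows "focal n ((r + r') / 2) ((r - r') / 2)"
proof
  have "(r + r') / 2 + (r - r') / 2 = r" "(r + r') / 2 - (r - r') / 2 = r'"
    by (simp_all add: field_simps)
  then show "ctn (\<lambda>_. 1) ((r + r') / 2 + (r - r') / 2) n = 0"
    "ctn (\<lambda>_. 1) ((r + r') / 2 - (r - r') / 2) n = 0" "(r + r') / 2 - (r - r') / 2 \<noteq> 0"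
    using assms by simp_all
qed (use assms in simp_all)

text \<open>Swapping the foci makes \<open>X\<close> positive, and passing from \<open>E\<close> to
  \<open>-E\<close> makes \<open>p\<close> positive.\<close>

lemma real_pair_sign_cases:
  fixes r r' :: real
  assumes "r \<noteq> r'" "r + r' \<noteq> 0"
    and "\<And>r r'. Q r r' \<Longrightarrow> Q r' r \<and> Q (- r) (- r')" and "Q r r'"
  obtains a a' where "Q a a'" "a' < a" "0 < a + a'"
proof -
  have "Q r' r" "Q (- r) (- r')" "Q (- r') (- r)" using assms(3)[OF assms(4)] assms(3) by blast+
  then show ?thesis using that[of r r'] that[of r' r] that[of "- r" "- r'"] that[of "- r'" "- r"] assms
    by linarith
qed

lemma ellipse_necessary:
  assumes A: "A \<in> reciprocal_mats n" and E: "is_ellipse E" "E \<noteq> uminus ` E"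
    and sub: "E \<union> uminus ` E \<subseteq> kippenhahn_curve A"
  shows "\<exists>p X C. focal n p X \<and> 0 < C \<and> even_poly n p X C (xi A) = 0 \<and> odd_poly n p X C (xi A) = 0"
proof -
  obtain f g s where fg: "dist f g < s" and Eeq: "E = {z. dist z f + dist z g = s}"
    using E(1) unfolding is_ellipse_def by blast
  have neg: "uminus ` {z. dist z f + dist z g = s} = {z. dist z (- f) + dist z (- g) = s}" for f g :: complex
  proof -
    have "dist (- z) h = dist z (- h)" for z h :: complex
      using norm_minus_cancel[of "z + h"] by (simp add: dist_norm)
    note d = this
    show ?thesis
    proof (intro equalityI subsetI)
      fix y assume "y \<in> {z. dist z (- f) + dist z (- g) = s}"
      then have "- y \<in> {z. dist z f + dist z g = s}" using d by simp
      then show "y \<in> uminus ` {z. dist z f + dist z g = s}" by (rule rev_image_eqI) simp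
    qed (use d in auto)
  qed
  obtain r r' where r: "f = complex_of_real r" "g = complex_of_real r'" "r \<noteq> r'"
  proof -
    have "{z. dist z f + dist z g = s} \<subseteq> kippenhahn_curve A" using sub Eeq by simp
    then show thesis by (rule ellipse_foci[OF A fg]) (rule that; assumption)
  qed
  \<comment> \<open>An ellipse centred at 0 equals its negative, so this is where \<open>E\<close>
    differs from \<open>-E\<close> enters.\<close>
  have "r + r' \<noteq> 0"
  proof
    assume "r + r' = 0"
    then have "g = - f" unfolding r by (simp add: eq_neg_iff_add_eq_0 add.commute flip: of_real_minus)
    then have "uminus ` E = E" unfolding Eeq neg by (simp add: add.commute)
    then show False using E(2) by simp
  qed
  \<comment> \<open>Contains both the ellipse and its negative, which makes it invariant under a
    change of sign of the foci.\<close>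
  define Q where "Q r r' \<longleftrightarrow> dist (complex_of_real r) (complex_of_real r') < s \<and>
      {z. dist z (complex_of_real r) + dist z (complex_of_real r') = s} \<subseteq> kippenhahn_curve A \<and>
      {z. dist z (- complex_of_real r) + dist z (- complex_of_real r') = s} \<subseteq> kippenhahn_curve A"
    for r r'
  have "Q r r'" using sub fg unfolding Q_def r Eeq neg by blast
  moreover have "Q r' r \<and> Q (- r) (- r')" if "Q r r'" for r r'
  proof -
    have "dist (- z) (- h) = dist z h" for z h :: complex
      by (simp add: dist_norm norm_minus_commute)
    then show ?thesis using that unfolding Q_def of_real_minus by (simp add: dist_commute add.commute)
  qed
  ultimately obtain a a' where a: "Q a a'" "a' < a" "0 < a + a'"
    using real_pair_sign_cases[OF \<open>r \<noteq> r'\<close> \<open>r + r' \<noteq> 0\<close>, of Q] by blast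
  obtain c c' where c: "complex_of_real a = complex_of_real c" "complex_of_real a' = complex_of_real c'"
    "c \<noteq> 0" "c' \<noteq> 0" "ctn (\<lambda>_. 1) c n = 0" "ctn (\<lambda>_. 1) c' n = 0"
    "\<And>t l. eval2 (conic_poly (complex_of_real a) (complex_of_real a') s) t l = 0 \<Longrightarrow>
       ctn (\<lambda>k. 1 + xi A k * (1 + t\<^sup>2)) l n = 0"
  proof -
    have "dist (complex_of_real a) (complex_of_real a') < s"
      "{z. dist z (complex_of_real a) + dist z (complex_of_real a') = s} \<subseteq> kippenhahn_curve A"
      using a(1) unfolding Q_def by blast+
    then show thesis by (rule ellipse_foci[OF A]) (rule that; assumption)
  qed
  then have roots: "a' \<noteq> 0" "ctn (\<lambda>_. 1) a n = 0" "ctn (\<lambda>_. 1) a' n = 0" by simp_all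
  interpret focal n "(a + a') / 2" "(a - a') / 2"
    using focal_of_roots[OF a(2,3) roots] .
  define C where "C = (sqrt (s\<^sup>2 - (a - a')\<^sup>2) / 2)\<^sup>2"
  have "\<bar>a - a'\<bar> < s" using a(1) unfolding Q_def by (simp add: dist_norm flip: of_real_diff)
  then have "(a - a')\<^sup>2 < s\<^sup>2" by (metis abs_ge_zero power2_abs power_strict_mono pos2)
  then have "0 < C" by (simp add: C_def)
  moreover have "even_poly n ((a + a') / 2) ((a - a') / 2) C (xi A) = 0
      \<and> odd_poly n ((a + a') / 2) ((a - a') / 2) C (xi A) = 0"
  proof (rule even_odd_poly_eq_0_of_lines)
    fix t l assume "(l - (a + a') / 2)\<^sup>2 = ((a - a') / 2)\<^sup>2 + C * (1 + t\<^sup>2)"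
    then show "ctn (\<lambda>k. 1 + xi A k * (1 + t\<^sup>2)) l n = 0"
      by (intro c(7)) (simp add: eval2_conic_poly_real C_def)
  qed (use \<open>0 < C\<close> in simp)
  ultimately show ?thesis using focal_axioms by blast
qed

text \<open>A pencil inside the family makes \<open>point_poly\<close> vanish identically, hence
  also at \<open>\<i>\<close>, where it is the characteristic polynomial evaluated at
  \<open>f\<close>.\<close>

lemma pencil_lines:
  assumes A: "A \<in> reciprocal_mats n" and f: "pencil_in_family A f"
  obtains r where "f = complex_of_real r" "ctn (\<lambda>_. 1) r n = 0"
    "\<And>t. ctn (\<lambda>k. 1 + xi A k * (1 + t\<^sup>2)) r n = 0"
proof -
  have z: "poly (point_poly (xi A) n f) t = 0" for t
  proof -
    let ?\<theta> = "- arctan t"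
    have c: "cos ?\<theta> \<noteq> 0" by simp
    have "ctn (\<lambda>k. xi A k + (cos ?\<theta>)\<^sup>2) (Re (cis ?\<theta> * f)) n = 0"
      using f unfolding pencil_in_family_def kippenhahn_root_iff[OF A] by blast
    then show ?thesis unfolding ctn_cos_eq[OF c] using c by (simp add: tan_arctan)
  qed
  then have "point_poly (xi A) n f = 0" using poly_all_0_iff_0 by blast
  then have "ctn (\<lambda>_. 1) f n = 0" using at_i_point_poly[of "xi A" n f] by simp
  then obtain r where r: "f = complex_of_real r" "ctn (\<lambda>_. 1) r n = 0"
    by (rule ctn_one_complex_root)
  then show ?thesis using that z by (simp add: poly_point_poly)
qed

text \<open>The case \<open>C = 0\<close> of the tangent condition: it admits only
  \<open>l = p + X\<close> and \<open>l = p - X\<close>, which are the lines through the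
  foci.\<close>

lemma pencil_necessary:
  assumes A: "A \<in> reciprocal_mats n" and fg: "f \<noteq> g" "{f, g} \<inter> uminus ` {f, g} = {}"
    and pencils: "\<forall>h\<in>{f, g} \<union> uminus ` {f, g}. pencil_in_family A h"
  shows "\<exists>p X. focal n p X \<and> even_poly n p X 0 (xi A) = 0 \<and> odd_poly n p X 0 (xi A) = 0"
proof -
  define L where "L r \<longleftrightarrow> r \<noteq> 0 \<and> pencil_in_family A (complex_of_real r)
    \<and> pencil_in_family A (complex_of_real (- r))" for r
  have real: "\<exists>r. h = complex_of_real r \<and> L r" if "h \<in> {f, g}" for h
  proof -
    have h: "pencil_in_family A h" "pencil_in_family A (- h)" using pencils that by blast+
    obtain r where r: "h = complex_of_real r" using h(1) by (rule pencil_lines[OF A])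
    have "h \<noteq> 0"
    proof
      assume "h = 0"
      then have "0 \<in> {f, g} \<inter> uminus ` {f, g}" using that by (auto simp: image_iff)
      then show False using fg(2) by simp
    qed
    then have "L r" using h unfolding L_def r of_real_minus by simp
    then show ?thesis using r by blast
  qed
  obtain r r' where r: "f = complex_of_real r" "L r" "g = complex_of_real r'" "L r'"
    using real by blast
  have "r \<noteq> r'" using fg(1) r by auto
  moreover have "r + r' \<noteq> 0"
  proof
    assume "r + r' = 0"
    then have "f = - g" unfolding r by (simp add: eq_neg_iff_add_eq_0 flip: of_real_minus)
    then show False using fg(2) by auto
  qed
  moreover have "L a' \<and> L a \<and> L (- a) \<and> L (- a')" if "L a \<and> L a'" for a a'
    using that by (simp add: L_def)
  ultimately obtain a a' where a: "L a \<and> L a'" "a' < a" "0 < a + a'"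
    using real_pair_sign_cases[of r r' "\<lambda>r r'. L r \<and> L r'"] r by metis
  have lines: "ctn (\<lambda>_. 1) b n = 0 \<and> (\<forall>t. ctn (\<lambda>k. 1 + xi A k * (1 + t\<^sup>2)) b n = 0)" if "L b" for b
  proof -
    note b = that
    obtain r where r: "complex_of_real b = complex_of_real r" "ctn (\<lambda>_. 1) r n = 0"
      "\<And>t. ctn (\<lambda>k. 1 + xi A k * (1 + t\<^sup>2)) r n = 0"
    proof -
      have "pencil_in_family A (complex_of_real b)" using b unfolding L_def by blast
      then show thesis by (rule pencil_lines[OF A]) (rule that)
    qed
    then have "b = r" by simp
    then show ?thesis using r by simp
  qed
  interpret focal n "(a + a') / 2" "(a - a') / 2"
    using focal_of_roots[OF a(2,3)] a(1) lines by (simp add: L_def)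
  have "even_poly n ((a + a') / 2) ((a - a') / 2) 0 (xi A) = 0
      \<and> odd_poly n ((a + a') / 2) ((a - a') / 2) 0 (xi A) = 0"
  proof (rule even_odd_poly_eq_0_of_lines)
    fix t l assume "(l - (a + a') / 2)\<^sup>2 = ((a - a') / 2)\<^sup>2 + 0 * (1 + t\<^sup>2)"
    then have "l - (a + a') / 2 = (a - a') / 2 \<or> l - (a + a') / 2 = - ((a - a') / 2)"
      by (simp add: power2_eq_iff)
    then have "l = a \<or> l = a'" by (auto simp: field_simps)
    then show "ctn (\<lambda>k. 1 + xi A k * (1 + t\<^sup>2)) l n = 0" using lines a(1) by blast
  qed simp
  then show ?thesis using focal_axioms by blast
qed

text \<open>A negative \<open>C\<close> would produce a non-real \<open>zeta_plus\<close> for some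
  \<open>\<rho> > 0\<close>, and its square root would be a non-real zero of a continuant with
  positive weights.\<close>

lemma (in focal) C_nonneg:
  assumes "\<And>k. 0 \<le> x k" "even_poly n p X C x = 0" "odd_poly n p X C x = 0"
  shows "0 \<le> C"
proof (rule ccontr)
  assume C: "\<not> 0 \<le> C"
  \<comment> \<open>Half of the value at which \<open>C + X ^ 2 * \<rho>\<close> changes sign, so
    that the radicand is negative.\<close>
  define \<rho> where "\<rho> = - C / (2 * X\<^sup>2)"
  have \<rho>: "0 < \<rho>" using C X_pos by (simp add: \<rho>_def divide_neg_pos)
  have "C + X\<^sup>2 * \<rho> = C / 2" using X_pos by (simp add: \<rho>_def field_simps)
  then have neg: "\<rho> * (C + X\<^sup>2 * \<rho>) < 0" using \<rho> C by (simp add: mult_pos_neg)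
  have "Im (root_term X C \<rho>) \<noteq> 0"
  proof
    assume "Im (root_term X C \<rho>) = 0"
    then have "Re ((root_term X C \<rho>)\<^sup>2) = (Re (root_term X C \<rho>))\<^sup>2" by (simp add: power2_eq_square)
    then have "\<rho> * (C + X\<^sup>2 * \<rho>) = (Re (root_term X C \<rho>))\<^sup>2" by (simp only: root_term_square Re_complex_of_real)
    then show False using neg by (metis not_less zero_le_power2)
  qed
  then have Im: "Im (zeta_plus p X C \<rho>) \<noteq> 0" using p_pos by (simp add: zeta_plus_def)
  define z where "z = csqrt (zeta_plus p X C \<rho>)"
  have z2: "z\<^sup>2 = zeta_plus p X C \<rho>" by (simp add: z_def)
  then have "Im z \<noteq> 0" using Im by (metis Im_power2 mult_zero_right)
  moreover have "0 < x k + \<rho>" for k using assms(1)[of k] \<rho> by simp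
  ultimately have "ctn (\<lambda>k. complex_of_real (x k + \<rho>)) z n \<noteq> 0" by (intro ctn_real_rooted)
  moreover have "P n x \<rho> (z\<^sup>2) = 0" unfolding z2 by (rule even_odd_poly_eq_0D(1)[OF assms(2,3)])
  ultimately show False unfolding ctn_eq_P by simp
qed

section \<open>Sufficiency: lines, pencils and ellipses from a solution\<close>

lemma (in focal) lines_in_family:
  assumes A: "A \<in> reciprocal_mats n"
    and R: "even_poly n p X C (xi A) = 0" "odd_poly n p X C (xi A) = 0"
    and C: "0 \<le> C" and e: "e = 1 \<or> e = - 1"
    and l: "l = p * cos \<theta> + e * sqrt (C + X\<^sup>2 * (cos \<theta>)\<^sup>2)"
  shows "kippenhahn_poly A (complex_of_real l) \<theta> = 0" "kippenhahn_poly A (complex_of_real (- l)) \<theta> = 0"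
proof -
  define \<rho> w where "\<rho> = (cos \<theta>)\<^sup>2" and "w = sqrt (C + X\<^sup>2 * (cos \<theta>)\<^sup>2)"
  have rad: "0 \<le> C + X\<^sup>2 * (cos \<theta>)\<^sup>2" using C by simp
  have w2: "w\<^sup>2 = C + X\<^sup>2 * \<rho>" using rad by (simp add: w_def \<rho>_def)
  have root: "root_term X C \<rho> = complex_of_real (\<bar>cos \<theta>\<bar> * w)"
  proof -
    have "\<rho> * (C + X\<^sup>2 * \<rho>) = (\<bar>cos \<theta>\<bar> * w)\<^sup>2" using w2 by (simp add: \<rho>_def power_mult_distrib)
    then show ?thesis unfolding root_term_def using rad by (subst csqrt_of_real_nonneg) (auto simp: w_def)
  qed
  have "l\<^sup>2 = C + (p\<^sup>2 + X\<^sup>2) * \<rho> + 2 * p * (e * cos \<theta> * w)"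
  proof -
    have "l\<^sup>2 = p\<^sup>2 * \<rho> + 2 * p * (e * cos \<theta> * w) + e\<^sup>2 * w\<^sup>2"
      unfolding l w_def[symmetric] \<rho>_def by (simp add: power2_eq_square algebra_simps)
    moreover have "e\<^sup>2 = 1" using e by auto
    ultimately show ?thesis unfolding w2 by (simp add: algebra_simps)
  qed
  note l2 = this
  \<comment> \<open>\<open>root_term\<close> only knows \<open>\<bar>cos \<theta>\<bar>\<close>; the
    signs of \<open>e\<close> and \<open>cos \<theta>\<close> merely decide between
    \<open>zeta_plus\<close> and \<open>zeta_minus\<close>.\<close>
  have sign: "e * cos \<theta> * w = \<bar>cos \<theta>\<bar> * w \<or> e * cos \<theta> * w = - (\<bar>cos \<theta>\<bar> * w)"
    using e by (auto simp: abs_if)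
  have "zeta_plus p X C \<rho> = complex_of_real (C + (p\<^sup>2 + X\<^sup>2) * \<rho> + 2 * p * (\<bar>cos \<theta>\<bar> * w))"
    "zeta_minus p X C \<rho> = complex_of_real (C + (p\<^sup>2 + X\<^sup>2) * \<rho> + 2 * p * - (\<bar>cos \<theta>\<bar> * w))"
    unfolding zeta_plus_def zeta_minus_def root by simp_all
  then have "complex_of_real (l\<^sup>2) = zeta_plus p X C \<rho> \<or> complex_of_real (l\<^sup>2) = zeta_minus p X C \<rho>"
    using sign unfolding l2 by metis
  then have "(complex_of_real l)\<^sup>2 = zeta_plus p X C \<rho> \<or> (complex_of_real l)\<^sup>2 = zeta_minus p X C \<rho>"
    by (simp only: of_real_power)
  then have "P n (xi A) \<rho> ((complex_of_real l)\<^sup>2) = 0" using even_odd_poly_eq_0D[OF R] by metis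
  then have "ctn (\<lambda>k. complex_of_real (xi A k + (cos \<theta>)\<^sup>2)) (complex_of_real l) n = 0"
    unfolding ctn_eq_P \<rho>_def by simp
  then show "kippenhahn_poly A (complex_of_real l) \<theta> = 0" "kippenhahn_poly A (complex_of_real (- l)) \<theta> = 0"
    unfolding kippenhahn_poly_eq_ctn[OF A] of_real_minus ctn_minus by simp_all
qed

lemma (in focal) pencil_sufficient:
  assumes A: "A \<in> reciprocal_mats n"
    and R: "even_poly n p X 0 (xi A) = 0" "odd_poly n p X 0 (xi A) = 0"
  shows "\<exists>f g. f \<noteq> g \<and> {f, g} \<inter> uminus ` {f, g} = {} \<and>
    (\<forall>h\<in>{f, g} \<union> uminus ` {f, g}. pencil_in_family A h)"
proof (intro exI conjI)
  let ?f = "complex_of_real (p + X)" and ?g = "complex_of_real (p - X)"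
  show "?f \<noteq> ?g" using X_pos by simp
  have "p + X \<noteq> - (p + X)" "p + X \<noteq> - (p - X)" "p - X \<noteq> - (p - X)" "p - X \<noteq> - (p + X)"
    using p_pos X_pos p_ne_X by linarith+
  then have "?f \<noteq> - ?f" "?f \<noteq> - ?g" "?g \<noteq> - ?g" "?g \<noteq> - ?f"
    unfolding of_real_minus[symmetric] of_real_eq_iff by blast+
  then show "{?f, ?g} \<inter> uminus ` {?f, ?g} = {}" by blast
  have line: "kippenhahn_poly A (complex_of_real ((p + d * X) * cos \<theta>)) \<theta> = 0
      \<and> kippenhahn_poly A (complex_of_real (- ((p + d * X) * cos \<theta>))) \<theta> = 0" if d: "d = 1 \<or> d = -1" for d \<theta>
  proof -
    \<comment> \<open>The square root yields \<open>X * \<bar>cos \<theta>\<bar>\<close>, and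
      \<open>e\<close> restores the sign of \<open>cos \<theta>\<close>.\<close>
    define e where "e = (if 0 \<le> cos \<theta> then d else - d)"
    have e: "e = 1 \<or> e = -1" using d by (auto simp: e_def)
    have "(p + d * X) * cos \<theta> = p * cos \<theta> + e * sqrt (0 + X\<^sup>2 * (cos \<theta>)\<^sup>2)"
      using X_pos by (simp add: real_sqrt_mult e_def algebra_simps)
    then show ?thesis using lines_in_family[OF A R order_refl e] by blast
  qed
  have "pencil_in_family A (complex_of_real (p + d * X)) \<and> pencil_in_family A (- complex_of_real (p + d * X))"
    if "d = 1 \<or> d = -1" for d
  proof -
    have "Re (cis \<theta> * complex_of_real c) = c * cos \<theta>"
      "Re (cis \<theta> * - complex_of_real c) = - (c * cos \<theta>)" for c \<theta>
      by (simp_all add: mult.commute)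
    then show ?thesis using line[OF that] by (simp only: pencil_in_family_def) blast
  qed
  from this[of 1] this[of "-1"] show "\<forall>h\<in>{?f, ?g} \<union> uminus ` {?f, ?g}. pencil_in_family A h" by auto
qed

lemma ellipse_equation:
  fixes z :: complex
  assumes C: "0 < C" and z: "dist z (complex_of_real (p + X)) + dist z (complex_of_real (p - X)) = 2 * sqrt (C + X\<^sup>2)"
  shows "C * (Re z - p)\<^sup>2 + (C + X\<^sup>2) * (Im z)\<^sup>2 = (C + X\<^sup>2) * C"
proof -
  define a d d' Y y where "a = sqrt (C + X\<^sup>2)" and "d = dist z (complex_of_real (p + X))"
    and "d' = dist z (complex_of_real (p - X))" and "Y = Re z - p" and "y = Im z"
  have a2: "a\<^sup>2 = C + X\<^sup>2" and a0: "0 < a" using C by (simp_all add: a_def add_pos_nonneg)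
  have d2: "d\<^sup>2 = (Y - X)\<^sup>2 + y\<^sup>2" "d'\<^sup>2 = (Y + X)\<^sup>2 + y\<^sup>2"
    by (simp_all add: d_def d'_def dist_norm cmod_power2 Y_def y_def algebra_simps)
  have sum: "d' = 2 * a - d" using z by (simp add: a_def d_def d'_def)
  \<comment> \<open>The difference of the squared focal distances is linear in \<open>Y\<close>.
    With the given sum this determines each distance without nested roots.\<close>
  have "4 * a * (a - d) = d'\<^sup>2 - d\<^sup>2" unfolding sum by (simp add: power2_eq_square algebra_simps)
  also have "\<dots> = 4 * (X * Y)" unfolding d2 by (simp add: power2_eq_square algebra_simps)
  finally have "a * d = a\<^sup>2 - X * Y" by (simp add: power2_eq_square algebra_simps)
  then have "a\<^sup>2 * d\<^sup>2 = (a\<^sup>2 - X * Y)\<^sup>2" by (simp flip: power_mult_distrib)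
  then have "a\<^sup>2 * ((Y - X)\<^sup>2 + y\<^sup>2) = (a\<^sup>2 - X * Y)\<^sup>2" unfolding d2 .
  then have "(a\<^sup>2 - X\<^sup>2) * Y\<^sup>2 + a\<^sup>2 * y\<^sup>2 = a\<^sup>2 * (a\<^sup>2 - X\<^sup>2)"
    by (simp add: power2_eq_square algebra_simps)
  then show ?thesis unfolding a2 by (simp add: Y_def y_def)
qed

lemma (in focal) ellipse_in_curve:
  assumes A: "A \<in> reciprocal_mats n"
    and R: "even_poly n p X C (xi A) = 0" "odd_poly n p X C (xi A) = 0" and C: "0 < C"
    and z: "dist z (complex_of_real (p + X)) + dist z (complex_of_real (p - X)) = 2 * sqrt (C + X\<^sup>2)"
    and e: "e = 1 \<or> e = - 1"
  shows "complex_of_real e * z \<in> kippenhahn_curve A"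
proof -
  define B Y y where "B = C + X\<^sup>2" and "Y = Re z - p" and "y = Im z"
  have B: "0 < B" using C by (simp add: B_def add_pos_nonneg)
  have eq: "C * Y\<^sup>2 + B * y\<^sup>2 = B * C"
    using ellipse_equation[OF C z] by (simp add: B_def Y_def y_def)
  \<comment> \<open>The normal of the ellipse at \<open>z\<close> is proportional to
    \<open>(C * Y, B * y)\<close>, and the line with angle \<open>\<theta>\<close> has normal
    \<open>(cos \<theta>, - sin \<theta>)\<close>; hence the minus sign.\<close>
  define v where "v = Complex (C * Y) (- (B * y))"
  define M where "M = cmod v"
  have M2: "M\<^sup>2 = C\<^sup>2 * Y\<^sup>2 + B\<^sup>2 * y\<^sup>2" by (simp add: M_def v_def cmod_power2 power_mult_distrib)
  have "v \<noteq> 0"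
  proof
    assume "v = 0"
    then have "Y = 0" "y = 0" using B C by (simp_all add: v_def complex_eq_iff)
    then show False using eq B C by simp
  qed
  then have M: "0 < M" by (simp add: M_def)
  define \<theta> where "\<theta> = Arg v"
  have bounds: "- pi < \<theta>" "\<theta> \<le> pi" using Arg_bounded[of v] by (simp_all add: \<theta>_def)
  have "cis \<theta> = sgn v" using \<open>v \<noteq> 0\<close> by (simp add: \<theta>_def cis_Arg)
  then have "cis \<theta> = v / complex_of_real M" by (simp add: sgn_eq M_def)
  then have cs: "cos \<theta> = C * Y / M" "sin \<theta> = - (B * y) / M"
    by (simp_all add: complex_eq_iff v_def)
  \<comment> \<open>Support function of the ellipse. It agrees with \<open>Re (cis t * z)\<close> to
    first order at \<open>\<theta>\<close>, as the envelope condition demands.\<close>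
  define h where "h t = p * cos t + sqrt (C + X\<^sup>2 * (cos t)\<^sup>2)" for t
  have rad: "C + X\<^sup>2 * (cos \<theta>)\<^sup>2 = (B * C / M)\<^sup>2"
  proof -
    have "C * M\<^sup>2 + X\<^sup>2 * (C * Y)\<^sup>2 = C\<^sup>2 * (C * Y\<^sup>2 + X\<^sup>2 * Y\<^sup>2) + C * B * (B * y\<^sup>2)"
      unfolding M2 by (simp add: power2_eq_square algebra_simps)
    also have "C * Y\<^sup>2 + X\<^sup>2 * Y\<^sup>2 = B * Y\<^sup>2" by (simp add: B_def algebra_simps)
    also have "C\<^sup>2 * (B * Y\<^sup>2) + C * B * (B * y\<^sup>2) = C * B * (C * Y\<^sup>2 + B * y\<^sup>2)"
      by (simp add: power2_eq_square algebra_simps)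
    also have "\<dots> = (B * C)\<^sup>2" unfolding eq by (simp add: power2_eq_square)
    finally show ?thesis unfolding cs using M by (simp add: power_divide field_simps)
  qed
  have root: "sqrt (C + X\<^sup>2 * (cos \<theta>)\<^sup>2) = B * C / M" unfolding rad using B C M by simp
  have val: "Re (cis \<theta> * z) = h \<theta>"
  proof -
    have "Re (cis \<theta> * z) = (C * Y * (Y + p) + B * y * y) / M"
      using cs by (simp add: Y_def y_def add_divide_distrib)
    also have "C * Y * (Y + p) + B * y * y = p * (C * Y) + B * C"
      using eq by (simp add: power2_eq_square algebra_simps)
    finally show ?thesis unfolding h_def root unfolding cs(1) by (simp add: add_divide_distrib)
  qed
  define d where "d = - sin \<theta> * Re z - cos \<theta> * Im z"
  have z': "((\<lambda>t. Re (cis t * z)) has_real_derivative d) (at \<theta>)"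
    unfolding d_def by (auto intro!: derivative_eq_intros)
  have "(h has_real_derivative - p * sin \<theta> + (X\<^sup>2 * (2 * cos \<theta> * - sin \<theta>)) * (inverse (sqrt (C + X\<^sup>2 * (cos \<theta>)\<^sup>2)) / 2)) (at \<theta>)"
  proof -
    have "0 < C + X\<^sup>2 * (cos \<theta>)\<^sup>2" using C by (simp add: add_pos_nonneg)
    then show ?thesis unfolding h_def
      by (auto intro!: derivative_eq_intros simp: field_simps)
  qed
  also have "- p * sin \<theta> + (X\<^sup>2 * (2 * cos \<theta> * - sin \<theta>)) * (inverse (sqrt (C + X\<^sup>2 * (cos \<theta>)\<^sup>2)) / 2) = d"
  proof -
    have "- p * sin \<theta> + (X\<^sup>2 * (2 * cos \<theta> * - sin \<theta>)) * (inverse (B * C / M) / 2)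
        = (p * (B * y) + X\<^sup>2 * Y * y) / M"
      unfolding cs using B C M by (simp add: field_simps power2_eq_square)
    also have "\<dots> = (B * y * (Y + p) - C * Y * y) / M" by (simp add: B_def algebra_simps)
    also have "\<dots> = d" unfolding d_def cs using M by (simp add: Y_def y_def field_simps)
    finally show ?thesis unfolding root .
  qed
  finally have h': "(h has_real_derivative d) (at \<theta>)" .
  have Re_e: "Re (cis t * (complex_of_real e * z)) = e * Re (cis t * z)" for t
    by (simp add: algebra_simps)
  have "((\<lambda>t. e * Re (cis t * z) - e * h t) has_real_derivative e * d - e * d) (at \<theta>)"
    by (intro DERIV_diff DERIV_cmult z' h')
  moreover have "kippenhahn_poly A (complex_of_real (e * h t)) t = 0" for t
    using lines_in_family[OF A R less_imp_le[OF C], of 1 "h t" t] e by (auto simp: h_def)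
  ultimately have "- pi < \<theta> \<and> \<theta> \<le> pi \<and>
      (\<forall>\<^sub>F t in nhds \<theta>. kippenhahn_poly A (complex_of_real (e * h t)) t = 0) \<and>
      Re (cis \<theta> * (complex_of_real e * z)) = e * h \<theta> \<and>
      ((\<lambda>t. Re (cis t * (complex_of_real e * z)) - e * h t) has_real_derivative 0) (at \<theta>)"
    unfolding Re_e val using bounds by simp
  then show ?thesis unfolding kippenhahn_curve_def by (intro CollectI exI[of _ \<theta>] exI[of _ "\<lambda>t. e * h t"])
qed

lemma (in focal) ellipse_sufficient:
  assumes A: "A \<in> reciprocal_mats n"
    and R: "even_poly n p X C (xi A) = 0" "odd_poly n p X C (xi A) = 0" and C: "0 < C"
  shows "\<exists>E. is_ellipse E \<and> E \<noteq> uminus ` E \<and> E \<union> uminus ` E \<subseteq> kippenhahn_curve A"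
proof (intro exI conjI)
  let ?f = "complex_of_real (p + X)" and ?g = "complex_of_real (p - X)" and ?a = "sqrt (C + X\<^sup>2)"
  let ?E = "{z. dist z ?f + dist z ?g = 2 * ?a}"
  have a: "X < ?a" using C X_pos by (intro real_less_rsqrt) simp
  have "dist ?f ?g < 2 * ?a" using a X_pos by (simp add: dist_real_def del: of_real_add of_real_diff)
  then show "is_ellipse ?E" unfolding is_ellipse_def by blast
  show "?E \<union> uminus ` ?E \<subseteq> kippenhahn_curve A"
    using ellipse_in_curve[OF A R C, of _ 1] ellipse_in_curve[OF A R C, of _ "- 1"] by auto
  \<comment> \<open>The right vertex distinguishes the two ellipses: the focal distances of its
    negative add up to \<open>2 * ?a + 4 * p\<close>.\<close>
  have "complex_of_real (p + ?a) \<in> ?E"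
    using a X_pos by (simp add: dist_real_def del: of_real_add of_real_diff)
  moreover have "complex_of_real (p + ?a) \<notin> uminus ` ?E"
  proof
    assume "complex_of_real (p + ?a) \<in> uminus ` ?E"
    then obtain z where "complex_of_real (p + ?a) = - z" "z \<in> ?E" by blast
    moreover from this have "z = complex_of_real (- (p + ?a))" by (metis minus_minus of_real_minus)
    ultimately have "complex_of_real (- (p + ?a)) \<in> ?E" by simp
    then show False
      using a X_pos p_pos by (simp add: dist_real_def del: of_real_add of_real_diff of_real_minus)
  qed
  ultimately show "?E \<noteq> uminus ` ?E" by blast
qed

section \<open>The equivalence\<close>

lemma focal_pairs_eq:
  assumes "A \<in> reciprocal_mats n"
  shows "focal_pairs A = {(p, X). focal n p X}"
proof -
  have ev: "eigenvalue A (complex_of_real r) \<longleftrightarrow> ctn (\<lambda>_. 1) r n = 0" for r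
  proof -
    have "ctn (\<lambda>_. 1) (complex_of_real r) n = complex_of_real (ctn (\<lambda>_. 1) r n)"
      by (simp only: of_real_hom.hom_ctn of_real_1)
    then show ?thesis unfolding eigenvalue_iff_ctn[OF assms] by simp
  qed
  show ?thesis unfolding focal_pairs_def focal_def ev by (auto simp: add_pos_pos)
qed

text \<open>A focal pair is determined by \<open>p + X > 0\<close> and \<open>p - X\<close>, an
  eigenvalue of either sign with smaller modulus. So each unordered pair of positive eigenvalues
  gives two focal pairs.\<close>

lemma card_focal:
  "card {(p, X). focal n p X} = n div 2 * (n div 2 - 1)"
proof -
  let ?m = "n div 2" and ?s = "cheb_root n"
  let ?I = "{(i, j). i \<in> {1..?m} \<and> j \<in> {1..?m} \<and> i \<noteq> j}"
  \<comment> \<open>The order of the indices encodes the sign: \<open>i < j\<close> gives the foci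
    \<open>?s i\<close> and \<open>?s j\<close>, otherwise they are \<open>?s j\<close> and
    \<open>- ?s i\<close>.\<close>
  define F where "F = (\<lambda>(i, j). if i < j then ((?s i + ?s j) / 2, (?s i - ?s j) / 2)
      else ((?s j - ?s i) / 2, (?s j + ?s i) / 2))"
  have pos: "0 < ?s i" if "i \<in> {1..?m}" for i
    using that cheb_root_pos[of i n] by auto
  have less: "?s j < ?s i" if "i < j" "j \<in> {1..?m}" for i j
    using that by (intro cheb_root_less) auto
  have inj_s: "i = j" if "?s i = ?s j" "i \<in> {1..?m}" "j \<in> {1..?m}" for i j
    using that less[of i j] less[of j i] by (cases i j rule: linorder_cases) auto
  have root: "ctn (\<lambda>_. 1) (?s i) n = 0" "ctn (\<lambda>_. 1) (- ?s i) n = 0" if "i \<in> {1..?m}" for i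
  proof -
    have "i \<in> {1..n}" using that by auto
    then show "ctn (\<lambda>_. 1) (?s i) n = 0" using ctn_one_roots[of n] by blast
    then show "ctn (\<lambda>_. 1) (- ?s i) n = 0" by (simp add: ctn_minus)
  qed
  have "bij_betw F ?I {(p, X). focal n p X}"
    unfolding bij_betw_def
  proof (intro conjI equalityI subsetI)
    have val: "fst (F (i, j)) + snd (F (i, j)) = (if i < j then ?s i else ?s j)"
      "fst (F (i, j)) - snd (F (i, j)) = (if i < j then ?s j else - ?s i)" for i j
      by (simp_all add: F_def field_simps)
    show "inj_on F ?I"
    proof (rule inj_onI, clarify)
      fix i j i' j'
      assume eq: "F (i, j) = F (i', j')" and ij: "i \<in> {1..?m}" "j \<in> {1..?m}" "i \<noteq> j"
        "i' \<in> {1..?m}" "j' \<in> {1..?m}" "i' \<noteq> j'"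
      have e: "(if i < j then ?s i else ?s j) = (if i' < j' then ?s i' else ?s j')"
        "(if i < j then ?s j else - ?s i) = (if i' < j' then ?s j' else - ?s i')"
        using val[of i j] val[of i' j'] eq by metis+
      \<comment> \<open>The sign of \<open>p - X\<close> tells the two cases apart.\<close>
      have "i < j \<longleftrightarrow> i' < j'"
        using e(2) pos ij by (smt (verit))
      then show "i = i' \<and> j = j'" using e ij inj_s by (auto split: if_splits)
    qed
    fix q assume "q \<in> F ` ?I"
    then obtain i j where ij: "q = F (i, j)" "i \<in> {1..?m}" "j \<in> {1..?m}" "i \<noteq> j" by blast
    show "q \<in> {(p, X). focal n p X}"
    proof (cases "i < j")
      case True
      then have "focal n ((?s i + ?s j) / 2) ((?s i - ?s j) / 2)"
        using ij pos[of i] pos[of j] less root by (intro focal_of_roots) auto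
      then show ?thesis using ij True by (simp add: F_def)
    next
      case False
      then have "focal n ((?s j + - ?s i) / 2) ((?s j - - ?s i) / 2)"
        using ij pos[of i] pos[of j] less[of j i] root by (intro focal_of_roots) auto
      then show ?thesis using ij False by (simp add: F_def)
    qed
  next
    fix q assume "q \<in> {(p, X). focal n p X}"
    then obtain p X where q: "q = (p, X)" and "focal n p X" by auto
    then interpret focal n p X by simp
    obtain k where k: "k \<in> {1..n}" "p + X = ?s k"
      using root_add ctn_one_roots[of n] by blast
    have kI: "k \<in> {1..?m}" using k cheb_root_pos[of k n] p_pos X_pos by auto
    obtain k1 where k1: "k1 \<in> {1..n}" "p - X = ?s k1"
      using root_diff ctn_one_roots[of n] by blast
    show "q \<in> F ` ?I"
    proof (cases "0 < p - X")
      case True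
      have k1I: "k1 \<in> {1..?m}" using k1 cheb_root_pos[of k1 n] True by auto
      have "?s k1 < ?s k" using k k1 X_pos by simp
      then have "k < k1" using less[of k1 k] kI by (cases k k1 rule: linorder_cases) auto
      moreover have "p = (?s k + ?s k1) / 2" "X = (?s k - ?s k1) / 2"
        unfolding k(2)[symmetric] k1(2)[symmetric] by simp_all
      ultimately show ?thesis unfolding q using kI k1I
        by (intro rev_image_eqI[of "(k, k1)"]) (auto simp: F_def)
    next
      case False
      define k2 where "k2 = Suc n - k1"
      have s2: "?s k2 = X - p" using k1 cheb_root_reflect[of k1 n] by (simp add: k2_def)
      moreover have "0 < X - p" using False p_ne_X by simp
      ultimately have k2I: "k2 \<in> {1..?m}" using k1 cheb_root_pos[of k2 n] by (auto simp: k2_def)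
      have "?s k2 < ?s k" using k s2 p_pos by simp
      then have "k < k2" using less[of k2 k] kI by (cases k k2 rule: linorder_cases) auto
      moreover have "p = (?s k - ?s k2) / 2" "X = (?s k + ?s k2) / 2"
        unfolding k(2)[symmetric] s2 by simp_all
      ultimately show ?thesis unfolding q using kI k2I
        by (intro rev_image_eqI[of "(k2, k)"]) (auto simp: F_def)
    qed
  qed
  then have "card {(p, X). focal n p X} = card ?I" by (simp add: bij_betw_same_card)
  also have "?I = {1..?m} \<times> {1..?m} - (\<lambda>i. (i, i)) ` {1..?m}" by auto
  also have "card \<dots> = ?m * ?m - ?m"
    by (subst card_Diff_subset) (auto simp: card_image inj_on_def)
  finally show ?thesis by (simp add: diff_mult_distrib2)
qed

theorem theorem5:
  fixes A :: "complex mat" and n m :: nat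
  assumes "A \<in> reciprocal_mats n" and "m = n div 2"
  shows
    "card (focal_pairs A) = m * (m - 1) \<and>
     (\<forall>(p, X) \<in> focal_pairs A.
        (\<forall>(C :: real) (x :: nat \<Rightarrow> real).
           represents_R_even n p X C x (R_even n p X C x) \<and>
           represents_R_odd n p X C x (R_odd n p X C x) \<and>
           degree (R_even n p X C x) \<le> m \<and> coeff (R_even n p X C x) m = 0 \<and>
           degree (R_odd n p X C x) \<le> m - 1 \<and> coeff (R_odd n p X C x) (m - 1) = 0) \<and>
        (\<forall>j\<le>m. homogeneous_form {0..<n} (m - j) (\<lambda>v. coeff (R_even n p X (v 0) v) j)) \<and>
        (\<forall>j\<le>m - 1. homogeneous_form {0..<n} (m - j - 1) (\<lambda>v. coeff (R_odd n p X (v 0) v) j)) \<and>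
        (\<exists>e. can_eliminate n p X e) \<and>
        (\<forall>e. can_eliminate n p X e \<longrightarrow>
           homogeneous_form {1..<n} 1 (elim_C n p X e) \<and>
           (\<forall>C x. elim_coeff n p X e C x = 0 \<longleftrightarrow> C = elim_C n p X e x) \<and>
           length (reduced_system n p X e) = 2 * m - 2 \<and>
           (\<forall>F \<in> set (reduced_system n p X e). \<exists>d. homogeneous_form {1..<n} d F))) \<and>
     (\<forall>e :: real \<Rightarrow> real \<Rightarrow> elim_source.
        (\<forall>(p, X) \<in> focal_pairs A. can_eliminate n p X (e p X)) \<longrightarrow>
        ((\<exists>E. is_ellipse E \<and> E \<noteq> uminus ` E \<and> E \<union> uminus ` E \<subseteq> kippenhahn_curve A) \<longleftrightarrow>
         (\<exists>(p, X) \<in> focal_pairs A.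
            solves (reduced_system n p X (e p X)) (xi A) \<and> 0 < elim_C n p X (e p X) (xi A))) \<and>
        ((\<exists>E. is_ellipse E \<and> E \<noteq> uminus ` E \<and> E \<union> uminus ` E \<subseteq> kippenhahn_curve A) \<or>
         (\<exists>f g. f \<noteq> g \<and> {f, g} \<inter> uminus ` {f, g} = {} \<and>
            (\<forall>h \<in> {f, g} \<union> uminus ` {f, g}. pencil_in_family A h)) \<longleftrightarrow>
         (\<exists>(p, X) \<in> focal_pairs A. solves (reduced_system n p X (e p X)) (xi A))))"
  (is "?card \<and> ?system \<and> (\<forall>e. ?elim e \<longrightarrow> (?ellipse \<longleftrightarrow> ?pos e) \<and> (?ellipse \<or> ?pencil \<longleftrightarrow> ?sol e))")
proof (intro conjI allI impI)
  note A = assms(1)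
  note pairs = focal_pairs_eq[OF A]
  show ?card unfolding pairs assms(2) by (rule card_focal)
  show ?system
  proof (rule ballI, clarify)
    fix p X assume "(p, X) \<in> focal_pairs A"
    then interpret focal n p X by (simp add: pairs)
    show "(\<forall>(C :: real) (x :: nat \<Rightarrow> real).
           represents_R_even n p X C x (R_even n p X C x) \<and>
           represents_R_odd n p X C x (R_odd n p X C x) \<and>
           degree (R_even n p X C x) \<le> m \<and> coeff (R_even n p X C x) m = 0 \<and>
           degree (R_odd n p X C x) \<le> m - 1 \<and> coeff (R_odd n p X C x) (m - 1) = 0) \<and>
        (\<forall>j\<le>m. homogeneous_form {0..<n} (m - j) (\<lambda>v. coeff (R_even n p X (v 0) v) j)) \<and>
        (\<forall>j\<le>m - 1. homogeneous_form {0..<n} (m - j - 1) (\<lambda>v. coeff (R_odd n p X (v 0) v) j)) \<and>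
        (\<exists>e. can_eliminate n p X e) \<and>
        (\<forall>e. can_eliminate n p X e \<longrightarrow>
           homogeneous_form {1..<n} 1 (elim_C n p X e) \<and>
           (\<forall>C x. elim_coeff n p X e C x = 0 \<longleftrightarrow> C = elim_C n p X e x) \<and>
           length (reduced_system n p X e) = 2 * m - 2 \<and>
           (\<forall>F \<in> set (reduced_system n p X e). \<exists>d. homogeneous_form {1..<n} d F))"
    proof (intro conjI allI impI ballI)
      show "represents_R_even n p X C x (R_even n p X C x)" for C x
        unfolding R_even by (rule represents_even_poly)
      show "represents_R_odd n p X C x (R_odd n p X C x)" for C x
        unfolding R_odd by (rule represents_odd_poly)
      show "degree (R_even n p X C x) \<le> m" "coeff (R_even n p X C x) m = 0" for C x
        unfolding R_even assms(2) by (rule degree_even, rule coeff_even_top)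
      show "degree (R_odd n p X C x) \<le> m - 1" "coeff (R_odd n p X C x) (m - 1) = 0" for C x
        unfolding R_odd assms(2) by (rule degree_odd, rule coeff_odd_top)
      show "homogeneous_form {0..<n} (m - j) (\<lambda>v. coeff (R_even n p X (v 0) v) j)" if "j \<le> m" for j
        using homogeneous_R(1) that unfolding assms(2) .
      show "homogeneous_form {0..<n} (m - j - 1) (\<lambda>v. coeff (R_odd n p X (v 0) v) j)"
        if "j \<le> m - 1" for j
        using homogeneous_R(2) that unfolding assms(2) .
      show "\<exists>e. can_eliminate n p X e" by (rule ex_can_eliminate)
      show "homogeneous_form {1..<n} 1 (elim_C n p X e)" for e by (rule homogeneous_elim_C)
      show "elim_coeff n p X e C x = 0 \<longleftrightarrow> C = elim_C n p X e x" if "can_eliminate n p X e" for e C x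
        using that by (rule elim_coeff_eq_0_iff)
      show "length (reduced_system n p X e) = 2 * m - 2" for e
        unfolding assms(2) by (rule length_reduced_system)
      show "\<exists>d. homogeneous_form {1..<n} d F" if "F \<in> set (reduced_system n p X e)" for e F
        using that by (rule homogeneous_reduced_system)
    qed
  qed
  fix e assume e: "?elim e"
  have elim: "can_eliminate n p X (e p X)" if "focal n p X" for p X
    using e that unfolding pairs by blast
  have sys: "solves (reduced_system n p X (e p X)) (xi A) \<longleftrightarrow>
      even_poly n p X (elim_C n p X (e p X) (xi A)) (xi A) = 0 \<and>
      odd_poly n p X (elim_C n p X (e p X) (xi A)) (xi A) = 0" if "focal n p X" for p X
    by (rule focal.solves_iff[OF that elim[OF that]])
  have solution: "C = elim_C n p X (e p X) (xi A) \<and> solves (reduced_system n p X (e p X)) (xi A)"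
    if "focal n p X" "even_poly n p X C (xi A) = 0" "odd_poly n p X C (xi A) = 0" for p X C
    using focal.elim_C_eqI[OF that(1) elim[OF that(1)] that(2,3)] sys[OF that(1)] that(2,3) by simp
  have necessary: "?pos e" if "?ellipse"
  proof -
    obtain E where E: "is_ellipse E" "E \<noteq> uminus ` E" "E \<union> uminus ` E \<subseteq> kippenhahn_curve A"
      using \<open>?ellipse\<close> by blast
    obtain p X C where F: "focal n p X" and C: "0 < C"
      and R: "even_poly n p X C (xi A) = 0" "odd_poly n p X C (xi A) = 0"
      using ellipse_necessary[OF A E] by blast
    show ?thesis
      by (rule bexI[of _ "(p, X)"]) (use solution[OF F R] C F in \<open>auto simp: pairs\<close>)
  qed
  have sufficient: "?ellipse"
    if "focal n p X" "solves (reduced_system n p X (e p X)) (xi A)" "0 < elim_C n p X (e p X) (xi A)" for p X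
    by (rule focal.ellipse_sufficient[OF that(1) A _ _ that(3)]) (use that(2) sys[OF that(1)] in auto)
  show "?ellipse \<longleftrightarrow> ?pos e"
  proof
    assume "?pos e"
    then obtain p X where "focal n p X" "solves (reduced_system n p X (e p X)) (xi A)"
      "0 < elim_C n p X (e p X) (xi A)" by (auto simp: pairs)
    then show "?ellipse" by (rule sufficient)
  qed (rule necessary)
  show "?ellipse \<or> ?pencil \<longleftrightarrow> ?sol e"
  proof
    assume "?ellipse \<or> ?pencil"
    then show "?sol e"
    proof
      assume "?ellipse"
      then have "?pos e" by (rule necessary)
      then show ?thesis by auto
    next
      assume "?pencil"
      then obtain f g where fg: "f \<noteq> g" "{f, g} \<inter> uminus ` {f, g} = {}"
        "\<forall>h\<in>{f, g} \<union> uminus ` {f, g}. pencil_in_family A h" by blast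
      obtain p X where F: "focal n p X"
        and R: "even_poly n p X 0 (xi A) = 0" "odd_poly n p X 0 (xi A) = 0"
        using pencil_necessary[OF A fg] by blast
      show ?thesis
        by (rule bexI[of _ "(p, X)"]) (use solution[OF F R] F in \<open>auto simp: pairs\<close>)
    qed
  next
    assume "?sol e"
    then obtain p X where F: "focal n p X" and s: "solves (reduced_system n p X (e p X)) (xi A)"
      by (auto simp: pairs)
    let ?C = "elim_C n p X (e p X) (xi A)"
    have R: "even_poly n p X ?C (xi A) = 0" "odd_poly n p X ?C (xi A) = 0" using s sys[OF F] by auto
    \<comment> \<open>The two remaining cases are a genuine ellipse and one whose dual conic has
      degenerated to the pencils through its foci.\<close>
    have "0 \<le> ?C" by (rule focal.C_nonneg[OF F xi_nonneg R])
    then consider "0 < ?C" | "?C = 0" by linarith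
    then show "?ellipse \<or> ?pencil"
    proof cases
      case 1
      have "?ellipse" by (rule sufficient[OF F s 1])
      then show ?thesis by (rule disjI1)
    next
      case 2
      have "?pencil" by (rule focal.pencil_sufficient[OF F A R[unfolded 2]])
      then show ?thesis by (rule disjI2)
    qed
  qed
qed

end
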